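(* Let $\mathcal{M}\subseteq\mathbb{R}^d$ be a compact smooth manifold without boundary. Let $g_1,\dots,g_m:\mathbb{R}^d\to\mathbb{R}^d$ be smooth vector fields with $g_i(x)\in T_x\mathcal{M}$ for all $x\in\mathcal{M}$ and all $i$, and suppose $\mathcal{V}=\{g_1,\dots,g_m\}$ is bracket generating on $\mathcal{M}$, i.e. $\mathrm{Lie}_x\mathcal{V}=T_x\mathcal{M}$ for all $x\in\mathcal{M}$. Let $\sigma:\mathbb{R}\to\mathbb{R}$ be an activation function satisfying the Regularity and Density of superpositions assumptions. Let $Y\in\mathrm{Diff}_0(\mathcal{M})$ and $\epsilon>0$. Then there exist piecewise constant functions $a_i:[0,1]\to\mathbb{R}$, $w_i:[0,1]\to\mathbb{R}^d$, $b_i:[0,1]\to\mathbb{R}$, $i=1,\dots,m$, such that the flow map $X:\mathcal{M}\to\mathcal{M}$, defined by $X(x_0)=x(1)$ for all $x_0\in\mathcal{M}$, where $x(\cdot)$ is the solution of $$\dot{x}(t)=\sum_{i=1}^m a_i(t)\,g_i(x(t))\,\sigma\big(w_i(t)^T x(t)+b_i(t)\big),\qquad x(0)=x_0,$$ satisfies $$\sup_{x\in\mathcal{M}}|X(x)-Y(x)|\le\frac{\epsilon}{2}.$$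
   Context: $\mathcal{M}$ is embedded in $\mathbb{R}^d$ and $T_x\mathcal{M}\subseteq\mathbb{R}^d$ denotes its tangent space at $x$; $|\cdot|$ is the Euclidean norm. $\mathrm{Diff}_0(\mathcal{M})$ is the set of diffeomorphisms $X$ of $\mathcal{M}$ isotopic to the identity map $I$: there is a smooth map $H:[0,1]\times\mathcal{M}\to\mathcal{M}$ with $H(t,\cdot)$ a diffeomorphism for every $t$, $H(0,\cdot)=I$ and $H(1,\cdot)=X$. The Lie bracket of vector fields $f,g$ on $\mathbb{R}^d$ is $[f,g]^i(x)=\sum_{j=1}^d\big(f^j(x)\frac{\partial g^i}{\partial x^j}(x)-g^j(x)\frac{\partial f^i}{\partial x^j}(x)\big)$. For a finite set $\mathcal{V}$ of vector fields put $\mathcal{V}^0=\mathcal{V}$ and, for $i\ge1$, $\mathcal{V}^i=\{[g,h] : g,h\in\bigcup_{j=0}^{i-1}\mathcal{V}^j\}$; then $\mathrm{Lie}_x\mathcal{V}=\mathrm{span}\{g(x) : g\in\mathcal{V}^i,\ i=0,1,2,\dots\}$. Assumptions on $\sigma$. (Regularity) There is $K>0$ with $|\sigma(x)-\sigma(y)|\le K|x-y|$ for all $x,y\in\mathbb{R}$. (Density of superpositions) Let $\mathcal{F}=\bigcup_{k\in\mathbb{Z}_+}\{x\mapsto\sum_{i=1}^k\alpha_i\sigma(w_i^Tx+b_i) : \alpha_i\in\mathbb{R},\ w_i\in\mathbb{R}^d,\ b_i\in\mathbb{R}\}$. For every $f\in C^1(\mathbb{R}^d;\mathbb{R})$, $R>0$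 and $\delta>0$ there is $h\in\mathcal{F}$ with $|f(x)-h(x)|+\sum_{i=1}^d\big|\frac{\partial f}{\partial x_i}(x)-\frac{\partial h}{\partial x_i}(x)\big|<\delta$ for Lebesgue almost every $x$ in the ball $\{x\in\mathbb{R}^d:|x|<R\}$. Piecewise constant functions of time have finitely many pieces on $[0,1]$; solutions of the ODE are absolutely continuous and satisfy it for almost every $t$. *)

theory Defs
  imports "HOL-Analysis.Analysis"
begin

text \<open>
  The domain \<open>U\<close> is meant to be open. All derivatives up to order \<open>k\<close> are tested through
  iterated directional derivatives, so that the codomain stays the same along the recursion.
\<close>

primrec Ck_on :: "nat \<Rightarrow> 'a::euclidean_space set \<Rightarrow> ('a \<Rightarrow> 'b::real_normed_vector) \<Rightarrow> bool" where
  "Ck_on 0 U f \<longleftrightarrow> continuous_on U f"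
| "Ck_on (Suc k) U f \<longleftrightarrow>
     (\<forall>x\<in>U. f differentiable (at x)) \<and>
     (\<forall>v. Ck_on k U (\<lambda>x. frechet_derivative f (at x) v))"

definition smooth_on :: "'a::euclidean_space set \<Rightarrow> ('a \<Rightarrow> 'b::real_normed_vector) \<Rightarrow> bool" where
  "smooth_on U f \<longleftrightarrow> (\<forall>k. Ck_on k U f)"

text \<open>
  Smoothness of a map on an arbitrary subset of Euclidean space: local extendability to a smooth
  map on an open set. For embedded submanifolds \<open>M\<close>, and for \<open>{0..1} \<times> M\<close> (a manifold with
  boundary), this is the usual smoothness in charts.
\<close>

definition smooth_map_on :: "'a::euclidean_space set \<Rightarrow> ('a \<Rightarrow> 'b::real_normed_vector) \<Rightarrow> bool" where
  "smooth_map_on S f \<longleftrightarrow>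
     (\<forall>x\<in>S. \<exists>U F. open U \<and> x \<in> U \<and> smooth_on U F \<and> (\<forall>y\<in>S \<inter> U. F y = f y))"

text \<open>
  Embedded \<open>k\<close>-dimensional submanifold without boundary, by slice charts. The model space
  \<open>\<real>\<^sup>k\<close> appears as a \<open>k\<close>-dimensional linear subspace \<open>S\<close> of the ambient space.
\<close>

definition smooth_submanifold :: "nat \<Rightarrow> 'a::euclidean_space set \<Rightarrow> bool" where
  "smooth_submanifold k M \<longleftrightarrow>
     (\<forall>x\<in>M. \<exists>U W \<phi> \<psi> (S :: 'a set).
        open U \<and> x \<in> U \<and> open W \<and> homeomorphism U W \<phi> \<psi> \<and>
        smooth_on U \<phi> \<and> smooth_on W \<psi> \<and>
        subspace S \<and> dim S = k \<and> \<phi> ` (U \<inter> M) = W \<inter> S)"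

definition tangent_space :: "'a::euclidean_space set \<Rightarrow> 'a \<Rightarrow> 'a set" where
  "tangent_space M x =
     {v. \<exists>\<delta> \<gamma>. \<delta> > 0 \<and> smooth_on {-\<delta><..<\<delta>} \<gamma> \<and> \<gamma> ` {-\<delta><..<\<delta>} \<subseteq> M \<and>
           \<gamma> (0::real) = x \<and> (\<gamma> has_vector_derivative v) (at 0)}"

definition diffeo_on :: "'a::euclidean_space set \<Rightarrow> ('a \<Rightarrow> 'a) \<Rightarrow> bool" where
  "diffeo_on M X \<longleftrightarrow>
     bij_betw X M M \<and> smooth_map_on M X \<and> smooth_map_on M (inv_into M X)"

text \<open>Only the values on \<open>M\<close> of the members of \<open>Diff0 M\<close> are meaningful.\<close>

definition Diff0 :: "'a::euclidean_space set \<Rightarrow> ('a \<Rightarrow> 'a) set" where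
  "Diff0 M =
     {X. diffeo_on M X \<and>
         (\<exists>H :: real \<times> 'a \<Rightarrow> 'a.
            smooth_map_on ({0..1} \<times> M) H \<and>
            (\<forall>t\<in>{0..1}. diffeo_on M (\<lambda>x. H (t, x))) \<and>
            (\<forall>x\<in>M. H (0, x) = x) \<and>
            (\<forall>x\<in>M. H (1, x) = X x))}"

definition has_partial :: "'d::finite \<Rightarrow> (real ^ 'd \<Rightarrow> real) \<Rightarrow> real ^ 'd \<Rightarrow> bool" where
  "has_partial j f x \<longleftrightarrow> (\<lambda>t::real. f (x + t *\<^sub>R axis j 1)) differentiable (at 0)"

text \<open>\<open>partial j f x\<close> is unspecified unless \<open>has_partial j f x\<close>.\<close>

definition partial :: "'d::finite \<Rightarrow> (real ^ 'd \<Rightarrow> real) \<Rightarrow> real ^ 'd \<Rightarrow> real" where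
  "partial j f x = deriv (\<lambda>t::real. f (x + t *\<^sub>R axis j 1)) 0"

definition lie_bracket ::
  "(real ^ 'd \<Rightarrow> real ^ 'd) \<Rightarrow> (real ^ 'd \<Rightarrow> real ^ 'd) \<Rightarrow> real ^ 'd \<Rightarrow> real ^ 'd::finite" where
  "lie_bracket f g x =
     (\<chi> i. \<Sum>j\<in>UNIV. f x $ j * partial j (\<lambda>y. g y $ i) x - g x $ j * partial j (\<lambda>y. f y $ i) x)"

fun bracket_level ::
  "(real ^ 'd \<Rightarrow> real ^ 'd) set \<Rightarrow> nat \<Rightarrow> (real ^ 'd \<Rightarrow> real ^ 'd::finite) set" where
  "bracket_level V i =
     (if i = 0 then V
      else {lie_bracket g h | g h.
              g \<in> (\<Union>j\<in>{..<i}. bracket_level V j) \<and> h \<in> (\<Union>j\<in>{..<i}. bracket_level V j)})"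

declare bracket_level.simps [simp del]

definition Lie_at :: "(real ^ 'd \<Rightarrow> real ^ 'd) set \<Rightarrow> real ^ 'd \<Rightarrow> (real ^ 'd::finite) set" where
  "Lie_at V x = span {g x | g. \<exists>i. g \<in> bracket_level V i}"

definition superpositions :: "(real \<Rightarrow> real) \<Rightarrow> (real ^ 'd::finite \<Rightarrow> real) set" where
  "superpositions \<sigma> =
     {h. \<exists>k\<ge>1. \<exists>(\<alpha> :: nat \<Rightarrow> real) w (b :: nat \<Rightarrow> real).
           h = (\<lambda>x. \<Sum>i=1..k. \<alpha> i * \<sigma> (w i \<bullet> x + b i))}"

definition regular_activation :: "(real \<Rightarrow> real) \<Rightarrow> bool" where
  "regular_activation \<sigma> \<longleftrightarrow> (\<exists>K>0. \<forall>x y. \<bar>\<sigma> x - \<sigma> y\<bar> \<le> K * \<bar>x - y\<bar>)"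

text \<open>
  The dimension is passed as the type argument \<open>'d\<close>. The partial derivatives of \<open>h\<close> only exist
  almost everywhere (\<open>\<sigma>\<close> is merely Lipschitz), so their existence is part of the
  almost-everywhere statement.
\<close>

definition dense_superpositions :: "'d::finite itself \<Rightarrow> (real \<Rightarrow> real) \<Rightarrow> bool" where
  "dense_superpositions _ \<sigma> \<longleftrightarrow>
     (\<forall>(f :: real ^ 'd \<Rightarrow> real) R \<delta>. Ck_on 1 UNIV f \<and> R > 0 \<and> \<delta> > 0 \<longrightarrow>
        (\<exists>h\<in>superpositions \<sigma>.
           AE x in lebesgue. norm x < R \<longrightarrow>
             (\<forall>i. has_partial i h x) \<and>
             \<bar>f x - h x\<bar> + (\<Sum>i\<in>UNIV. \<bar>partial i f x - partial i h x\<bar>) < \<delta>))"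

text \<open>The values at the finitely many break points are unconstrained.\<close>

definition piecewise_constant :: "(real \<Rightarrow> 'a) \<Rightarrow> bool" where
  "piecewise_constant f \<longleftrightarrow>
     (\<exists>(n::nat) \<tau>. \<tau> 0 = 0 \<and> \<tau> n = 1 \<and> (\<forall>i<n. \<tau> i < \<tau> (Suc i)) \<and>
        (\<forall>i<n. \<exists>c. \<forall>t\<in>{\<tau> i<..<\<tau> (Suc i)}. f t = c))"

definition abs_continuous_on_interval ::
  "real \<Rightarrow> real \<Rightarrow> (real \<Rightarrow> 'a::real_normed_vector) \<Rightarrow> bool" where
  "abs_continuous_on_interval l u x \<longleftrightarrow>
     (\<forall>\<epsilon>>0. \<exists>\<delta>>0. \<forall>(n::nat) p q.
        (\<forall>i<n. l \<le> p i \<and> p i \<le> q i \<and> q i \<le> u) \<and>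
        disjoint_family_on (\<lambda>i. {p i<..<q i}) {..<n} \<and>
        (\<Sum>i<n. q i - p i) < \<delta> \<longrightarrow>
        (\<Sum>i<n. norm (x (q i) - x (p i))) < \<epsilon>)"

definition ode_solution ::
  "(real \<Rightarrow> 'a \<Rightarrow> 'a) \<Rightarrow> 'a \<Rightarrow> (real \<Rightarrow> 'a::euclidean_space) \<Rightarrow> bool" where
  "ode_solution F x0 x \<longleftrightarrow>
     abs_continuous_on_interval 0 1 x \<and> x 0 = x0 \<and>
     (AE t in lebesgue. t \<in> {0..1} \<longrightarrow>
        (x has_vector_derivative F t (x t)) (at t within {0..1}))"

text \<open>
  \<open>X\<close> is the time-one flow map \<open>M \<rightarrow> M\<close> of \<open>F\<close>: every initial value in \<open>M\<close> has exactly one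
  solution on \<open>{0..1}\<close> in the whole ambient space, and it ends at \<open>X x0 \<in> M\<close>.
\<close>

definition is_flow_map ::
  "'a::euclidean_space set \<Rightarrow> (real \<Rightarrow> 'a \<Rightarrow> 'a) \<Rightarrow> ('a \<Rightarrow> 'a) \<Rightarrow> bool" where
  "is_flow_map M F X \<longleftrightarrow>
     X \<in> M \<rightarrow> M \<and>
     (\<forall>x0\<in>M. \<exists>x. ode_solution F x0 x \<and> X x0 = x 1 \<and>
        (\<forall>y. ode_solution F x0 y \<longrightarrow> (\<forall>t\<in>{0..1}. y t = x t)))"

end

theory Submission
  imports Defs
begin

text \<open>
  Call a field \<open>W\<close> tangent to \<open>M\<close> approximable if, for small \<open>s\<close>, some uniform limit of realizable maps
  equals \<open>x + s W(x) + o(s)\<close> uniformly on \<open>M\<close>. Approximable fields are closed under sums and uniform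
  limits, and by an Euler scheme the flow of a Lipschitz approximable field is a uniform limit of
  realizable maps. Hence they are closed under brackets too: the commutator of the flows of
  \<open>\<plusminus>f\<close>, \<open>\<plusminus>h\<close> at time \<open>\<surd>s\<close> is \<open>x + s [f, h](x) + o(s)\<close>.

  By density of superpositions \<open>c g\<^sub>i\<close> is approximable for every smooth function \<open>c\<close>, and
  \<open>c [f, h] = [c f, h] + (Dc h) f\<close> carries this to all iterated brackets of the \<open>g\<^sub>i\<close>. These span the
  tangent spaces, so a partition of unity shows that every continuous tangent field is approximable.
  Finally, an isotopy from the identity to \<open>Y\<close> is the flow of a time-dependent tangent field that is
  Lipschitz uniformly in time, and the Euler scheme applies once more.
\<close>

section \<open>Smooth functions\<close>

text \<open>The scheme is shaped by a lack of regularity. The fields that a control produces contain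
  \<open>\<sigma>\<close> and are merely locally Lipschitz, so their brackets need not be defined.
  Approximability asks for one first-order step only and therefore survives uniform limits: the
  fields containing \<open>\<sigma>\<close> are replaced by smooth ones before any bracket is
  formed. For the same reason a tangent field that is only continuous, and may have no well-defined
  flow, can be approximable. In the Euler scheme errors are propagated with the Lipschitz constant
  of the limiting field alone. The approximating maps have to be close to a step in the supremum
  norm; the Lipschitz constants of the controls behind them, which may blow up, never enter.
  Realizable maps are composed but never inverted: the backward flows in a commutator are flows of
  negated fields, and closure under multiplication by smooth functions supplies the sign.\<close>

abbreviation fderiv ::
  "('a::real_normed_vector \<Rightarrow> 'b::real_normed_vector) \<Rightarrow> 'a \<Rightarrow> 'a \<Rightarrow> 'b" where
  "fderiv f x \<equiv> frechet_derivative f (at x)"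

lemma Ck_on_cong:
  assumes "open U" "\<And>x. x \<in> U \<Longrightarrow> f x = g x" "Ck_on k U f"
  shows "Ck_on k U g"
  using assms(2,3)
proof (induction k arbitrary: f g)
  case 0
  then show ?case by (metis Ck_on.simps(1) continuous_on_cong)
next
  case (Suc k)
  have d: "f differentiable (at x)" if "x \<in> U" for x
    using Suc.prems(2) that by simp
  have "g differentiable (at x)" if "x \<in> U" for x
    using d[OF that] Suc.prems(1) assms(1) that
    by (metis differentiable_def has_derivative_transform_within_open)
  moreover have "Ck_on k U (\<lambda>x. fderiv g x v)" for v
  proof (rule Suc.IH)
    show "Ck_on k U (\<lambda>x. fderiv f x v)"
      using Suc.prems(2) by simp
    show "fderiv f x v = fderiv g x v" if "x \<in> U" for x
      using frechet_derivative_transform_within_open[OF d[OF that] assms(1) that, of g] Suc.prems(1)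
      by simp
  qed
  ultimately show ?case by simp
qed

text \<open>\<open>frechet_derivative\<close> is a choice operator. This rule allows an explicit
  derivative formula instead, which has to be correct on \<open>U\<close> only, since
  \<open>Ck_on\<close> on an open set ignores values outside.\<close>

lemma Ck_on_SucI:
  assumes "open U" "\<And>x. x \<in> U \<Longrightarrow> (f has_derivative f' x) (at x)"
    "\<And>v. Ck_on k U (\<lambda>x. f' x v)"
  shows "Ck_on (Suc k) U f"
proof -
  have "Ck_on k U (\<lambda>x. fderiv f x v)" for v
    by (rule Ck_on_cong[OF assms(1) _ assms(3)[of v]])
       (simp add: frechet_derivative_at[OF assms(2), symmetric])
  then show ?thesis
    using assms(2) by (auto simp: differentiable_def)
qed

lemma Ck_on_Suc_has_derivative:
  assumes "Ck_on (Suc k) U f" "x \<in> U"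
  shows "(f has_derivative fderiv f x) (at x)"
  using assms by (simp add: frechet_derivative_works[symmetric])

lemma Ck_on_SucD: "Ck_on (Suc k) U f \<Longrightarrow> Ck_on k U f"
proof (induction k arbitrary: f)
  case 0
  then show ?case
    by (auto intro!: differentiable_imp_continuous_on
        simp: differentiable_on_def differentiable_at_withinI)
next
  case (Suc k)
  then show ?case by (metis Ck_on.simps(2))
qed

lemma Ck_on_const: "Ck_on k U (\<lambda>x. c)"
  by (induction k arbitrary: c) auto

lemma Ck_on_bounded_linear:
  assumes "open U" "bounded_linear L" "Ck_on k U f"
  shows "Ck_on k U (\<lambda>x. L (f x))"
  using assms(3)
proof (induction k arbitrary: f)
  case 0
  then show ?case
    by (simp add: assms(2) bounded_linear.continuous_on)
next
  case (Suc k)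
  show ?case
  proof (rule Ck_on_SucI[OF assms(1)])
    show "((\<lambda>x. L (f x)) has_derivative (\<lambda>v. L (fderiv f x v))) (at x)"
      if "x \<in> U" for x
      by (rule bounded_linear.has_derivative[OF assms(2) Ck_on_Suc_has_derivative[OF Suc.prems that]])
    show "Ck_on k U (\<lambda>x. L (fderiv f x v))" for v
      using Suc.prems by (intro Suc.IH) simp
  qed
qed

lemma Ck_on_linear:
  assumes "open U" "bounded_linear f"
  shows "Ck_on k U f"
proof (cases k)
  case 0
  then show ?thesis
    using linear_continuous_on[OF assms(2)] by simp
next
  case (Suc j)
  show ?thesis unfolding Suc
    by (rule Ck_on_SucI[OF assms(1), where f' = "\<lambda>x. f"])
       (auto intro: bounded_linear_imp_has_derivative assms(2) Ck_on_const)
qed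

lemma Ck_on_add:
  assumes "open U" "Ck_on k U f" "Ck_on k U g"
  shows "Ck_on k U (\<lambda>x. f x + g x)"
  using assms(2,3)
proof (induction k arbitrary: f g)
  case 0
  then show ?case by (simp add: continuous_on_add)
next
  case (Suc k)
  show ?case
  proof (rule Ck_on_SucI[OF assms(1)])
    show "((\<lambda>x. f x + g x) has_derivative
        (\<lambda>v. fderiv f x v + fderiv g x v)) (at x)"
      if "x \<in> U" for x
      using Suc.prems that by (intro has_derivative_add Ck_on_Suc_has_derivative) auto
    show "Ck_on k U (\<lambda>x. fderiv f x v + fderiv g x v)" for v
      using Suc.prems by (intro Suc.IH) simp_all
  qed
qed

lemma Ck_on_scaleR:
  fixes c :: "'a::euclidean_space \<Rightarrow> real"
  assumes "open U" "Ck_on k U c" "Ck_on k U f"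
  shows "Ck_on k U (\<lambda>x. c x *\<^sub>R f x)"
  using assms(2,3)
proof (induction k arbitrary: c f)
  case 0
  then show ?case by (simp add: continuous_on_scaleR)
next
  case (Suc k)
  show ?case
  proof (rule Ck_on_SucI[OF assms(1)])
    show "((\<lambda>x. c x *\<^sub>R f x) has_derivative
        (\<lambda>v. c x *\<^sub>R fderiv f x v + fderiv c x v *\<^sub>R f x)) (at x)"
      if "x \<in> U" for x
      using Suc.prems that by (intro has_derivative_scaleR Ck_on_Suc_has_derivative) auto
    show "Ck_on k U (\<lambda>x. c x *\<^sub>R fderiv f x v + fderiv c x v *\<^sub>R f x)" for v
      \<comment> \<open>The product rule mixes derivatives with the undifferentiated factors, so the
        latter are needed at order \<open>k\<close> as well.\<close>
      using Suc.prems Suc.prems[THEN Ck_on_SucD]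
      by (intro Ck_on_add[OF assms(1)] Suc.IH) simp_all
  qed
qed

lemma Ck_on_sum:
  assumes "open U" "\<And>i. i \<in> I \<Longrightarrow> Ck_on k U (f i)"
  shows "Ck_on k U (\<lambda>x. \<Sum>i\<in>I. f i x)"
  using assms(2)
  by (induction I rule: infinite_finite_induct) (auto intro: Ck_on_const Ck_on_add[OF assms(1)])

lemma smooth_on_const: "smooth_on U (\<lambda>x. c)"
  by (simp add: smooth_on_def Ck_on_const)

lemma smooth_on_linear: "open U \<Longrightarrow> bounded_linear f \<Longrightarrow> smooth_on U f"
  by (simp add: smooth_on_def Ck_on_linear)

lemma smooth_on_bounded_linear:
  "open U \<Longrightarrow> bounded_linear L \<Longrightarrow> smooth_on U f \<Longrightarrow> smooth_on U (\<lambda>x. L (f x))"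
  by (simp add: smooth_on_def Ck_on_bounded_linear)

lemma smooth_on_add:
  "open U \<Longrightarrow> smooth_on U f \<Longrightarrow> smooth_on U g \<Longrightarrow> smooth_on U (\<lambda>x. f x + g x)"
  by (simp add: smooth_on_def Ck_on_add)

lemma smooth_on_scaleR:
  fixes c :: "'a::euclidean_space \<Rightarrow> real"
  shows "open U \<Longrightarrow> smooth_on U c \<Longrightarrow> smooth_on U f \<Longrightarrow> smooth_on U (\<lambda>x. c x *\<^sub>R f x)"
  by (simp add: smooth_on_def Ck_on_scaleR)

lemma smooth_on_minus: "open U \<Longrightarrow> smooth_on U f \<Longrightarrow> smooth_on U (\<lambda>x. - f x)"
  using smooth_on_bounded_linear[of U uminus f] by (simp add: bounded_linear_minus bounded_linear_ident)

lemma smooth_on_sum: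
  "open U \<Longrightarrow> (\<And>i. i \<in> I \<Longrightarrow> smooth_on U (f i)) \<Longrightarrow> smooth_on U (\<lambda>x. \<Sum>i\<in>I. f i x)"
  by (simp add: smooth_on_def Ck_on_sum)

lemma smooth_on_has_derivative:
  "smooth_on U f \<Longrightarrow> x \<in> U \<Longrightarrow> (f has_derivative fderiv f x) (at x)"
  using Ck_on_Suc_has_derivative unfolding smooth_on_def by blast

lemma smooth_on_directional:
  "smooth_on U f \<Longrightarrow> smooth_on U (\<lambda>x. fderiv f x v)"
  unfolding smooth_on_def by (metis Ck_on.simps(2))

lemma smooth_on_continuous_on: "smooth_on U f \<Longrightarrow> continuous_on U f"
  by (metis Ck_on.simps(1) smooth_on_def)

text \<open>\<open>Ck_on\<close> differentiates in constant directions only. Expanding the variable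
  direction \<open>h x\<close> in coordinates leaves a finite sum of products of smooth
  functions.\<close>

lemma smooth_on_derivative_along:
  fixes f :: "'a::euclidean_space \<Rightarrow> 'b::real_normed_vector" and h :: "'a \<Rightarrow> 'a"
  assumes "open U" "smooth_on U f" "smooth_on U h"
  shows "smooth_on U (\<lambda>x. fderiv f x (h x))"
proof -
  have eq: "(\<Sum>b\<in>Basis. (h x \<bullet> b) *\<^sub>R fderiv f x b) = fderiv f x (h x)"
    if "x \<in> U" for x
  proof -
    interpret bounded_linear "fderiv f x"
      using smooth_on_has_derivative[OF assms(2) that] has_derivative_bounded_linear by blast
    show ?thesis
      using arg_cong[OF euclidean_representation[of "h x"], of "fderiv f x"]
      by (simp add: sum scale)
  qed
  have "smooth_on U (\<lambda>x. \<Sum>b\<in>Basis. (h x \<bullet> b) *\<^sub>R fderiv f x b)"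
    by (intro smooth_on_sum smooth_on_scaleR assms(1) smooth_on_directional[OF assms(2)]
        smooth_on_bounded_linear[OF _ bounded_linear_inner_left] assms(3))
  then show ?thesis
    unfolding smooth_on_def using Ck_on_cong[OF assms(1), rotated, OF _ eq] by simp
qed

lemma smooth_on_polynomial: "real_polynomial_function p \<Longrightarrow> smooth_on UNIV p"
proof (induction rule: real_polynomial_function.induct)
  case (mult f g)
  then show ?case using smooth_on_scaleR[of UNIV f g] by simp
qed (auto intro: smooth_on_linear smooth_on_const smooth_on_add)

text \<open>With an affine inner map the chain rule yields \<open>fderiv F (a + L s) (L v)\<close>,
  again a composition of the same form with a directional derivative of \<open>F\<close>, so the
  induction on the order closes. It turns the time slices of an isotopy into smooth curves.\<close>

lemma smooth_on_affine_compose: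
  fixes F :: "'b::euclidean_space \<Rightarrow> 'c::real_normed_vector" and L :: "'a::euclidean_space \<Rightarrow> 'b"
  assumes "open U" "open V" "bounded_linear L" "\<And>s. s \<in> V \<Longrightarrow> a + L s \<in> U" "smooth_on U F"
  shows "smooth_on V (\<lambda>s. F (a + L s))"
proof -
  have "Ck_on k V (\<lambda>s. F (a + L s))" if "Ck_on k U F" for k
    using that
  proof (induction k arbitrary: F)
    case 0
    have "continuous_on V (\<lambda>s. a + L s)"
      by (intro continuous_intros bounded_linear.continuous_on[OF assms(3)])
    with 0 assms(4) show ?case
      by (auto intro: continuous_on_compose2[of U F])
  next
    case (Suc k)
    show ?case
    proof (rule Ck_on_SucI[OF assms(2)])
      show "((\<lambda>s. F (a + L s)) has_derivative (\<lambda>v. fderiv F (a + L s) (L v))) (at s)"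
        if "s \<in> V" for s
      proof -
        have "((\<lambda>s. a + L s) has_derivative L) (at s)"
          using has_derivative_add[OF has_derivative_const bounded_linear_imp_has_derivative[OF assms(3)]]
          by simp
        from has_derivative_compose[OF this Ck_on_Suc_has_derivative[OF Suc.prems assms(4)[OF that]]]
        show ?thesis .
      qed
      show "Ck_on k V (\<lambda>s. fderiv F (a + L s) (L v))" for v
        using Suc.prems by (intro Suc.IH) simp
    qed
  qed
  then show ?thesis
    using assms(5) by (simp add: smooth_on_def)
qed

section \<open>Uniform linear approximation on compact sets\<close>

text \<open>Reduces operator norms to finitely many directional derivatives, the only data whose
  continuity \<open>Ck_on\<close> provides.\<close>

lemma onorm_le_Basis_sum:
  fixes L :: "'a::euclidean_space \<Rightarrow> 'b::real_normed_vector"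
  assumes "bounded_linear L"
  shows "onorm L \<le> (\<Sum>b\<in>Basis. norm (L b))"
proof (rule onorm_le)
  fix x
  interpret bounded_linear L by fact
  have "L x = (\<Sum>b\<in>Basis. (x \<bullet> b) *\<^sub>R L b)"
    using arg_cong[OF euclidean_representation[of x], of L] by (simp add: sum scale)
  also have "norm \<dots> \<le> (\<Sum>b\<in>Basis. norm ((x \<bullet> b) *\<^sub>R L b))"
    by (rule norm_sum)
  also have "\<dots> \<le> (\<Sum>b\<in>Basis. norm x * norm (L b))"
    by (intro sum_mono) (simp add: Basis_le_norm mult_right_mono)
  finally show "norm (L x) \<le> (\<Sum>b\<in>Basis. norm (L b)) * norm x"
    by (simp add: sum_distrib_left mult.commute)
qed

text \<open>Strict differentiability with a radius independent of \<open>p\<close>: the directional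
  derivatives are uniformly continuous on a compact thickening of \<open>K\<close>, and the mean
  value inequality is applied to \<open>f\<close> minus its linearization at \<open>p\<close>.
  Leaving both \<open>x\<close> and \<open>y\<close> free is what the later Lipschitz and
  perturbation arguments rely on.\<close>

lemma smooth_on_strict_derivative:
  fixes f :: "'a::euclidean_space \<Rightarrow> 'b::real_normed_vector"
  assumes "open U" "smooth_on U f" "compact K" "K \<subseteq> U" "e > 0"
  obtains d where "d > 0" "\<And>p. p \<in> K \<Longrightarrow> ball p d \<subseteq> U"
    "\<And>p x y. p \<in> K \<Longrightarrow> x \<in> ball p d \<Longrightarrow> y \<in> ball p d \<Longrightarrow>
      norm (f x - f y - fderiv f p (x - y)) \<le> e * norm (x - y)"
proof -
  obtain r where r: "r > 0" "(\<Union>p\<in>K. cball p r) \<subseteq> U"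
    using compact_subset_open_imp_cball_epsilon_subset[OF assms(3,1,4)] by blast
  \<comment> \<open>Compact, yet large enough to contain every ball in which the derivative is
    compared with the one at \<open>p\<close>.\<close>
  define K' where "K' = (\<Union>p\<in>K. cball p r)"
  have cK': "compact K'"
  proof -
    have "K' = {x + y |x y. x \<in> K \<and> y \<in> cball 0 r}"
    proof (intro equalityI subsetI)
      fix z assume "z \<in> K'"
      then obtain p where "p \<in> K" "z \<in> cball p r" by (auto simp: K'_def)
      then have "z = p + (z - p)" "z - p \<in> cball 0 r" by (auto simp: dist_norm norm_minus_commute)
      with \<open>p \<in> K\<close> show "z \<in> {x + y |x y. x \<in> K \<and> y \<in> cball 0 r}" by blast
    next
      fix z assume "z \<in> {x + y |x y. x \<in> K \<and> y \<in> cball 0 r}"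
      then show "z \<in> K'" by (force simp: K'_def dist_norm)
    qed
    then show ?thesis
      using compact_sums[OF assms(3) compact_cball[of 0 r]] by simp
  qed
  \<comment> \<open>The operator norm is bounded by a sum of \<open>DIM('a)\<close> terms; each gets
    an equal share of \<open>e\<close>.\<close>
  define e' where "e' = e / DIM('a)"
  have e': "e' > 0" using assms(5) by (simp add: e'_def)
  have "\<exists>d>0. \<forall>x\<in>K'. \<forall>y\<in>K'. dist x y < d \<longrightarrow>
      dist (fderiv f x b) (fderiv f y b) < e'" for b
  proof -
    have "continuous_on K' (\<lambda>x. fderiv f x b)"
      using continuous_on_subset[OF smooth_on_continuous_on[OF smooth_on_directional[OF assms(2)]]] r
      by (simp add: K'_def)
    from compact_uniformly_continuous[OF this cK'] show ?thesis
      using e' unfolding uniformly_continuous_on_def by (metis dist_commute)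
  qed
  then obtain d where d: "\<And>b. d b > 0" "\<And>b x y. x \<in> K' \<Longrightarrow> y \<in> K' \<Longrightarrow> dist x y < d b \<Longrightarrow>
      dist (fderiv f x b) (fderiv f y b) < e'"
    by metis
  define d0 where "d0 = min r (Min (d ` Basis))"
  have d0: "d0 > 0" "d0 \<le> r" "\<And>b. b \<in> Basis \<Longrightarrow> d0 \<le> d b"
    using r(1) d(1) by (auto simp: d0_def min.coboundedI2)
  show thesis
  proof
    show "d0 > 0" by fact
    show sub: "ball p d0 \<subseteq> U" if "p \<in> K" for p
      using r(2) d0(2) that by fastforce
    fix p x y assume p: "p \<in> K" and x: "x \<in> ball p d0" and y: "y \<in> ball p d0"
    have der: "(f has_derivative fderiv f z) (at z)" if "z \<in> ball p d0" for z
      using smooth_on_has_derivative[OF assms(2)] sub[OF p] that by blast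
    have on: "onorm (\<lambda>v. fderiv f z v - fderiv f p v) \<le> e"
      if z: "z \<in> ball p d0" for z
    proof -
      have "bounded_linear (\<lambda>v. fderiv f z v - fderiv f p v)"
        using der[OF z] der[of p] d0(1)
        by (intro bounded_linear_sub) (auto dest: has_derivative_bounded_linear)
      then have "onorm (\<lambda>v. fderiv f z v - fderiv f p v) \<le>
         (\<Sum>b\<in>Basis. norm (fderiv f z b - fderiv f p b))"
        by (rule onorm_le_Basis_sum)
      also have "\<dots> \<le> (\<Sum>b\<in>(Basis::'a set). e')"
      proof (rule sum_mono)
        fix b :: 'a assume b: "b \<in> Basis"
        have "z \<in> K'" "p \<in> K'"
          using p z d0 r(1) by (force simp: K'_def)+
        moreover have "dist z p < d b"
          using z d0(3)[OF b] by (simp add: dist_commute)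
        ultimately show "norm (fderiv f z b - fderiv f p b) \<le> e'"
          using d(2)[of z p b] by (simp add: dist_norm)
      qed
      also have "\<dots> = e" by (simp add: e'_def)
      finally show ?thesis .
    qed
    have "norm (f x - f y - fderiv f p (x - y)) \<le> norm (x - y) * e"
    proof (rule differentiable_bound_linearization[where S = "ball p d0"])
      show "y + t *\<^sub>R (x - y) \<in> ball p d0" if "t \<in> {0..1}" for t
        using convexD_alt[OF convex_ball y x, of t] that by (simp add: algebra_simps)
      show "(f has_derivative fderiv f z) (at z within ball p d0)"
        if "z \<in> ball p d0" for z
        using der[OF that] has_derivative_at_withinI by blast
      show "onorm (fderiv f z - fderiv f p) \<le> e"
        if "z \<in> ball p d0" for z
        using on[OF that] by (simp add: fun_diff_def)
      show "p \<in> ball p d0" using d0(1) by simp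
    qed
    then show "norm (f x - f y - fderiv f p (x - y)) \<le> e * norm (x - y)"
      by (simp add: mult.commute)
  qed
qed

lemma smooth_on_locally_lipschitz:
  fixes f :: "'a::euclidean_space \<Rightarrow> 'b::real_normed_vector"
  assumes "open U" "smooth_on U f" "p \<in> U"
  obtains d L where "d > 0" "ball p d \<subseteq> U" "L > 0" "L-lipschitz_on (ball p d) f"
proof -
  obtain d where d: "d > 0" "ball p d \<subseteq> U" "\<And>x y. x \<in> ball p d \<Longrightarrow> y \<in> ball p d \<Longrightarrow>
      norm (f x - f y - fderiv f p (x - y)) \<le> 1 * norm (x - y)"
    by (rule smooth_on_strict_derivative[OF assms(1,2), of "{p}" 1]) (use assms(3) in auto)
  have bl: "bounded_linear (fderiv f p)"
    using smooth_on_has_derivative[OF assms(2,3)] has_derivative_bounded_linear by blast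
  have "(onorm (fderiv f p) + 1)-lipschitz_on (ball p d) f"
  proof (rule lipschitz_onI)
    fix x y assume "x \<in> ball p d" "y \<in> ball p d"
    from d(3)[OF this] onorm[OF bl, of "x - y"]
      norm_triangle_ineq[of "f x - f y - fderiv f p (x - y)" "fderiv f p (x - y)"]
    show "dist (f x) (f y) \<le> (onorm (fderiv f p) + 1) * dist x y"
      by (simp add: dist_norm algebra_simps)
  qed (use onorm_pos_le[OF bl] in simp)
  with d(1,2) show thesis
    using that onorm_pos_le[OF bl] by (metis add_nonneg_pos zero_less_one)
qed

section \<open>Flows on compact sets\<close>

text \<open>
  The control fields are not globally Lipschitz on the ambient space. Their flows are obtained from
  truncated, globally Lipschitz fields, whose integral curves never leave the compact set.
\<close>

definition lipschitz_on_balls :: "('a::real_normed_vector \<Rightarrow> 'b::real_normed_vector) \<Rightarrow> bool" where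
  "lipschitz_on_balls f \<longleftrightarrow> (\<forall>r. \<exists>L. L-lipschitz_on (cball 0 r) f)"

lemma smooth_on_lipschitz_on_balls:
  fixes f :: "'a::euclidean_space \<Rightarrow> 'b::real_normed_vector"
  assumes "smooth_on UNIV f"
  shows "lipschitz_on_balls f"
  unfolding lipschitz_on_balls_def
proof
  fix r :: real
  \<comment> \<open>A single dummy time makes the time-dependent compactness theorem applicable to
    \<open>f\<close>.\<close>
  have "local_lipschitz {0::real} UNIV (\<lambda>t. f)"
    unfolding local_lipschitz_def
  proof (intro ballI)
    fix x :: 'a and t :: real
    obtain d L where "d > 0" "L-lipschitz_on (ball x d) f"
      using smooth_on_locally_lipschitz[OF open_UNIV assms, of x] by blast
    then have "L-lipschitz_on (cball x (d/2) \<inter> UNIV) f"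
      by (auto elim: lipschitz_on_subset)
    then show "\<exists>u>0. \<exists>L. \<forall>t\<in>cball t u \<inter> {0}. L-lipschitz_on (cball x u \<inter> UNIV) f"
      using \<open>d > 0\<close> by (intro exI[of _ "d/2"]) auto
  qed
  then have "local_lipschitz {0::real} (cball 0 r) (\<lambda>t. f)"
    by (rule local_lipschitz_subset) auto
  then obtain L where "L-lipschitz_on (cball 0 r) f"
    using local_lipschitz_compact_implies_lipschitz[where X = "cball 0 r" and T = "{0::real}" and f = "\<lambda>t. f"]
    by auto
  then show "\<exists>L. L-lipschitz_on (cball 0 r) f" ..
qed

lemma lipschitz_on_balls_add:
  "lipschitz_on_balls f \<Longrightarrow> lipschitz_on_balls g \<Longrightarrow> lipschitz_on_balls (\<lambda>x. f x + g x)"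
  unfolding lipschitz_on_balls_def using lipschitz_on_add by blast

lemma lipschitz_on_balls_bounded:
  fixes f :: "'a::real_normed_vector \<Rightarrow> 'b::real_normed_vector"
  assumes "lipschitz_on_balls f"
  obtains B where "B > 0" "\<And>x. norm x \<le> r \<Longrightarrow> norm (f x) \<le> B"
proof -
  obtain L where L: "L-lipschitz_on (cball 0 r) f"
    using assms by (auto simp: lipschitz_on_balls_def)
  show thesis
  proof
    show "norm (f 0) + L * \<bar>r\<bar> + 1 > 0"
      using lipschitz_on_nonneg[OF L] by (simp add: add_nonneg_pos)
    fix x :: 'a assume x: "norm x \<le> r"
    then have "norm (f x - f 0) \<le> L * norm (x - 0)"
      by (intro lipschitz_on_normD[OF L]) (use norm_ge_zero[of x] in \<open>auto simp del: norm_ge_zero\<close>)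
    also have "\<dots> \<le> L * \<bar>r\<bar>"
      using x lipschitz_on_nonneg[OF L] by (intro mult_left_mono) auto
    finally show "norm (f x) \<le> norm (f 0) + L * \<bar>r\<bar> + 1"
      using norm_triangle_ineq2[of "f x" "f 0"] by linarith
  qed
qed

text \<open>A product of Lipschitz functions is Lipschitz where both factors are bounded, and on
  balls boundedness is automatic. Closure under products is why the class is formed with balls: it
  contains smooth maps as well as activations, hence every control field.\<close>

lemma lipschitz_on_balls_scaleR:
  fixes c :: "'a::real_normed_vector \<Rightarrow> real" and f :: "'a \<Rightarrow> 'b::real_normed_vector"
  assumes "lipschitz_on_balls c" "lipschitz_on_balls f"
  shows "lipschitz_on_balls (\<lambda>x. c x *\<^sub>R f x)"
  unfolding lipschitz_on_balls_def
proof
  fix r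
  obtain Lc Lf where L: "Lc-lipschitz_on (cball 0 r) c" "Lf-lipschitz_on (cball 0 r) f"
    using assms unfolding lipschitz_on_balls_def by blast
  obtain Bc Bf where B: "Bc > 0" "Bf > 0"
    "\<And>x. norm x \<le> r \<Longrightarrow> norm (c x) \<le> Bc" "\<And>x. norm x \<le> r \<Longrightarrow> norm (f x) \<le> Bf"
    using lipschitz_on_balls_bounded[of c r] lipschitz_on_balls_bounded[of f r] assms by metis
  have "(Bc * Lf + Bf * Lc)-lipschitz_on (cball 0 r) (\<lambda>x. c x *\<^sub>R f x)"
  proof (rule lipschitz_onI)
    fix x y :: 'a assume xy: "x \<in> cball 0 r" "y \<in> cball 0 r"
    have "c x *\<^sub>R f x - c y *\<^sub>R f y = c x *\<^sub>R (f x - f y) + (c x - c y) *\<^sub>R f y"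
      by (simp add: algebra_simps)
    also have "norm \<dots> \<le> norm (c x) * norm (f x - f y) + norm (c x - c y) * norm (f y)"
      using norm_triangle_ineq[of "c x *\<^sub>R (f x - f y)" "(c x - c y) *\<^sub>R f y"] by simp
    also have "\<dots> \<le> Bc * (Lf * norm (x - y)) + (Lc * norm (x - y)) * Bf"
      using xy B lipschitz_on_nonneg[OF L(1)] lipschitz_on_nonneg[OF L(2)]
        lipschitz_on_normD[OF L(1), of x y] lipschitz_on_normD[OF L(2), of x y]
      by (intro add_mono mult_mono) auto
    finally show "dist (c x *\<^sub>R f x) (c y *\<^sub>R f y) \<le> (Bc * Lf + Bf * Lc) * dist x y"
      by (simp add: dist_norm algebra_simps)
  qed (use B lipschitz_on_nonneg[OF L(1)] lipschitz_on_nonneg[OF L(2)] in simp)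
  then show "\<exists>L. L-lipschitz_on (cball 0 r) (\<lambda>x. c x *\<^sub>R f x)" ..
qed

lemma lipschitz_on_balls_const: "lipschitz_on_balls (\<lambda>x. c)"
  unfolding lipschitz_on_balls_def using lipschitz_on_constant by blast

lemma lipschitz_on_balls_sum:
  "(\<And>i. i \<in> I \<Longrightarrow> lipschitz_on_balls (f i)) \<Longrightarrow> lipschitz_on_balls (\<lambda>x. \<Sum>i\<in>I. f i x)"
  by (induction I rule: infinite_finite_induct)
     (auto intro: lipschitz_on_balls_const lipschitz_on_balls_add)

lemma lipschitz_on_balls_compact:
  assumes "lipschitz_on_balls f" "compact M"
  obtains L where "L > 0" "L-lipschitz_on M f"
proof -
  obtain r where r: "M \<subseteq> cball 0 r"
    using bounded_subset_ballD[OF compact_imp_bounded[OF assms(2)], of 0] ball_subset_cball[of 0]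
    by (meson order_trans)
  obtain L where "L-lipschitz_on (cball 0 r) f"
    using assms(1) unfolding lipschitz_on_balls_def by blast
  then have "(\<bar>L\<bar> + 1)-lipschitz_on M f"
    by (rule lipschitz_on_mono[OF _ r]) simp
  then show thesis using that[of "\<bar>L\<bar> + 1"] by auto
qed

lemma has_vector_derivative_norm_bound:
  fixes f :: "real \<Rightarrow> 'a::real_normed_vector"
  assumes "a \<le> b" "\<And>t. t \<in> {a..b} \<Longrightarrow> (f has_vector_derivative f' t) (at t within {a..b})"
    "\<And>t. t \<in> {a..b} \<Longrightarrow> norm (f' t) \<le> B"
  shows "norm (f b - f a) \<le> B * (b - a)"
proof -
  have "norm (f b - f a) \<le> B * norm (b - a)"
    by (rule differentiable_bound[where S = "{a..b}" and f' = "\<lambda>t h. h *\<^sub>R f' t"])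
       (use assms in \<open>auto simp: has_vector_derivative_def mult.commute[of B] intro!: onorm_le mult_left_mono\<close>)
  then show ?thesis using assms(1) by simp
qed

section \<open>Integral curves and invariance of compact sets\<close>

text \<open>Picard iteration measured with the weight \<open>exp (- 2 * K * t)\<close>. In the
  weighted norm the integral operator contracts by 1/2 whatever the Lipschitz constant, so all of
  \<open>{0..1}\<close> is reached at once, without splitting it into short intervals.\<close>

lemma picard_exists:
  fixes F :: "'a::euclidean_space \<Rightarrow> 'a"
  assumes F: "L-lipschitz_on UNIV F"
  obtains x where "x 0 = x0"
    "\<And>t. t \<in> {0..1} \<Longrightarrow> (x has_vector_derivative F (x t)) (at t within {0..1::real})"
proof -
  \<comment> \<open>A constant at least 1 permits division by \<open>K\<close> and starts the
    induction through \<open>t \<le> exp (2 * K * t)\<close>.\<close>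
  define K where "K = max L 1"
  have K: "K \<ge> 1" "\<And>u v. norm (F u - F v) \<le> K * norm (u - v)"
  proof -
    show "norm (F u - F v) \<le> K * norm (u - v)" for u v
      using lipschitz_on_normD[OF F, of u v] mult_right_mono[of L K "norm (u - v)"] by (simp add: K_def)
  qed (simp add: K_def)
  have contF: "continuous_on UNIV F"
    using F by (rule lipschitz_on_continuous_on)
  define X where "X = rec_nat (\<lambda>t::real. x0) (\<lambda>n f t. x0 + integral {0..t} (\<lambda>s. F (f s)))"
  have X0: "X 0 = (\<lambda>t. x0)" and XS: "\<And>n. X (Suc n) = (\<lambda>t. x0 + integral {0..t} (\<lambda>s. F (X n s)))"
    by (auto simp: X_def)
  have contX: "continuous_on {0..1} (X n)" for n
  proof (induction n)
    case (Suc n)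
    have "(\<lambda>s. F (X n s)) integrable_on {0..1}"
      by (rule integrable_continuous_real) (rule continuous_on_compose2[OF contF Suc], simp)
    from indefinite_integral_continuous_1[OF this] show ?case
      unfolding XS by (intro continuous_intros)
  qed (simp add: X0)
  have int: "(\<lambda>s. F (X n s)) integrable_on {0..t}" if "t \<in> {0..1}" for n t
    by (rule integrable_continuous_real, rule continuous_on_compose2[OF contF])
       (use contX[of n] that in \<open>auto intro: continuous_on_subset\<close>)
  define C where "C = norm (F x0)"
  have C: "C \<ge> 0" by (simp add: C_def)
  have step: "norm (X (Suc n) t - X n t) \<le> C * (1/2)^n * exp (2 * K * t)" if "t \<in> {0..1}" for n t
    using that
  proof (induction n arbitrary: t)
    case 0
    have "norm (X (Suc 0) t - X 0 t) = C * t"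
      using 0 by (simp add: XS X0 C_def)
    also have "\<dots> \<le> C * exp (2 * K * t)"
    proof (rule mult_left_mono[OF _ C])
      have "t \<le> 1 + 2 * K * t" using 0 K(1) mult_right_mono[of 1 "2 * K" t] by auto
      then show "t \<le> exp (2 * K * t)" using exp_ge_add_one_self[of "2 * K * t"] by linarith
    qed
    finally show ?case by simp
  next
    case (Suc n)
    define c where "c = C * (1/2)^n"
    have c: "c \<ge> 0" using C by (simp add: c_def)
    \<comment> \<open>Integrating the weight divides by \<open>2 * K\<close>; against the Lipschitz
      factor \<open>K\<close> this leaves the contraction factor 1/2.\<close>
    have hi: "((\<lambda>s. c * K * exp (2 * K * s)) has_integral
        (c / 2 * exp (2 * K * t) - c / 2 * exp (2 * K * 0))) {0..t}"
      by (rule fundamental_theorem_of_calculus)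
         (use Suc.prems K(1) in \<open>auto intro!: derivative_eq_intros
            simp: has_real_derivative_iff_has_vector_derivative[symmetric]\<close>)
    have "norm (X (Suc (Suc n)) t - X (Suc n) t)
        = norm (integral {0..t} (\<lambda>s. F (X (Suc n) s) - F (X n s)))"
      unfolding XS[of "Suc n"] XS[of n] integral_diff[OF int[OF Suc.prems, of "Suc n"] int[OF Suc.prems, of n], unfolded XS[of n]]
      by simp
    also have "\<dots> \<le> integral {0..t} (\<lambda>s. c * K * exp (2 * K * s))"
    proof (rule integral_norm_bound_integral)
      show "(\<lambda>s. F (X (Suc n) s) - F (X n s)) integrable_on {0..t}"
        using int[OF Suc.prems] by (intro integrable_diff)
      show "(\<lambda>s. c * K * exp (2 * K * s)) integrable_on {0..t}"
        using hi by blast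
      fix s assume "s \<in> {0..t}"
      then have s: "s \<in> {0..1}" using Suc.prems by auto
      have "norm (F (X (Suc n) s) - F (X n s)) \<le> K * norm (X (Suc n) s - X n s)" by (rule K)
      also have "\<dots> \<le> K * (c * exp (2 * K * s))"
        using Suc.IH[OF s] K(1) by (intro mult_left_mono) (auto simp: c_def)
      finally show "norm (F (X (Suc n) s) - F (X n s)) \<le> c * K * exp (2 * K * s)"
        by (simp add: mult_ac)
    qed
    also have "\<dots> = c / 2 * exp (2 * K * t) - c / 2"
      using integral_unique[OF hi] by simp
    also have "\<dots> \<le> C * (1/2)^Suc n * exp (2 * K * t)"
      using c by (simp add: c_def)
    finally show ?case .
  qed
  have "uniform_limit {0..1} (\<lambda>n t. \<Sum>k<n. X (Suc k) t - X k t)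
      (\<lambda>t. suminf (\<lambda>k. X (Suc k) t - X k t)) sequentially"
  proof (rule Weierstrass_m_test)
    show "norm (X (Suc n) t - X n t) \<le> C * exp (2 * K) * (1/2)^n" if "t \<in> {0..1}" for n t
    proof -
      have "exp (2 * K * t) \<le> exp (2 * K)" using that K(1) by auto
      then have "C * (1/2)^n * exp (2 * K * t) \<le> C * (1/2)^n * exp (2 * K)"
        using C by (intro mult_left_mono) auto
      then show ?thesis using step[OF that, of n] by (simp add: mult_ac)
    qed
    show "summable (\<lambda>n. C * exp (2 * K) * (1/2)^n)"
      by (intro summable_mult summable_geometric) simp
  qed
  define x where "x = (\<lambda>t. x0 + suminf (\<lambda>k. X (Suc k) t - X k t))"
  have "uniform_limit {0..1} (\<lambda>n t. x0 + (\<Sum>k<n. X (Suc k) t - X k t)) x sequentially"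
    unfolding x_def by (intro uniform_limit_intros) fact
  moreover have "x0 + (\<Sum>k<n. X (Suc k) t - X k t) = X n t" for n t
    by (subst sum_lessThan_telescope) (simp add: X0)
  ultimately have ulim: "uniform_limit {0..1} X x sequentially" by simp
  have contx: "continuous_on {0..1} x"
    by (rule uniform_limit_theorem[OF _ ulim]) (auto simp: contX)
  have ulimF: "uniform_limit {0..1} (\<lambda>n t. F (X n t)) (\<lambda>t. F (x t)) sequentially"
  proof (rule uniform_limitI)
    fix e :: real assume "e > 0"
    then have "e / K > 0" using K(1) by simp
    from uniform_limitD[OF ulim this]
    show "\<forall>\<^sub>F n in sequentially. \<forall>t\<in>{0..1}. dist (F (X n t)) (F (x t)) < e"
    proof eventually_elim
      case (elim n)
      show ?case
      proof
        fix t :: real assume "t \<in> {0..1}"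
        with elim have "K * norm (X n t - x t) < e"
          using K(1) by (auto simp: dist_norm field_simps)
        then show "dist (F (X n t)) (F (x t)) < e"
          using K(2)[of "X n t" "x t"] by (simp add: dist_norm)
      qed
    qed
  qed
  have xint: "x t = x0 + integral {0..t} (\<lambda>s. F (x s))" if t: "t \<in> {0..1}" for t
  proof -
    have "uniform_limit {0..t} (\<lambda>n t. F (X n t)) (\<lambda>t. F (x t)) sequentially"
      using uniform_limit_on_subset[OF ulimF] t by auto
    then obtain I J where IJ: "\<And>n. ((\<lambda>t. F (X n t)) has_integral I n) {0..t}"
      "((\<lambda>t. F (x t)) has_integral J) {0..t}" "I \<longlonglongrightarrow> J"
    proof (rule uniform_limit_integral)
      show "continuous_on {0..t} (\<lambda>t. F (X n t))" for n
        by (rule continuous_on_compose2[OF contF])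
           (use contX[of n] t in \<open>auto intro: continuous_on_subset\<close>)
    qed auto
    have "(\<lambda>n. X (Suc n) t) \<longlonglongrightarrow> x0 + J"
      unfolding XS integral_unique[OF IJ(1)] using IJ(3) by (intro tendsto_intros)
    moreover have "(\<lambda>n. X (Suc n) t) \<longlonglongrightarrow> x t"
      using tendsto_uniform_limitI[OF ulim t] LIMSEQ_Suc by blast
    ultimately show ?thesis
      using IJ(2) LIMSEQ_unique by (metis integral_unique)
  qed
  show thesis
  proof (rule that)
    show "x 0 = x0" using xint[of 0] by simp
    fix t :: real assume t: "t \<in> {0..1}"
    have "continuous_on {0..1} (\<lambda>s. F (x s))"
      by (rule continuous_on_compose2[OF contF contx]) simp
    from integral_has_vector_derivative[OF this t]
    have "((\<lambda>u. x0 + integral {0..u} (\<lambda>s. F (x s))) has_vector_derivative F (x t)) (at t within {0..1})"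
      using has_vector_derivative_add[OF has_vector_derivative_const] by fastforce
    then show "(x has_vector_derivative F (x t)) (at t within {0..1})"
      by (rule has_vector_derivative_transform[rotated 2]) (use t xint in auto)
  qed
qed

text \<open>Real induction: the supremum of the good times up to \<open>t\<close> is itself good by
  closedness, and if it were below \<open>t\<close> it could be pushed to the right.\<close>

lemma interval_induct_right:
  fixes P :: "real \<Rightarrow> bool"
  assumes "P 0" "closed {t\<in>{0..1}. P t}"
    "\<And>t. t \<in> {0..<1} \<Longrightarrow> P t \<Longrightarrow> \<exists>d>0. \<forall>h. 0 < h \<and> h < d \<and> t + h \<le> 1 \<longrightarrow> P (t + h)"
    "t \<in> {0..1}"
  shows "P t"
proof (rule ccontr)
  assume nP: "\<not> P t"
  define A where "A = {s\<in>{0..1}. P s} \<inter> {0..t}"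
  have A: "closed A" "0 \<in> A" "bdd_above A"
    using assms by (auto simp: A_def intro: closed_Int)
  define s where "s = Sup A"
  have s: "s \<in> A" unfolding s_def using A by (intro closed_contains_Sup) auto
  then have "s < t" "P s" using nP by (auto simp: A_def order.order_iff_strict)
  then obtain d where d: "d > 0" "\<And>h. 0 < h \<and> h < d \<and> s + h \<le> 1 \<Longrightarrow> P (s + h)"
    using assms(3)[of s] assms(4) s by (auto simp: A_def)
  define h where "h = min (d/2) (t - s)"
  have h: "0 < h" "h < d" "s + h \<le> t" using d(1) \<open>s < t\<close> by (auto simp: h_def min_def)
  then have "P (s + h)" using d(2) assms(4) by auto
  then have "s + h \<in> A" using h assms(4) s by (auto simp: A_def)
  then have "s + h \<le> s" unfolding s_def using A(3) by (rule cSup_upper)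
  then show False using h by simp
qed

text \<open>
  The distance \<open>u\<close> to the invariant set satisfies \<open>u(t+h) \<le> u(t) + h L u(t) + o(h)\<close>: compare the
  solution with the curve in \<open>M\<close> through the nearest point that has the prescribed velocity.
\<close>

lemma integral_curve_stays:
  fixes F :: "'a::euclidean_space \<Rightarrow> 'a"
  assumes F: "L-lipschitz_on UNIV F" and M: "compact M"
    and tan: "\<And>p. p \<in> M \<Longrightarrow> F p \<in> tangent_space M p"
    and x: "\<And>t. t \<in> {0..1} \<Longrightarrow> (x has_vector_derivative F (x t)) (at t within {0..1::real})"
    and x0: "x 0 \<in> M" and t: "t \<in> {0..1}"
  shows "x t \<in> M"
proof -
  have ne: "M \<noteq> {}" and cl: "closed M" using x0 M by (auto simp: compact_imp_closed)
  have L: "L \<ge> 0" using F by (rule lipschitz_on_nonneg)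
  have contx: "continuous_on {0..1} x"
    using x by (intro continuous_on_vector_derivative)
  define u where "u t = infdist (x t) M" for t
  have contu: "continuous_on {0..1} u"
    unfolding u_def by (intro continuous_on_infdist contx)
  have u0: "u t \<ge> 0" for t by (simp add: u_def infdist_nonneg)
  have stepu: "\<exists>d>0. \<forall>h. 0 < h \<and> h < d \<and> t + h \<le> 1 \<longrightarrow> u (t + h) \<le> u t + h * (L * u t) + h * e"
    if t: "t \<in> {0..<1}" and e: "e > 0" for t e
  proof -
    obtain p where p: "p \<in> M" "infdist (x t) M = dist (x t) p"
      using infdist_attains_inf[OF cl ne] by metis
    obtain \<delta> \<gamma> where \<gamma>: "\<delta> > 0" "\<gamma> ` {-\<delta><..<\<delta>} \<subseteq> M" "\<gamma> 0 = p" "(\<gamma> has_vector_derivative F p) (at (0::real))"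
      using tan[OF p(1)] unfolding tangent_space_def by blast
    obtain d1 where d1: "d1 > 0"
      "\<And>h. norm h < d1 \<Longrightarrow> norm (\<gamma> h - p - h *\<^sub>R F p) \<le> e / 2 * norm h"
      using \<gamma>(4) e unfolding has_vector_derivative_def has_derivative_within_alt \<gamma>(3)[symmetric]
      by (metis UNIV_I diff_zero half_gt_zero)
    have "\<exists>d>0. \<forall>y\<in>{0..1}. norm (y - t) < d \<longrightarrow> norm (x y - x t - (y - t) *\<^sub>R F (x t)) \<le> e / 2 * norm (y - t)"
      using x[of t] t half_gt_zero[OF e] unfolding has_vector_derivative_def has_derivative_within_alt
      by (metis atLeastAtMost_iff atLeastLessThan_iff less_imp_le)
    then obtain d2 where d2: "d2 > 0"
      "\<And>y. y \<in> {0..1} \<Longrightarrow> norm (y - t) < d2 \<Longrightarrow> norm (x y - x t - (y - t) *\<^sub>R F (x t)) \<le> e / 2 * norm (y - t)"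
      by blast
    have "u (t + h) \<le> u t + h * (L * u t) + h * e"
      if h: "0 < h" "h < min \<delta> (min d1 d2)" "t + h \<le> 1" for h
    proof -
      have "\<gamma> h \<in> M" using \<gamma>(1,2) h by auto
      then have "u (t + h) \<le> norm (x (t + h) - \<gamma> h)"
        unfolding u_def using infdist_le by (metis dist_norm)
      also have "x (t + h) - \<gamma> h = (x (t + h) - x t - h *\<^sub>R F (x t)) + (x t - p)
          + (h *\<^sub>R (F (x t) - F p)) + - (\<gamma> h - p - h *\<^sub>R F p)"
        by (simp add: algebra_simps)
      also have "norm \<dots> \<le> e / 2 * h + u t + h * (L * u t) + e / 2 * h"
      proof (intro norm_triangle_mono)
        show "norm (x (t + h) - x t - h *\<^sub>R F (x t)) \<le> e / 2 * h"
          using d2(2)[of "t + h"] h t by simp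
        show "norm (x t - p) \<le> u t" using p(2) by (simp add: u_def dist_norm)
        show "norm (h *\<^sub>R (F (x t) - F p)) \<le> h * (L * u t)"
          using lipschitz_on_normD[OF F, of "x t" p] h p(2) by (simp add: u_def dist_norm)
        show "norm (- (\<gamma> h - p - h *\<^sub>R F p)) \<le> e / 2 * h"
          using d1(2)[of h] h by (subst norm_minus_cancel) simp
      qed
      finally show ?thesis by (simp add: algebra_simps)
    qed
    then show ?thesis
      using \<gamma>(1) d1(1) d2(1) by (intro exI[of _ "min \<delta> (min d1 d2)"]) auto
  qed
  \<comment> \<open>Gronwall with a barrier: the extra rate 1 in the exponent pays for the error
    \<open>h * e\<close>, because \<open>e\<close> is at most the value \<open>z\<close> of the
    barrier. Letting \<open>e\<close> tend to 0 then forces \<open>u t = 0\<close>.\<close>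
  have bound: "u t \<le> e * exp ((L + 1) * t)" if e: "e > 0" for e
  proof (rule interval_induct_right[OF _ _ _ t])
    show "u 0 \<le> e * exp ((L + 1) * 0)" using x0 e by (simp add: u_def)
    show "closed {t\<in>{0..1}. u t \<le> e * exp ((L + 1) * t)}"
      by (intro continuous_on_closed_Collect_le contu continuous_intros)
    fix t assume t: "t \<in> {0..<1::real}" and le: "u t \<le> e * exp ((L + 1) * t)"
    define z where "z = e * exp ((L + 1) * t)"
    have "e \<le> z" using e L t by (simp add: z_def)
    obtain d where d: "d > 0" "\<And>h. 0 < h \<and> h < d \<and> t + h \<le> 1 \<Longrightarrow> u (t + h) \<le> u t + h * (L * u t) + h * e"
      using stepu[OF t e] by blast
    have "u (t + h) \<le> e * exp ((L + 1) * (t + h))" if h: "0 < h \<and> h < d \<and> t + h \<le> 1" for h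
    proof -
      have "u (t + h) \<le> u t + h * (L * u t) + h * e" using d(2)[OF h] .
      also have "\<dots> \<le> z + h * (L * z) + h * z"
        using le h L \<open>e \<le> z\<close> by (intro add_mono mult_left_mono) (auto simp: z_def)
      also have "\<dots> = z * (1 + (L + 1) * h)" by (simp add: algebra_simps)
      also have "\<dots> \<le> z * exp ((L + 1) * h)"
        using \<open>e \<le> z\<close> e by (intro mult_left_mono) auto
      also have "\<dots> = e * exp ((L + 1) * (t + h))"
        by (simp add: z_def exp_add[symmetric] algebra_simps)
      finally show ?thesis .
    qed
    then show "\<exists>d>0. \<forall>h. 0 < h \<and> h < d \<and> t + h \<le> 1 \<longrightarrow> u (t + h) \<le> e * exp ((L + 1) * (t + h))"
      using d(1) by blast
  qed
  have "u t \<le> 0"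
  proof (rule field_le_epsilon)
    fix e :: real assume e: "e > 0"
    from bound[of "e / exp ((L + 1) * t)"] e show "u t \<le> 0 + e" by simp
  qed
  then have "u t = 0" using u0[of t] by simp
  then show ?thesis
    using in_closed_iff_infdist_zero[OF cl ne] by (simp add: u_def)
qed

section \<open>Flows on an invariant compact set\<close>

text \<open>Only points of \<open>M\<close> and times in \<open>{0..1}\<close> count, with one-sided
  derivatives at the ends. No dependence on the initial point is demanded; it is derived in
  \<open>flow_on_stability\<close> from a Lipschitz bound on \<open>M\<close>.\<close>

definition flow_on :: "'a::euclidean_space set \<Rightarrow> ('a \<Rightarrow> 'a) \<Rightarrow> (real \<Rightarrow> 'a \<Rightarrow> 'a) \<Rightarrow> bool" where
  "flow_on M W \<Phi> \<longleftrightarrow> (\<forall>x\<in>M. \<Phi> 0 x = x \<and> (\<forall>t\<in>{0..1}. \<Phi> t x \<in> M \<and>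
     ((\<lambda>t. \<Phi> t x) has_vector_derivative W (\<Phi> t x)) (at t within {0..1})))"

text \<open>Precomposing \<open>W\<close> with the nearest-point map of a large ball, which is
  1-Lipschitz by convexity, gives a globally Lipschitz field that is unchanged on \<open>M\<close>.
  Its integral curves stay in \<open>M\<close> by tangency, so along them the truncation is
  invisible.\<close>

lemma flow_on_exists:
  fixes W :: "'a::euclidean_space \<Rightarrow> 'a"
  assumes W: "lipschitz_on_balls W" and M: "compact M"
    and tan: "\<And>p. p \<in> M \<Longrightarrow> W p \<in> tangent_space M p"
  obtains \<Phi> where "flow_on M W \<Phi>"
proof -
  obtain r where r: "r > 0" "M \<subseteq> cball 0 r"
    using bounded_subset_ballD[OF compact_imp_bounded[OF M], of 0] ball_subset_cball[of 0] by (meson order_trans)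
  define S where "S = cball (0::'a) r"
  have S: "convex S" "closed S" "S \<noteq> {}" using r(1) by (auto simp: S_def)
  obtain L where L: "L-lipschitz_on S W" using W by (auto simp: lipschitz_on_balls_def S_def)
  define F where "F x = W (closest_point S x)" for x
  have F: "L-lipschitz_on UNIV F"
  proof (rule lipschitz_onI)
    fix x y :: 'a
    have "dist (F x) (F y) \<le> L * dist (closest_point S x) (closest_point S y)"
      unfolding F_def using S by (intro lipschitz_onD[OF L] closest_point_in_set)
    also have "\<dots> \<le> L * dist x y"
      using closest_point_lipschitz[OF S] lipschitz_on_nonneg[OF L] by (intro mult_left_mono)
    finally show "dist (F x) (F y) \<le> L * dist x y" .
  qed (rule lipschitz_on_nonneg[OF L])
  have FW: "F x = W x" if "x \<in> M" for x
    using that r(2) closest_point_self[of x S] by (auto simp: F_def S_def)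
  have "\<exists>y. x \<in> M \<longrightarrow> y 0 = x \<and> (\<forall>t\<in>{0..1}. y t \<in> M \<and>
     (y has_vector_derivative W (y t)) (at t within {0..1::real}))" for x
  proof (cases "x \<in> M")
    case True
    obtain y where y: "y 0 = x"
      "\<And>t. t \<in> {0..1} \<Longrightarrow> (y has_vector_derivative F (y t)) (at t within {0..1::real})"
      using picard_exists[OF F] by blast
    have "y t \<in> M" if "t \<in> {0..1}" for t
      using integral_curve_stays[OF F M _ y(2) _ that] tan FW y(1) True by simp
    then show ?thesis using y FW by (intro exI[of _ y]) simp
  qed auto
  then have "\<forall>x. \<exists>y. x \<in> M \<longrightarrow> y 0 = x \<and> (\<forall>t\<in>{0..1}. y t \<in> M \<and>
     (y has_vector_derivative W (y t)) (at t within {0..1::real}))"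
    by blast
  from choice[OF this] obtain \<Psi> where "\<And>x. x \<in> M \<longrightarrow> \<Psi> x 0 = x \<and> (\<forall>t\<in>{0..1}. \<Psi> x t \<in> M \<and>
     (\<Psi> x has_vector_derivative W (\<Psi> x t)) (at t within {0..1::real}))"
    by blast
  then have "flow_on M W (\<lambda>t x. \<Psi> x t)" by (simp add: flow_on_def)
  then show thesis by (rule that)
qed

context
  fixes M :: "'a::euclidean_space set" and W :: "'a \<Rightarrow> 'a" and \<Phi> :: "real \<Rightarrow> 'a \<Rightarrow> 'a" and L B :: real
  assumes flow: "flow_on M W \<Phi>" and lip: "L-lipschitz_on M W"
    and bnd: "\<And>x. x \<in> M \<Longrightarrow> norm (W x) \<le> B"
begin

lemma flow_on_shift_derivative:
  assumes "x \<in> M" "0 \<le> a" "b \<le> 1" "t \<in> {a..b}"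
  shows "((\<lambda>t. \<Phi> t x) has_vector_derivative W (\<Phi> t x)) (at t within {a..b})"
proof (rule has_vector_derivative_within_subset)
  show "((\<lambda>t. \<Phi> t x) has_vector_derivative W (\<Phi> t x)) (at t within {0..1})"
    using flow assms unfolding flow_on_def by simp
qed (use assms in auto)

lemma flow_on_displacement:
  assumes "x \<in> M" "0 \<le> a" "a \<le> b" "b \<le> 1"
  shows "norm (\<Phi> b x - \<Phi> a x) \<le> B * (b - a)"
proof (rule has_vector_derivative_norm_bound[OF assms(3), where f' = "\<lambda>t. W (\<Phi> t x)"])
  show "((\<lambda>t. \<Phi> t x) has_vector_derivative W (\<Phi> t x)) (at t within {a..b})" if "t \<in> {a..b}" for t
    using flow_on_shift_derivative assms that by blast
  show "norm (W (\<Phi> t x)) \<le> B" if "t \<in> {a..b}" for t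
    using flow assms that by (intro bnd) (simp add: flow_on_def)
qed

text \<open>During the time \<open>b - a\<close> the curve moves by at most
  \<open>B * (b - a)\<close>, so its velocity changes by at most \<open>L * B * (b - a)\<close>.
  Keeping \<open>L\<close> and \<open>B\<close> explicit matters when the field is rescaled by the
  step size.\<close>

lemma flow_on_expansion:
  assumes "x \<in> M" "0 \<le> a" "a \<le> b" "b \<le> 1"
  shows "norm (\<Phi> b x - \<Phi> a x - (b - a) *\<^sub>R W (\<Phi> a x)) \<le> L * B * (b - a)\<^sup>2"
proof -
  have B: "B \<ge> 0" using bnd[OF assms(1)] norm_ge_zero[of "W x"] by linarith
  have L: "L \<ge> 0" using lip by (rule lipschitz_on_nonneg)
  have inM: "\<Phi> t x \<in> M" if "t \<in> {a..b}" for t using flow that assms by (auto simp: flow_on_def)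
  have "norm (\<Phi> b x - \<Phi> a x - (b - a) *\<^sub>R W (\<Phi> a x)) \<le> norm (b - a) * (L * (B * (b - a)))"
  proof (rule vector_differentiable_bound_linearization[where S = "{a..b}" and f = "\<lambda>t. \<Phi> t x"])
    show "((\<lambda>t. \<Phi> t x) has_vector_derivative W (\<Phi> t x)) (at t within {a..b})" if "t \<in> {a..b}" for t
      using flow_on_shift_derivative assms that by blast
    show "norm (W (\<Phi> t x) - W (\<Phi> a x)) \<le> L * (B * (b - a))" if t: "t \<in> {a..b}" for t
    proof -
      have "norm (W (\<Phi> t x) - W (\<Phi> a x)) \<le> L * norm (\<Phi> t x - \<Phi> a x)"
        using inM t assms by (intro lipschitz_on_normD[OF lip]) auto
      also have "norm (\<Phi> t x - \<Phi> a x) \<le> B * (t - a)"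
        using flow_on_displacement assms t by auto
      also have "\<dots> \<le> B * (b - a)" using t B by (intro mult_left_mono) auto
      finally show ?thesis using L by (simp add: mult_left_mono)
    qed
  qed (use assms in \<open>auto simp: closed_segment_eq_real_ivl\<close>)
  then show ?thesis using assms by (simp add: power2_eq_square mult_ac)
qed

text \<open>Gronwall for the squared distance, which unlike the distance is differentiable where the
  two curves meet: after multiplication by \<open>exp (- (2 * L * s))\<close> it is nonincreasing by
  the Cauchy-Schwarz inequality.\<close>

lemma flow_on_stability:
  assumes "x \<in> M" "y \<in> M" "t \<in> {0..1}"
  shows "norm (\<Phi> t x - \<Phi> t y) \<le> exp (L * t) * norm (x - y)"
proof -
  define u where "u s = \<Phi> s x - \<Phi> s y" for s
  define f where "f s = exp (- (2 * L * s)) * (u s \<bullet> u s)" for s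
  have der: "(u has_vector_derivative W (\<Phi> s x) - W (\<Phi> s y)) (at s within {0..1})" if "s \<in> {0..1}" for s
    using has_vector_derivative_diff[OF flow_on_shift_derivative[OF assms(1) order_refl order_refl that]
        flow_on_shift_derivative[OF assms(2) order_refl order_refl that]]
    by (simp add: u_def[abs_def])
  have contu: "continuous_on {0..1} u"
    using der by (intro continuous_on_vector_derivative)
  have "f t \<le> f 0"
  proof (rule DERIV_nonpos_imp_decreasing_open[where f = f and a = 0 and b = t])
    show "continuous_on {0..t} f"
      unfolding f_def using assms(3)
      by (intro continuous_intros continuous_on_subset[OF contu]) auto
    fix s assume s: "0 < s" "s < t"
    then have "(u has_vector_derivative W (\<Phi> s x) - W (\<Phi> s y)) (at s)"
      using der[of s] at_within_Icc_at[of 0 s 1] assms(3) by auto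
    then have du: "(u has_derivative (\<lambda>h. h *\<^sub>R (W (\<Phi> s x) - W (\<Phi> s y)))) (at s)"
      by (simp add: has_vector_derivative_def)
    have "((\<lambda>s. u s \<bullet> u s) has_real_derivative 2 * (u s \<bullet> (W (\<Phi> s x) - W (\<Phi> s y)))) (at s)"
      unfolding has_field_derivative_def
      by (rule has_derivative_eq_rhs[OF has_derivative_inner[OF du du]])
         (auto simp: inner_commute algebra_simps)
    then have "(f has_real_derivative
        exp (- (2 * L * s)) * (2 * (u s \<bullet> (W (\<Phi> s x) - W (\<Phi> s y))) - 2 * L * (u s \<bullet> u s))) (at s)"
      unfolding f_def by (auto intro!: derivative_eq_intros simp: algebra_simps)
    moreover have "u s \<bullet> (W (\<Phi> s x) - W (\<Phi> s y)) \<le> L * (u s \<bullet> u s)"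
    proof -
      have "u s \<bullet> (W (\<Phi> s x) - W (\<Phi> s y)) \<le> norm (u s) * norm (W (\<Phi> s x) - W (\<Phi> s y))"
        by (rule norm_cauchy_schwarz)
      also have "\<dots> \<le> norm (u s) * (L * norm (u s))"
        unfolding u_def using flow assms s
        by (intro mult_left_mono lipschitz_on_normD[OF lip]) (auto simp: flow_on_def)
      finally show ?thesis by (simp add: power2_norm_eq_inner[symmetric] power2_eq_square mult_ac)
    qed
    ultimately show "\<exists>y. DERIV f s :> y \<and> y \<le> 0"
      by (intro exI conjI) (auto intro!: mult_nonneg_nonpos)
  qed (use assms in auto)
  then have "u t \<bullet> u t \<le> exp (2 * L * t) * (u 0 \<bullet> u 0)"
    by (simp add: f_def exp_minus field_simps)
  then have "(norm (u t))\<^sup>2 \<le> (exp (L * t) * norm (u 0))\<^sup>2"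
    by (simp add: power2_norm_eq_inner power_mult_distrib exp_double[symmetric] mult.assoc)
  then have "norm (u t) \<le> exp (L * t) * norm (u 0)"
    by (rule power2_le_imp_le) simp
  then show ?thesis using flow assms by (simp add: u_def flow_on_def)
qed

lemma flow_on_continuous:
  assumes "t \<in> {0..1}"
  shows "continuous_on M (\<Phi> t)"
proof -
  have "(exp (L * t))-lipschitz_on M (\<Phi> t)"
    using flow_on_stability[OF _ _ assms] by (intro lipschitz_onI) (auto simp: dist_norm)
  then show ?thesis by (rule lipschitz_on_continuous_on)
qed

end

section \<open>Absolutely continuous solutions\<close>

abbreviation short_cells ::
  "real \<Rightarrow> real \<Rightarrow> nat \<Rightarrow> (nat \<Rightarrow> real) \<Rightarrow> (nat \<Rightarrow> real) \<Rightarrow> real \<Rightarrow> bool" where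
  "short_cells a b n p q d \<equiv> (\<forall>i<n. a \<le> p i \<and> p i \<le> q i \<and> q i \<le> b) \<and>
     disjoint_family_on (\<lambda>i. {p i<..<q i}) {..<n} \<and> (\<Sum>i<n. q i - p i) < d"

lemma abs_continuous_on_interval_diff:
  assumes "abs_continuous_on_interval a b f" "abs_continuous_on_interval a b g"
  shows "abs_continuous_on_interval a b (\<lambda>t. f t - g t)"
  unfolding abs_continuous_on_interval_def
proof (intro allI impI)
  fix e :: real assume "e > 0"
  then have e2: "e / 2 > 0" by simp
  obtain d1 where d1: "d1 > 0" "\<And>(n::nat) p q. short_cells a b n p q d1 \<Longrightarrow>
      (\<Sum>i<n. norm (f (q i) - f (p i))) < e / 2"
    using assms(1) e2 unfolding abs_continuous_on_interval_def by blast
  obtain d2 where d2: "d2 > 0" "\<And>(n::nat) p q. short_cells a b n p q d2 \<Longrightarrow>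
      (\<Sum>i<n. norm (g (q i) - g (p i))) < e / 2"
    using assms(2) e2 unfolding abs_continuous_on_interval_def by blast
  have "(\<Sum>i<n. norm (f (q i) - g (q i) - (f (p i) - g (p i)))) < e"
    if A: "short_cells a b n p q (min d1 d2)"
    for n :: nat and p q
  proof -
    have "(\<Sum>i<n. norm (f (q i) - g (q i) - (f (p i) - g (p i))))
        \<le> (\<Sum>i<n. norm (f (q i) - f (p i)) + norm (g (q i) - g (p i)))"
    proof (rule sum_mono)
      fix i
      have "f (q i) - g (q i) - (f (p i) - g (p i)) = (f (q i) - f (p i)) - (g (q i) - g (p i))"
        by simp
      then show "norm (f (q i) - g (q i) - (f (p i) - g (p i)))
          \<le> norm (f (q i) - f (p i)) + norm (g (q i) - g (p i))"
        by (metis norm_triangle_ineq4)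
    qed
    also have "\<dots> < e / 2 + e / 2"
      unfolding sum.distrib using A by (intro add_strict_mono d1(2) d2(2)) auto
    finally show ?thesis by simp
  qed
  then show "\<exists>d>0. \<forall>(n::nat) p q. short_cells a b n p q d \<longrightarrow>
      (\<Sum>i<n. norm (f (q i) - g (q i) - (f (p i) - g (p i)))) < e"
    using d1(1) d2(1) by (intro exI[of _ "min d1 d2"]) auto
qed

lemma abs_continuous_on_interval_subset:
  assumes "abs_continuous_on_interval a b f" "a \<le> a'" "b' \<le> b"
  shows "abs_continuous_on_interval a' b' f"
  unfolding abs_continuous_on_interval_def
proof (intro allI impI)
  fix e :: real assume "e > 0"
  then obtain d where d: "d > 0" "\<And>(n::nat) p q. short_cells a b n p q d \<Longrightarrow>
      (\<Sum>i<n. norm (f (q i) - f (p i))) < e"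
    using assms(1) unfolding abs_continuous_on_interval_def by blast
  show "\<exists>d>0. \<forall>(n::nat) p q. short_cells a' b' n p q d \<longrightarrow>
      (\<Sum>i<n. norm (f (q i) - f (p i))) < e"
    using d(1) assms(2,3) by (intro exI[of _ d]) (fastforce intro!: d(2))
qed

lemma lipschitz_on_imp_abs_continuous:
  fixes f :: "real \<Rightarrow> 'a::real_normed_vector"
  assumes "L-lipschitz_on {a..b} f"
  shows "abs_continuous_on_interval a b f"
  unfolding abs_continuous_on_interval_def
proof (intro allI impI)
  fix e :: real assume e: "e > 0"
  have L: "L \<ge> 0" using assms by (rule lipschitz_on_nonneg)
  have "(\<Sum>i<n. norm (f (q i) - f (p i))) < e"
    if A: "short_cells a b n p q (e / (L + 1))"
    for n :: nat and p q
  proof -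
    have "(\<Sum>i<n. norm (f (q i) - f (p i))) \<le> (\<Sum>i<n. L * (q i - p i))"
    proof (rule sum_mono)
      fix i assume "i \<in> {..<n}"
      then have "a \<le> p i" "p i \<le> q i" "q i \<le> b" using A by auto
      then show "norm (f (q i) - f (p i)) \<le> L * (q i - p i)"
        using lipschitz_on_normD[OF assms, of "q i" "p i"] by simp
    qed
    also have "\<dots> \<le> (L + 1) * (\<Sum>i<n. q i - p i)"
      unfolding sum_distrib_left using A by (intro sum_mono mult_right_mono) auto
    also have "\<dots> < e" using A L by (simp add: field_simps)
    finally show ?thesis .
  qed
  then show "\<exists>d>0. \<forall>(n::nat) p q. short_cells a b n p q d \<longrightarrow>
      (\<Sum>i<n. norm (f (q i) - f (p i))) < e"
    using e L by (intro exI[of _ "e / (L + 1)"]) auto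
qed

lemma abs_continuous_imp_continuous:
  assumes "abs_continuous_on_interval a b f"
  shows "continuous_on {a..b} f"
  unfolding continuous_on_iff
proof (intro ballI allI impI)
  fix x e :: real assume x: "x \<in> {a..b}" and "e > 0"
  then obtain d where d: "d > 0" "\<And>(n::nat) p q. short_cells a b n p q d \<Longrightarrow>
      (\<Sum>i<n. norm (f (q i) - f (p i))) < e"
    using assms unfolding abs_continuous_on_interval_def by blast
  have "dist (f y) (f x) < e" if y: "y \<in> {a..b}" "dist y x < d" for y
  proof -
    \<comment> \<open>A family with a single cell, whose ends are put in order by \<open>min\<close>
      and \<open>max\<close>.\<close>
    have "(\<Sum>i<1::nat. norm (f (max x y) - f (min x y))) < e"
      by (rule d(2)[of 1 "\<lambda>i. min x y" "\<lambda>i. max x y"])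
         (use x y in \<open>auto simp: dist_real_def disjoint_family_on_def\<close>)
    then show ?thesis
      by (auto simp: dist_norm norm_minus_commute max_def min_def split: if_splits)
  qed
  then show "\<exists>d>0. \<forall>y\<in>{a..b}. dist y x < d \<longrightarrow> dist (f y) (f x) < e"
    using d(1) by blast
qed

text \<open>
  Cousin's lemma: a fine tagged partition splits into cells tagged at points where the derivative
  bound holds, and cells tagged in the exceptional null set, which lie in an open set of small
  measure and are handled by absolute continuity.
\<close>

lemma abs_continuous_derivative_bound:
  fixes u :: "real \<Rightarrow> 'a::real_normed_vector"
  assumes ac: "abs_continuous_on_interval a b u" and ab: "a \<le> b" and C: "C \<ge> 0"
    and ae: "AE t in lebesgue. t \<in> {a..b} \<longrightarrow>
        (\<exists>v. (u has_vector_derivative v) (at t within {a..b}) \<and> norm v \<le> C)"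
  shows "norm (u b - u a) \<le> C * (b - a)"
proof (rule field_le_epsilon)
  fix e' :: real assume e': "e' > 0"
  \<comment> \<open>The cells with good tags cost an excess of \<open>e * (b - a)\<close>, the
    others \<open>e\<close>; together this is \<open>e'\<close>.\<close>
  define e where "e = e' / (b - a + 1)"
  have "e * (b - a + 1) = e'" using ab by (simp add: e_def)
  then have e: "e > 0" "e * (b - a) + e = e'"
    using e' ab by (simp_all add: e_def distrib_left)
  define good where "good t \<longleftrightarrow> (\<exists>v. (u has_vector_derivative v) (at t within {a..b}) \<and> norm v \<le> C)" for t
  define N where "N = {t\<in>{a..b}. \<not> good t}"
  have N: "N \<in> null_sets lebesgue"
  proof -
    have "AE t in lebesgue. t \<notin> N" using ae by (auto simp: N_def good_def)
    then obtain N' where "N' \<in> null_sets lebesgue" "N \<subseteq> N'"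
      by (auto simp: eventually_ae_filter)
    then show ?thesis using completion.complete2 by blast
  qed
  obtain d where d: "d > 0" "\<And>(n::nat) p q. short_cells a b n p q d \<Longrightarrow>
      (\<Sum>i<n. norm (u (q i) - u (p i))) < e"
    using ac e(1) unfolding abs_continuous_on_interval_def by blast
  have "N \<in> sets lebesgue" using N by blast
  then obtain T where T: "open T" "N \<subseteq> T" "T - N \<in> lmeasurable" "emeasure lebesgue (T - N) < ennreal d"
    using sets_lebesgue_outer_open[OF _ d(1)] by blast
  have Tl: "T \<in> lmeasurable" "measure lebesgue T < d"
  proof -
    have "emeasure lebesgue T = emeasure lebesgue (T - N)"
      using T(1) N by (intro emeasure_Diff_null_set[symmetric]) auto
    then have *: "emeasure lebesgue T < ennreal d" using T(4) by simp
    show "T \<in> lmeasurable" using T(1) * by (intro fmeasurableI) (auto simp: less_top[symmetric] top_unique intro: order.strict_trans)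
    then show "measure lebesgue T < d" using * d(1)
      by (metis emeasure_eq_measure2 ennreal_less_iff measure_nonneg)
  qed
  have "\<exists>r>0. \<forall>y\<in>{a..b}. norm (y - t) < r \<longrightarrow> norm (u y - u t) \<le> (C + e) * norm (y - t)"
    if "t \<in> {a..b}" "good t" for t
  proof -
    obtain v where v: "(u has_vector_derivative v) (at t within {a..b})" "norm v \<le> C"
      using \<open>good t\<close> good_def by blast
    obtain r where r: "r > 0" "\<And>y. y \<in> {a..b} \<Longrightarrow> norm (y - t) < r \<Longrightarrow>
        norm (u y - u t - (y - t) *\<^sub>R v) \<le> e * norm (y - t)"
      using v(1) e(1) unfolding has_vector_derivative_def has_derivative_within_alt by metis
    have "norm (u y - u t) \<le> (C + e) * norm (y - t)" if "y \<in> {a..b}" "norm (y - t) < r" for y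
    proof -
      have "norm (u y - u t) \<le> norm (u y - u t - (y - t) *\<^sub>R v) + norm ((y - t) *\<^sub>R v)"
        using norm_triangle_ineq[of "u y - u t - (y - t) *\<^sub>R v" "(y - t) *\<^sub>R v"] by simp
      also have "\<dots> \<le> e * norm (y - t) + norm (y - t) * C"
        using r(2)[OF that] v(2) by (intro add_mono) (auto intro: mult_left_mono)
      finally show ?thesis by (simp add: algebra_simps)
    qed
    with r(1) show ?thesis by blast
  qed
  then obtain r where r: "\<And>t. t \<in> {a..b} \<Longrightarrow> good t \<Longrightarrow> r t > 0"
    "\<And>t y. t \<in> {a..b} \<Longrightarrow> good t \<Longrightarrow> y \<in> {a..b} \<Longrightarrow> norm (y - t) < r t \<Longrightarrow>
       norm (u y - u t) \<le> (C + e) * norm (y - t)"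
    by metis
  \<comment> \<open>A cell tagged in \<open>N\<close> is forced into the small open set
    \<open>T\<close>; a cell with a good tag is forced into the ball where the difference quotient
    is controlled. The last case only makes the gauge total.\<close>
  define \<gamma> where "\<gamma> t = (if t \<in> N then T else if t \<in> {a..b} then ball t (r t) else ball t 1)" for t
  have "gauge \<gamma>"
    unfolding gauge_def \<gamma>_def using T(1,2) r(1) by (auto simp: N_def)
  then obtain p where p: "p tagged_division_of {a..b}" "\<gamma> fine p"
    by (rule fine_division_exists_real)
  note pD = tagged_division_ofD[OF p(1)]
  have cell: "\<exists>l h. K = {l..h} \<and> a \<le> l \<and> l \<le> t \<and> t \<le> h \<and> h \<le> b" if tK: "(t, K) \<in> p" for t K
  proof -
    obtain l h where "K = {l..h}" using pD(4)[OF tK] by auto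
    with pD(2,3)[OF tK] show ?thesis by auto
  qed
  define D where "D = (\<lambda>(t::real, K). norm (u (Sup K) - u (Inf K)))"
  define p1 where "p1 = {x\<in>p. fst x \<notin> N}"
  define p2 where "p2 = {x\<in>p. fst x \<in> N}"
  have fin: "finite p" "finite p1" "finite p2" using pD(1) by (auto simp: p1_def p2_def)
  have "norm (u b - u a) = norm (\<Sum>(t, K)\<in>p. u (Sup K) - u (Inf K))"
    by (subst additive_tagged_division_1[OF ab p(1)]) simp
  also have "\<dots> \<le> sum D p"
    unfolding D_def by (rule order_trans[OF norm_sum]) (simp add: case_prod_beta)
  also have "sum D p = sum D p1 + sum D p2"
    using fin by (subst sum.union_disjoint[symmetric]) (auto simp: p1_def p2_def intro!: sum.cong)
  also have "sum D p1 \<le> (C + e) * (b - a)"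
  proof -
    have "D x \<le> (case x of (t, K) \<Rightarrow> (C + e) * (Sup K - Inf K))" if x: "x \<in> p1" for x
    proof -
      obtain t K where tK: "x = (t, K)" by force
      obtain l h where K: "K = {l..h}" "a \<le> l" "l \<le> t" "t \<le> h" "h \<le> b"
        using cell[of t K] x tK unfolding p1_def by blast
      have t: "t \<in> {a..b}" "good t" "t \<notin> N" using x tK K by (auto simp: p1_def N_def)
      have "K \<subseteq> ball t (r t)"
        using fineD[OF p(2), of t K] x t tK by (simp add: \<gamma>_def p1_def)
      then have lh: "norm (l - t) < r t" "norm (h - t) < r t"
        using K subsetD[of K "ball t (r t)" l] subsetD[of K "ball t (r t)" h]
        by (simp_all add: dist_norm norm_minus_commute)
      have "norm (u h - u l) \<le> norm (u h - u t) + norm (u l - u t)"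
        using norm_triangle_ineq4[of "u h - u t" "u l - u t"] by simp
      also have "\<dots> \<le> (C + e) * (h - t) + (C + e) * (t - l)"
        using r(2)[OF t(1,2) _ lh(1)] r(2)[OF t(1,2) _ lh(2)] K by (intro add_mono) auto
      finally show ?thesis using K tK by (simp add: D_def algebra_simps)
    qed
    then have "sum D p1 \<le> (\<Sum>(t, K)\<in>p1. (C + e) * (Sup K - Inf K))" by (rule sum_mono)
    also have "\<dots> \<le> (\<Sum>(t, K)\<in>p. (C + e) * (Sup K - Inf K))"
    proof (rule sum_mono2)
      fix x assume "x \<in> p - p1"
      then obtain t K where tK: "x = (t, K)" "(t, K) \<in> p" by (cases x) auto
      from cell[OF tK(2)] obtain l h where "K = {l..h}" "l \<le> h" by force
      with tK(1) show "0 \<le> (case x of (t, K) \<Rightarrow> (C + e) * (Sup K - Inf K))" using C e(1) by simp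
    qed (use fin in \<open>auto simp: p1_def\<close>)
    also have "\<dots> = (C + e) * (b - a)"
      using additive_tagged_division_1[OF ab p(1), of "\<lambda>t. (C + e) * t"] by (simp add: algebra_simps)
    finally show ?thesis .
  qed
  also have "sum D p2 \<le> e"
  proof -
    obtain f where f: "bij_betw f {..<card p2} p2"
      using ex_bij_betw_nat_finite[OF fin(3)] by (auto simp: atLeast0LessThan)
    define P where "P i = Inf (snd (f i))" for i
    define Q where "Q i = Sup (snd (f i))" for i
    have fi: "snd (f i) = {P i..Q i} \<and> a \<le> P i \<and> P i \<le> Q i \<and> Q i \<le> b \<and> {P i..Q i} \<subseteq> T \<and> f i \<in> p"
      if "i < card p2" for i
    proof -
      have "f i \<in> p2" using bij_betwE[OF f] that by simp
      then obtain t K where tK: "f i = (t, K)" "(t, K) \<in> p" "t \<in> N" by (cases "f i") (auto simp: p2_def)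
      obtain l h where K: "K = {l..h}" "a \<le> l" "l \<le> t" "t \<le> h" "h \<le> b" using cell[OF tK(2)] by blast
      have "K \<subseteq> T" using fineD[OF p(2) tK(2)] tK(3) by (simp add: \<gamma>_def)
      then show ?thesis using K tK by (simp add: P_def Q_def)
    qed
    have disj: "disjoint_family_on (\<lambda>i. {P i<..<Q i}) {..<card p2}"
      unfolding disjoint_family_on_def
    proof (intro ballI impI)
      fix i j assume ij: "i \<in> {..<card p2}" "j \<in> {..<card p2}" "i \<noteq> j"
      then have "f i \<noteq> f j" using f by (auto simp: bij_betw_def inj_on_def)
      with pD(5)[of "fst (f i)" "snd (f i)" "fst (f j)" "snd (f j)"]
      have "interior (snd (f i)) \<inter> interior (snd (f j)) = {}"
        using fi ij by auto
      then show "{P i<..<Q i} \<inter> {P j<..<Q j} = {}"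
        using fi[of i] fi[of j] ij by simp
    qed
    \<comment> \<open>The open cells are disjoint and lie in \<open>T\<close>, so their total length
      is at most the measure of \<open>T\<close>, which is below the threshold of absolute
      continuity.\<close>
    have "(\<Sum>i<card p2. Q i - P i) = (\<Sum>i<card p2. measure lebesgue {P i<..<Q i})"
      using fi by (intro sum.cong) auto
    also have "\<dots> = measure lebesgue (\<Union>i<card p2. {P i<..<Q i})"
      using disj fi by (intro measure_finite_Union[symmetric]) (auto simp: emeasure_lborel_Ioo)
    also have "\<dots> \<le> measure lebesgue T"
      using fi Tl(1) by (intro measure_mono_fmeasurable) (force, auto)
    finally have "(\<Sum>i<card p2. Q i - P i) < d" using Tl(2) by simp
    then have "(\<Sum>i<card p2. norm (u (Q i) - u (P i))) < e"
      using fi disj by (intro d(2)) auto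
    moreover have "sum D p2 = (\<Sum>i<card p2. norm (u (Q i) - u (P i)))"
      unfolding sum.reindex_bij_betw[OF f, symmetric] D_def by (simp add: P_def Q_def case_prod_beta)
    ultimately show ?thesis by simp
  qed
  finally show "norm (u b - u a) \<le> C * (b - a) + e'"
    using e(2) by (simp add: algebra_simps)
qed

text \<open>The equation holds almost everywhere only, so the mean value inequality is replaced by
  \<open>abs_continuous_derivative_bound\<close>. On a time step of length
  \<open>1 / (2 * L)\<close> starting from agreement, let the difference \<open>u\<close> be largest
  in norm at \<open>s0\<close>; then \<open>norm (u s0)\<close> is at most half of itself. Finitely
  many such steps cover \<open>{0..1}\<close>. Compactness of both trajectories lets a Lipschitz
  bound on one ball suffice.\<close>

lemma ode_solution_unique:
  fixes F :: "real \<Rightarrow> 'a::euclidean_space \<Rightarrow> 'a"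
  assumes F: "\<And>r. \<exists>L. \<forall>t\<in>{0..1}. L-lipschitz_on (cball 0 r) (F t)"
    and x: "ode_solution F x0 x" and y: "ode_solution F x0 y" and t: "t \<in> {0..1}"
  shows "x t = y t"
proof -
  have acx: "abs_continuous_on_interval 0 1 x" and acy: "abs_continuous_on_interval 0 1 y"
    using x y by (auto simp: ode_solution_def)
  define u where "u = (\<lambda>t. x t - y t)"
  have acu: "abs_continuous_on_interval 0 1 u"
    unfolding u_def using acx acy by (rule abs_continuous_on_interval_diff)
  have cont: "continuous_on {0..1} x" "continuous_on {0..1} y" "continuous_on {0..1} u"
    using acx acy acu abs_continuous_imp_continuous by blast+
  have "compact (x ` {0..1} \<union> y ` {0..1})"
    using cont by (intro compact_Un compact_continuous_image) auto
  then obtain r where r: "x ` {0..1} \<union> y ` {0..1} \<subseteq> ball 0 r"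
    using bounded_subset_ballD[OF compact_imp_bounded, of _ 0] by blast
  have rxy: "norm (x s) \<le> r" "norm (y s) \<le> r" if "s \<in> {0..1}" for s
  proof -
    have "x s \<in> ball 0 r" "y s \<in> ball 0 r" using r that by blast+
    then show "norm (x s) \<le> r" "norm (y s) \<le> r" by auto
  qed
  obtain L0 where L0: "\<forall>t\<in>{0..1}. L0-lipschitz_on (cball 0 r) (F t)" using F by blast
  define L where "L = max L0 1"
  have L: "L \<ge> 1" "norm (F s (x s) - F s (y s)) \<le> L * norm (u s)" if "s \<in> {0..1}" for s
  proof -
    have "norm (F s (x s) - F s (y s)) \<le> L0 * norm (x s - y s)"
      using rxy that by (intro lipschitz_on_normD[OF L0[rule_format, OF that]]) auto
    also have "\<dots> \<le> L * norm (u s)" unfolding u_def L_def by (intro mult_right_mono) auto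
    finally show "norm (F s (x s) - F s (y s)) \<le> L * norm (u s)" .
  qed (simp add: L_def)
  have aeu: "AE s in lebesgue. s \<in> {0..1} \<longrightarrow>
      (u has_vector_derivative F s (x s) - F s (y s)) (at s within {0..1})"
  proof -
    have "AE s in lebesgue. s \<in> {0..1} \<longrightarrow> (x has_vector_derivative F s (x s)) (at s within {0..1})"
      "AE s in lebesgue. s \<in> {0..1} \<longrightarrow> (y has_vector_derivative F s (y s)) (at s within {0..1})"
      using x y by (auto simp: ode_solution_def)
    then show ?thesis
      by eventually_elim (auto simp: u_def intro: has_vector_derivative_diff)
  qed
  have step: "u s = 0" if a: "a \<in> {0..1}" "u a = 0" and s: "s \<in> {a..min 1 (a + 1 / (2 * L))}" for a s
  proof -
    define b where "b = min 1 (a + 1 / (2 * L))"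
    have L1: "L \<ge> 1" using L(1)[of 0] by simp
    have ab: "a \<le> b" "b \<le> 1" "b - a \<le> 1 / (2 * L)"
      using a(1) L1 by (auto simp: b_def)
    have "continuous_on {a..b} (\<lambda>s. norm (u s))"
      using ab a(1) by (intro continuous_intros continuous_on_subset[OF cont(3)]) auto
    then obtain s0 where s0: "s0 \<in> {a..b}" "\<And>s. s \<in> {a..b} \<Longrightarrow> norm (u s) \<le> norm (u s0)"
      using continuous_attains_sup[of "{a..b}" "\<lambda>s. norm (u s)"] ab by auto
    have "norm (u s0 - u a) \<le> (L * norm (u s0)) * (s0 - a)"
    proof (rule abs_continuous_derivative_bound)
      show "abs_continuous_on_interval a s0 u"
        using s0(1) ab a(1) by (intro abs_continuous_on_interval_subset[OF acu]) auto
      show "AE s in lebesgue. s \<in> {a..s0} \<longrightarrow>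
        (\<exists>v. (u has_vector_derivative v) (at s within {a..s0}) \<and> norm v \<le> L * norm (u s0))"
        using aeu
      proof eventually_elim
        case (elim s)
        show ?case
        proof
          assume s: "s \<in> {a..s0}"
          then have s01: "s \<in> {0..1}" using s0(1) ab a(1) by auto
          have "(u has_vector_derivative F s (x s) - F s (y s)) (at s within {a..s0})"
          proof (rule has_vector_derivative_within_subset)
            show "(u has_vector_derivative F s (x s) - F s (y s)) (at s within {0..1})"
              using elim s01 by simp
            show "{a..s0} \<subseteq> {0..1}" using s0(1) ab a(1) by auto
          qed
          moreover have "norm (F s (x s) - F s (y s)) \<le> L * norm (u s0)"
          proof -
            have "s \<in> {a..b}" using s s0(1) by simp
            from mult_left_mono[OF s0(2)[OF this], of L] L(2)[OF s01] L1 show ?thesis by linarith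
          qed
          ultimately show "\<exists>v. (u has_vector_derivative v) (at s within {a..s0}) \<and> norm v \<le> L * norm (u s0)"
            by (intro exI conjI)
        qed
      qed
    qed (use s0(1) L1 in auto)
    also have "\<dots> \<le> (L * norm (u s0)) * (1 / (2 * L))"
      using s0(1) ab L1 by (intro mult_left_mono) auto
    finally have "norm (u s0) \<le> norm (u s0) / 2" using a(2) L1 by simp
    then have "norm (u s0) = 0" by simp
    then show "u s = 0" using s0(2)[of s] s by (simp add: b_def)
  qed
  have "\<forall>s\<in>{0..1}. s \<le> k / (2 * L) \<longrightarrow> u s = 0" for k :: nat
  proof (induction k)
    case 0
    have "u 0 = 0" using x y by (simp add: u_def ode_solution_def)
    then show ?case by auto
  next
    case (Suc k)
    show ?case
    proof (intro ballI impI)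
      fix s assume s: "s \<in> {0..1::real}" "s \<le> Suc k / (2 * L)"
      have L1: "L \<ge> 1" using L(1)[of 0] by simp
      \<comment> \<open>The minimum also treats times \<open>s\<close> that earlier steps have
        already reached.\<close>
      define a where "a = min s (k / (2 * L))"
      have a01: "a \<in> {0..1}" using s L1 by (auto simp: a_def)
      moreover from a01 have "u a = 0" using Suc.IH by (auto simp: a_def)
      moreover have "s \<in> {a..min 1 (a + 1 / (2 * L))}"
        using s L1 by (auto simp: a_def min_def add_divide_distrib)
      ultimately show "u s = 0" using step by blast
    qed
  qed
  moreover obtain k :: nat where k: "2 * L \<le> k" using real_arch_simple by blast
  moreover have "t \<le> k / (2 * L)"
  proof -
    have "t * (2 * L) \<le> 1 * (2 * L)" using t L(1)[of 0] by (intro mult_right_mono) auto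
    then have "t * (2 * L) \<le> k" using k by linarith
    then show ?thesis using L(1)[of 0] by (subst pos_le_divide_eq) auto
  qed
  ultimately have "u t = 0" using t by blast
  then show ?thesis by (simp add: u_def)
qed

section \<open>Uniform limits of a semigroup of maps\<close>

lemma compact_continuous_modulus:
  fixes f :: "'a::metric_space \<Rightarrow> 'b::metric_space"
  assumes "compact S" "continuous_on S f" "e > 0"
  obtains d where "d > 0" "\<And>x y. x \<in> S \<Longrightarrow> y \<in> S \<Longrightarrow> dist y x < d \<Longrightarrow> dist (f y) (f x) < e"
proof -
  have "uniformly_continuous_on S f"
    using assms(2,1) by (rule compact_uniformly_continuous)
  then have "\<exists>d>0. \<forall>x\<in>S. \<forall>y\<in>S. dist y x < d \<longrightarrow> dist (f y) (f x) < e"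
    using assms(3) unfolding uniformly_continuous_on_def by blast
  then show thesis using that by blast
qed

lemma compact_continuous_bound:
  fixes f :: "'a::metric_space \<Rightarrow> 'b::real_normed_vector"
  assumes "compact S" "continuous_on S f"
  obtains B where "B > 0" "\<And>x. x \<in> S \<Longrightarrow> norm (f x) \<le> B"
proof -
  have "bounded (f ` S)"
    using compact_continuous_image[OF assms(2,1)] by (rule compact_imp_bounded)
  then show thesis using that unfolding bounded_pos by blast
qed

text \<open>Everything up to brackets uses only that the maps can be composed and send the compact
  set \<open>M\<close> to itself. The family \<open>R\<close> is later instantiated by the end maps
  of piecewise constant controls.\<close>

locale map_semigroup =
  fixes M :: "'a::euclidean_space set" and R :: "('a \<Rightarrow> 'a) set"
  assumes compact: "compact M"
    and maps: "X \<in> R \<Longrightarrow> X \<in> M \<rightarrow> M"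
    and cont: "X \<in> R \<Longrightarrow> continuous_on M X"
    and ident: "(\<lambda>x. x) \<in> R"
    and comp: "X \<in> R \<Longrightarrow> Y \<in> R \<Longrightarrow> (\<lambda>x. X (Y x)) \<in> R"
begin

definition cl :: "('a \<Rightarrow> 'a) set" where
  "cl = {P. P \<in> M \<rightarrow> M \<and> (\<forall>e>0. \<exists>X\<in>R. \<forall>x\<in>M. norm (P x - X x) \<le> e)}"

lemma cl_maps: "P \<in> cl \<Longrightarrow> P \<in> M \<rightarrow> M"
  by (simp add: cl_def)

lemma cl_in: "P \<in> cl \<Longrightarrow> x \<in> M \<Longrightarrow> P x \<in> M"
  by (auto simp: cl_def)

lemma maps_in: "X \<in> R \<Longrightarrow> x \<in> M \<Longrightarrow> X x \<in> M"
  using maps by blast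

lemma cl_approx: "P \<in> cl \<Longrightarrow> e > 0 \<Longrightarrow> \<exists>X\<in>R. \<forall>x\<in>M. norm (P x - X x) \<le> e"
  by (simp add: cl_def)

lemma subset_cl: "X \<in> R \<Longrightarrow> X \<in> cl"
  using maps by (auto simp: cl_def intro!: bexI[of _ X])

lemma cl_closed:
  assumes "P \<in> M \<rightarrow> M" "\<And>e. e > 0 \<Longrightarrow> \<exists>Q\<in>cl. \<forall>x\<in>M. norm (P x - Q x) \<le> e"
  shows "P \<in> cl"
  unfolding cl_def
proof (intro CollectI conjI allI impI assms(1))
  fix e :: real assume e: "e > 0"
  obtain Q where Q: "Q \<in> cl" "\<And>x. x \<in> M \<Longrightarrow> norm (P x - Q x) \<le> e / 2"
    using assms(2)[of "e / 2"] e by auto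
  obtain X where X: "X \<in> R" "\<And>x. x \<in> M \<Longrightarrow> norm (Q x - X x) \<le> e / 2"
    using cl_approx[OF Q(1), of "e / 2"] e by auto
  have "norm (P x - X x) \<le> e" if "x \<in> M" for x
    using norm_triangle_ineq[of "P x - Q x" "Q x - X x"] Q(2)[OF that] X(2)[OF that] by simp
  then show "\<exists>X\<in>R. \<forall>x\<in>M. norm (P x - X x) \<le> e" using X(1) by blast
qed

lemma cl_cong:
  assumes "P \<in> cl" "\<And>x. x \<in> M \<Longrightarrow> Q x = P x"
  shows "Q \<in> cl"
proof (rule cl_closed)
  show "Q \<in> M \<rightarrow> M" using cl_maps[OF assms(1)] assms(2) by auto
  show "\<exists>P\<in>cl. \<forall>x\<in>M. norm (Q x - P x) \<le> e" if "e > 0" for e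
    using assms that by (intro bexI[of _ P]) auto
qed

lemma cl_continuous:
  assumes "P \<in> cl"
  shows "continuous_on M P"
  unfolding continuous_on_iff
proof (intro ballI allI impI)
  fix x e assume x: "x \<in> M" and e: "(e::real) > 0"
  obtain X where X: "X \<in> R" "\<And>x. x \<in> M \<Longrightarrow> norm (P x - X x) \<le> e / 4"
    using cl_approx[OF assms, of "e / 4"] e by auto
  have "\<exists>d>0. \<forall>y\<in>M. dist y x < d \<longrightarrow> dist (X y) (X x) < e / 4"
    using cont[OF X(1), unfolded continuous_on_iff, rule_format, OF x, of "e / 4"] e by auto
  then obtain d where d: "d > 0" "\<And>y. y \<in> M \<Longrightarrow> dist y x < d \<Longrightarrow> dist (X y) (X x) < e / 4"
    by blast
  have "dist (P y) (P x) < e" if y: "y \<in> M" "dist y x < d" for y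
  proof -
    have "dist (P y) (X y) \<le> e / 4" "dist (P x) (X x) \<le> e / 4"
      using X(2) x y by (auto simp: dist_norm)
    with d(2)[OF y] e show ?thesis
      using dist_triangle[of "P y" "P x" "X y"] dist_triangle[of "X y" "P x" "X x"]
        dist_commute[of "P x" "X x"] by linarith
  qed
  then show "\<exists>d>0. \<forall>y\<in>M. dist y x < d \<longrightarrow> dist (P y) (P x) < e" using d(1) by blast
qed

text \<open>The error of \<open>Q\<close> is absorbed by the uniform continuity of \<open>P\<close>
  on \<open>M\<close>; the error of \<open>P\<close> is evaluated at a point that is already in
  \<open>M\<close>.\<close>

lemma cl_comp:
  assumes P: "P \<in> cl" and Q: "Q \<in> cl"
  shows "(\<lambda>x. P (Q x)) \<in> cl"
  unfolding cl_def
proof (intro CollectI conjI allI impI)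
  show "(\<lambda>x. P (Q x)) \<in> M \<rightarrow> M" by (intro Pi_I cl_in[OF P] cl_in[OF Q])
  fix e :: real assume e: "e > 0"
  obtain d where d: "d > 0"
    "\<And>x y. x \<in> M \<Longrightarrow> y \<in> M \<Longrightarrow> dist y x < d \<Longrightarrow> dist (P y) (P x) < e / 2"
    using compact_continuous_modulus[OF compact cl_continuous[OF P] half_gt_zero[OF e]] by blast
  obtain X where X: "X \<in> R" "\<And>x. x \<in> M \<Longrightarrow> norm (P x - X x) \<le> e / 2"
    using cl_approx[OF P half_gt_zero[OF e]] by blast
  obtain Y where Y: "Y \<in> R" "\<And>x. x \<in> M \<Longrightarrow> norm (Q x - Y x) \<le> d / 2"
    using cl_approx[OF Q half_gt_zero[OF d(1)]] by blast
  have "norm (P (Q x) - X (Y x)) \<le> e" if x: "x \<in> M" for x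
  proof -
    have m: "Q x \<in> M" "Y x \<in> M" by (rule cl_in[OF Q x], rule maps_in[OF Y(1) x])
    have "dist (P (Q x)) (P (Y x)) < e / 2"
      using Y(2)[OF x] d(1) by (intro d(2) m) (simp add: dist_norm)
    then show ?thesis
      using X(2)[OF m(2)] norm_triangle_ineq[of "P (Q x) - P (Y x)" "P (Y x) - X (Y x)"]
      by (simp add: dist_norm)
  qed
  then show "\<exists>X\<in>R. \<forall>x\<in>M. norm (P (Q x) - X x) \<le> e"
    by (intro bexI[OF _ comp[OF X(1) Y(1)]]) simp
qed

section \<open>Approximable vector fields\<close>

abbreviation has_step :: "('a \<Rightarrow> 'a) \<Rightarrow> real \<Rightarrow> real \<Rightarrow> bool" where
  "has_step W e s \<equiv> \<exists>P\<in>cl. \<forall>x\<in>M. norm (P x - x - s *\<^sub>R W x) \<le> e * s"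

text \<open>One may think of the tangent cone at the identity of the uniform closure of
  \<open>R\<close>. Only positive \<open>s\<close> occur, so approximability of \<open>- W\<close>
  is a separate statement, and neither a Lipschitz condition nor a flow is asked for.\<close>

definition approximable :: "('a \<Rightarrow> 'a) \<Rightarrow> bool" where
  "approximable W \<longleftrightarrow> continuous_on M W \<and>
     (\<forall>e>0. \<exists>d>0. \<forall>s. 0 < s \<and> s < d \<longrightarrow> (has_step W e s))"

lemma approximable_continuous: "approximable W \<Longrightarrow> continuous_on M W"
  by (simp add: approximable_def)

lemma approximableE:
  assumes "approximable W" "e > 0"
  obtains d where "d > 0"
    "\<And>s. 0 < s \<Longrightarrow> s < d \<Longrightarrow> has_step W e s"
  using assms unfolding approximable_def by blast

text \<open>Replacing \<open>W\<close> by \<open>V\<close> changes a step of length \<open>s\<close>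
  by \<open>s\<close> times their distance, an error of the same order as the tolerance
  \<open>e * s\<close>.\<close>

lemma approximable_limit:
  assumes "continuous_on M W"
    "\<And>e. e > 0 \<Longrightarrow> \<exists>V. approximable V \<and> (\<forall>x\<in>M. norm (W x - V x) \<le> e)"
  shows "approximable W"
  unfolding approximable_def
proof (intro conjI allI impI assms(1))
  fix e :: real assume "e > 0"
  then have e2: "e / 2 > 0" by simp
  obtain V where V: "approximable V" "\<And>x. x \<in> M \<Longrightarrow> norm (W x - V x) \<le> e / 2"
    using assms(2)[OF e2] by blast
  obtain d where d: "d > 0"
    "\<And>s. 0 < s \<Longrightarrow> s < d \<Longrightarrow> has_step V (e / 2) s"
    using approximableE[OF V(1) e2] by blast
  have "has_step W e s" if s: "0 < s" "s < d" for s
  proof -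
    obtain P where P: "P \<in> cl" "\<And>x. x \<in> M \<Longrightarrow> norm (P x - x - s *\<^sub>R V x) \<le> e / 2 * s"
      using d(2)[OF s] by blast
    have "norm (P x - x - s *\<^sub>R W x) \<le> e * s" if x: "x \<in> M" for x
    proof -
      have *: "norm (s *\<^sub>R (W x - V x)) \<le> s * (e / 2)"
        using mult_left_mono[OF V(2)[OF x], of s] s(1) by simp
      have "P x - x - s *\<^sub>R W x = (P x - x - s *\<^sub>R V x) - s *\<^sub>R (W x - V x)"
        by (simp add: algebra_simps)
      also have "norm \<dots> \<le> e / 2 * s + s * (e / 2)"
        using norm_triangle_ineq4[of "P x - x - s *\<^sub>R V x" "s *\<^sub>R (W x - V x)"] P(2)[OF x] *
        by linarith
      finally show ?thesis by simp
    qed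
    then show ?thesis using P(1) by blast
  qed
  then show "\<exists>d>0. \<forall>s. 0 < s \<and> s < d \<longrightarrow> (has_step W e s)"
    using d(1) by blast
qed

lemma approximable_cong:
  assumes "approximable V" "\<And>x. x \<in> M \<Longrightarrow> W x = V x"
  shows "approximable W"
proof (rule approximable_limit)
  show "continuous_on M W"
    using approximable_continuous[OF assms(1)] by (rule continuous_on_eq) (simp add: assms(2))
  show "\<exists>V. approximable V \<and> (\<forall>x\<in>M. norm (W x - V x) \<le> e)" if "e > 0" for e
    using assms that by (intro exI[of _ V]) auto
qed

lemma approximable_quadratic:
  assumes "continuous_on M W"
    "\<And>s. 0 < s \<Longrightarrow> s \<le> 1 \<Longrightarrow> \<exists>P\<in>cl. \<forall>x\<in>M. norm (P x - x - s *\<^sub>R W x) \<le> C * s\<^sup>2"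
  shows "approximable W"
  unfolding approximable_def
proof (intro conjI allI impI assms(1))
  fix e :: real assume e: "e > 0"
  define d where "d = min 1 (e / (\<bar>C\<bar> + 1))"
  have d: "d > 0" using e by (simp add: d_def)
  have "has_step W e s" if s: "0 < s" "s < d" for s
  proof -
    have "C * s \<le> (\<bar>C\<bar> + 1) * s" using s by (intro mult_right_mono) auto
    also have "\<dots> \<le> e" using s by (simp add: d_def pos_less_divide_eq mult.commute less_imp_le)
    finally have "C * s * s \<le> e * s" using s by (intro mult_right_mono) auto
    then have "C * s\<^sup>2 \<le> e * s" by (simp add: power2_eq_square mult.assoc)
    moreover obtain P where "P \<in> cl" "\<forall>x\<in>M. norm (P x - x - s *\<^sub>R W x) \<le> C * s\<^sup>2"
      using assms(2)[of s] s by (auto simp: d_def)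
    ultimately show ?thesis by (intro bexI[of _ P]) auto
  qed
  then show "\<exists>d>0. \<forall>s. 0 < s \<and> s < d \<longrightarrow> (has_step W e s)"
    using d by blast
qed

lemma approximable_zero: "approximable (\<lambda>x. 0)"
proof (rule approximable_quadratic[where C = 0])
  show "\<exists>P\<in>cl. \<forall>x\<in>M. norm (P x - x - s *\<^sub>R 0) \<le> 0 * s\<^sup>2" for s :: real
    by (rule bexI[OF _ subset_cl[OF ident]]) simp
qed simp

text \<open>Operator splitting: a \<open>W\<close>-step followed by a \<open>V\<close>-step. The
  latter sees \<open>V\<close> at the moved point, and uniform continuity of \<open>V\<close> makes
  up for the displacement.\<close>

lemma approximable_add:
  assumes V: "approximable V" and W: "approximable W"
  shows "approximable (\<lambda>x. V x + W x)"
  unfolding approximable_def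
proof (intro conjI allI impI)
  note cV = approximable_continuous[OF V] and cW = approximable_continuous[OF W]
  show "continuous_on M (\<lambda>x. V x + W x)" by (intro continuous_on_add cV cW)
  fix e :: real assume "e > 0"
  then have e3: "e / 3 > 0" by simp
  obtain d1 where d1: "d1 > 0"
    "\<And>s. 0 < s \<Longrightarrow> s < d1 \<Longrightarrow> has_step V (e / 3) s"
    using approximableE[OF V e3] by blast
  obtain d2 where d2: "d2 > 0"
    "\<And>s. 0 < s \<Longrightarrow> s < d2 \<Longrightarrow> has_step W (e / 3) s"
    using approximableE[OF W e3] by blast
  obtain d3 where d3: "d3 > 0"
    "\<And>x y. x \<in> M \<Longrightarrow> y \<in> M \<Longrightarrow> dist y x < d3 \<Longrightarrow> dist (V y) (V x) < e / 3"
    using compact_continuous_modulus[OF compact cV e3] by blast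
  obtain B where B: "B > 0" "\<And>x. x \<in> M \<Longrightarrow> norm (W x) \<le> B"
    using compact_continuous_bound[OF compact cW] by blast
  \<comment> \<open>\<open>B + e / 3\<close> bounds the displacement of a \<open>W\<close>-step per
    unit of \<open>s\<close>, so \<open>V\<close> changes by less than \<open>e / 3\<close> over
    it.\<close>
  define d where "d = min d1 (min d2 (d3 / (B + e / 3)))"
  have d: "d > 0" using d1(1) d2(1) d3(1) B(1) e3 by (simp add: d_def)
  have "\<exists>P\<in>cl. \<forall>x\<in>M. norm (P x - x - s *\<^sub>R (V x + W x)) \<le> e * s" if s: "0 < s" "s < d" for s
  proof -
    have sd: "s < d1" "s < d2" "s * (B + e / 3) < d3"
      using s B(1) e3 by (auto simp: d_def pos_less_divide_eq)
    obtain P where P: "P \<in> cl" "\<And>x. x \<in> M \<Longrightarrow> norm (P x - x - s *\<^sub>R V x) \<le> e / 3 * s"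
      using d1(2)[OF s(1) sd(1)] by blast
    obtain Q where Q: "Q \<in> cl" "\<And>x. x \<in> M \<Longrightarrow> norm (Q x - x - s *\<^sub>R W x) \<le> e / 3 * s"
      using d2(2)[OF s(1) sd(2)] by blast
    have "norm (P (Q x) - x - s *\<^sub>R (V x + W x)) \<le> e * s" if x: "x \<in> M" for x
    proof -
      have m: "Q x \<in> M" by (rule cl_in[OF Q(1) x])
      have "norm (Q x - x) \<le> norm (Q x - x - s *\<^sub>R W x) + norm (s *\<^sub>R W x)"
        using norm_triangle_ineq[of "Q x - x - s *\<^sub>R W x" "s *\<^sub>R W x"] by simp
      also have "\<dots> \<le> e / 3 * s + s * B"
        using Q(2)[OF x] B(2)[OF x] s(1) by (intro add_mono) auto
      also have "\<dots> < d3" using sd(3) by (simp add: algebra_simps)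
      finally have "dist (V (Q x)) (V x) < e / 3"
        by (intro d3(2) x m) (simp add: dist_norm)
      then have VQ: "norm (s *\<^sub>R (V (Q x) - V x)) \<le> s * (e / 3)"
        using s(1) by (simp add: dist_norm)
      have "P (Q x) - x - s *\<^sub>R (V x + W x)
          = (P (Q x) - Q x - s *\<^sub>R V (Q x)) + (Q x - x - s *\<^sub>R W x) + s *\<^sub>R (V (Q x) - V x)"
        by (simp add: algebra_simps)
      also have "norm \<dots> \<le> e / 3 * s + e / 3 * s + s * (e / 3)"
        by (intro norm_triangle_mono P(2) Q(2) m x VQ)
      finally show ?thesis by (simp add: algebra_simps)
    qed
    then show ?thesis by (intro bexI[OF _ cl_comp[OF P(1) Q(1)]]) simp
  qed
  then show "\<exists>d>0. \<forall>s. 0 < s \<and> s < d \<longrightarrow>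
      (\<exists>P\<in>cl. \<forall>x\<in>M. norm (P x - x - s *\<^sub>R (V x + W x)) \<le> e * s)"
    using d by blast
qed

lemma approximable_sum:
  "(\<And>i. i \<in> I \<Longrightarrow> approximable (W i)) \<Longrightarrow> approximable (\<lambda>x. \<Sum>i\<in>I. W i x)"
proof (induction I rule: infinite_finite_induct)
  case (insert i I)
  then show ?case using approximable_add[of "W i" "\<lambda>x. \<Sum>i\<in>I. W i x"] by simp
qed (simp_all add: approximable_zero)

text \<open>Each step of length \<open>h\<close> multiplies the error by at most \<open>1 + L h\<close> and adds at most \<open>2 e h\<close>.\<close>

lemma euler_limit:
  fixes c :: "real \<Rightarrow> 'a \<Rightarrow> 'a" and V :: "real \<Rightarrow> 'a \<Rightarrow> 'a"
  assumes c0: "\<And>x. x \<in> M \<Longrightarrow> c 0 x = x" and cM: "\<And>x t. x \<in> M \<Longrightarrow> t \<in> {0..1} \<Longrightarrow> c t x \<in> M"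
    and lip: "\<And>t. t \<in> {0..1} \<Longrightarrow> L-lipschitz_on M (V t)"
    and consistent: "\<And>e. e > 0 \<Longrightarrow> \<exists>d>0. \<forall>x\<in>M. \<forall>t s. 0 \<le> t \<and> 0 < s \<and> s < d \<and> t + s \<le> 1 \<longrightarrow>
        norm (c (t + s) x - c t x - s *\<^sub>R V t (c t x)) \<le> e * s"
    and approx: "\<And>e. e > 0 \<Longrightarrow> \<exists>d>0. \<forall>s t. 0 < s \<and> s < d \<and> t \<in> {0..1} \<longrightarrow>
        (has_step (V t) e s)"
    and T: "T \<in> {0..1}"
  shows "c T \<in> cl"
proof (cases "T = 0")
  case True
  show ?thesis by (rule cl_cong[OF subset_cl[OF ident]]) (simp add: True c0)
next
  case False
  then have T0: "T > 0" using T by simp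
  have L: "L \<ge> 0" using lip[OF T] lipschitz_on_nonneg by blast
  show ?thesis
  proof (rule cl_closed)
    show "c T \<in> M \<rightarrow> M" using cM T by auto
    fix \<epsilon> :: real assume "\<epsilon> > 0"
    \<comment> \<open>The accumulated error is at most \<open>2 * e * T * (1 + L * h) ^ n\<close>,
      hence at most \<open>2 * e * exp L\<close>.\<close>
    define e where "e = \<epsilon> / (2 * exp L)"
    have e: "e > 0" using \<open>\<epsilon> > 0\<close> by (simp add: e_def)
    obtain d1 where d1: "d1 > 0" "\<And>x t s. x \<in> M \<Longrightarrow> 0 \<le> t \<Longrightarrow> 0 < s \<Longrightarrow> s < d1 \<Longrightarrow> t + s \<le> 1 \<Longrightarrow>
        norm (c (t + s) x - c t x - s *\<^sub>R V t (c t x)) \<le> e * s"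
      using consistent[OF e] by blast
    obtain d2 where d2: "d2 > 0" "\<And>t s. 0 < s \<Longrightarrow> s < d2 \<Longrightarrow> t \<in> {0..1} \<Longrightarrow>
        has_step (V t) e s"
      using approx[OF e] by blast
    have "T / min d1 d2 > 0" using T0 d1(1) d2(1) by simp
    then obtain n :: nat where n: "T / min d1 d2 < n" using reals_Archimedean2 by blast
    then have n0: "n > 0" using \<open>T / min d1 d2 > 0\<close> by (cases n) auto
    define h where "h = T / n"
    have "h < min d1 d2"
      using n n0 d1(1) d2(1) by (simp add: h_def pos_divide_less_eq mult.commute del: min_less_iff_conj)
    then have h: "h > 0" "h < d1" "h < d2" "n * h = T"
      using n0 T0 by (auto simp: h_def)
    have kh: "k * h \<in> {0..1}" "k * h + h \<le> T" if "k < n" for k :: nat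
    proof -
      have "(k + 1) * h \<le> n * h" using that h(1) by (intro mult_right_mono) auto
      then show "k * h + h \<le> T" using h(4) by (simp add: algebra_simps)
      then show "k * h \<in> {0..1}" using T h(1) by simp
    qed
    have "\<forall>k::nat. \<exists>P. k < n \<longrightarrow> P \<in> cl \<and> (\<forall>x\<in>M. norm (P x - x - h *\<^sub>R V (k * h) x) \<le> e * h)"
    proof
      fix k :: nat
      show "\<exists>P. k < n \<longrightarrow> P \<in> cl \<and> (\<forall>x\<in>M. norm (P x - x - h *\<^sub>R V (k * h) x) \<le> e * h)"
      proof (cases "k < n")
        case True
        from d2(2)[OF h(1,3) kh(1)[OF this]] show ?thesis by blast
      qed auto
    qed
    from choice[OF this] obtain P where
      P0: "\<forall>k::nat. k < n \<longrightarrow> P k \<in> cl \<and> (\<forall>x\<in>M. norm (P k x - x - h *\<^sub>R V (k * h) x) \<le> e * h)"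
      by blast
    then have P: "\<And>k. k < n \<Longrightarrow> P k \<in> cl"
      "\<And>k x. k < n \<Longrightarrow> x \<in> M \<Longrightarrow> norm (P k x - x - h *\<^sub>R V (k * h) x) \<le> e * h"
      by blast+
    define Q where "Q = rec_nat (\<lambda>x. x) (\<lambda>k q x. P k (q x))"
    have Q0: "Q 0 = (\<lambda>x. x)" and QS: "\<And>k. Q (Suc k) = (\<lambda>x. P k (Q k x))"
      by (simp_all add: Q_def)
    have Qcl: "Q k \<in> cl" if "k \<le> n" for k
      using that
    proof (induction k)
      case (Suc k)
      then show ?case unfolding QS using cl_comp[OF P(1), of k "Q k"] by simp
    qed (simp add: Q0 subset_cl[OF ident])
    have err: "norm (c (k * h) x - Q k x) \<le> 2 * e * (k * h) * (1 + L * h) ^ k" if "k \<le> n" "x \<in> M" for k x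
      using that(1)
    proof (induction k)
      case 0
      then show ?case using c0 that by (simp add: Q0)
    next
      case (Suc k)
      then have k: "k < n" by simp
      have m: "c (k * h) x \<in> M" "Q k x \<in> M"
        using cM[OF that(2) kh(1)[OF k]] cl_maps[OF Qcl[of k]] k that(2) by auto
      have kS: "Suc k * h = k * h + h" by (simp add: algebra_simps)
      \<comment> \<open>The two points are compared through the exact field \<open>V\<close>, whose
        Lipschitz constant is known; the map \<open>P k\<close> is compared with its own Euler step
        at the same point only.\<close>
      have eq: "c (Suc k * h) x - Q (Suc k) x = (c (k * h + h) x - c (k * h) x - h *\<^sub>R V (k * h) (c (k * h) x))
          + - (P k (Q k x) - Q k x - h *\<^sub>R V (k * h) (Q k x))
          + (c (k * h) x - Q k x) + h *\<^sub>R (V (k * h) (c (k * h) x) - V (k * h) (Q k x))"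
        unfolding kS QS by (simp add: scaleR_diff_right)
      have "norm (c (Suc k * h) x - Q (Suc k) x) \<le> e * h + e * h
          + norm (c (k * h) x - Q k x) + h * (L * norm (c (k * h) x - Q k x))"
        unfolding eq
      proof (intro norm_triangle_mono order_refl)
        show "norm (c (k * h + h) x - c (k * h) x - h *\<^sub>R V (k * h) (c (k * h) x)) \<le> e * h"
          using kh[OF k] T by (intro d1(2) that h) auto
        show "norm (- (P k (Q k x) - Q k x - h *\<^sub>R V (k * h) (Q k x))) \<le> e * h"
          unfolding norm_minus_cancel by (intro P(2) k m)
        show "norm (h *\<^sub>R (V (k * h) (c (k * h) x) - V (k * h) (Q k x)))
            \<le> h * (L * norm (c (k * h) x - Q k x))"
          using lipschitz_on_normD[OF lip[OF kh(1)[OF k]] m] h(1) by simp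
      qed
      also have "\<dots> = 2 * e * h + (1 + L * h) * norm (c (k * h) x - Q k x)"
        by (simp add: algebra_simps)
      also have "\<dots> \<le> 2 * e * h * (1 + L * h) ^ Suc k + (1 + L * h) * (2 * e * (k * h) * (1 + L * h) ^ k)"
      proof (rule add_mono)
        have "1 \<le> (1 + L * h) ^ Suc k" using L h(1) by (intro one_le_power) auto
        then show "2 * e * h \<le> 2 * e * h * (1 + L * h) ^ Suc k"
          using e h(1) mult_left_mono[of 1 "(1 + L * h) ^ Suc k" "2 * e * h"] by simp
        show "(1 + L * h) * norm (c (k * h) x - Q k x) \<le> (1 + L * h) * (2 * e * (k * h) * (1 + L * h) ^ k)"
          using Suc L h(1) by (intro mult_left_mono) auto
      qed
      also have "\<dots> = 2 * e * (Suc k * h) * (1 + L * h) ^ Suc k"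
        by (simp add: algebra_simps)
      finally show ?case .
    qed
    have "norm (c T x - Q n x) \<le> \<epsilon>" if x: "x \<in> M" for x
    proof -
      have "(1 + L * h) ^ n \<le> exp (L * h) ^ n"
        using L h(1) by (intro power_mono exp_ge_add_one_self) auto
      also have "\<dots> = exp (L * T)"
        using h(4) by (simp add: exp_of_nat_mult[symmetric] mult_ac)
      also have "\<dots> \<le> exp L" using L T by (simp add: mult_left_le)
      finally have "2 * e * T * (1 + L * h) ^ n \<le> 2 * e * 1 * exp L"
        using e T L h(1) by (intro mult_mono) auto
      also have "\<dots> = \<epsilon>" by (simp add: e_def)
      finally show ?thesis using err[of n x] x h(4) by simp
    qed
    then show "\<exists>Q\<in>cl. \<forall>x\<in>M. norm (c T x - Q x) \<le> \<epsilon>" using Qcl[of n] by blast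
  qed
qed

text \<open>The Euler scheme with a field frozen in time; the quadratic remainder of
  \<open>flow_on_expansion\<close> gives consistency.\<close>

lemma flow_in_cl:
  assumes W: "approximable W" and lip: "L-lipschitz_on M W" and flow: "flow_on M W \<Phi>" and t: "t \<in> {0..1}"
  shows "\<Phi> t \<in> cl"
proof -
  obtain B where B: "\<And>x. x \<in> M \<Longrightarrow> norm (W x) \<le> B"
    using compact_continuous_bound[OF compact approximable_continuous[OF W]] by blast
  show ?thesis
  proof (rule euler_limit[where V = "\<lambda>t. W" and L = L, OF _ _ _ _ _ t])
    fix e :: real assume e: "e > 0"
    define d where "d = e / (\<bar>L * B\<bar> + 1)"
    have d: "d > 0" using e by (simp add: d_def)
    have "norm (\<Phi> (t + s) x - \<Phi> t x - s *\<^sub>R W (\<Phi> t x)) \<le> e * s"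
      if "x \<in> M" "0 \<le> t" "0 < s" "s < d" "t + s \<le> 1" for x t s
    proof -
      have "L * B * s \<le> (\<bar>L * B\<bar> + 1) * s" using that by (intro mult_right_mono) auto
      also have "\<dots> \<le> e" using that by (simp add: d_def pos_less_divide_eq mult.commute less_imp_le)
      finally have "L * B * s * s \<le> e * s" using that by (intro mult_right_mono) auto
      then have "L * B * s\<^sup>2 \<le> e * s" by (simp add: power2_eq_square mult.assoc)
      then show ?thesis
        using flow_on_expansion[OF flow lip B that(1,2), of "t + s"] that by simp
    qed
    then show "\<exists>d>0. \<forall>x\<in>M. \<forall>t s. 0 \<le> t \<and> 0 < s \<and> s < d \<and> t + s \<le> 1 \<longrightarrow>
        norm (\<Phi> (t + s) x - \<Phi> t x - s *\<^sub>R W (\<Phi> t x)) \<le> e * s"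
      using d by blast
    show "\<exists>d>0. \<forall>s t. 0 < s \<and> s < d \<and> t \<in> {0..1::real} \<longrightarrow>
        (has_step W e s)"
    proof -
      obtain d where "d > 0"
        "\<And>s. 0 < s \<Longrightarrow> s < d \<Longrightarrow> has_step W e s"
        using approximableE[OF W e] by blast
      then show ?thesis by (intro exI[of _ d]) simp
    qed
  next
    show "\<Phi> 0 x = x" if "x \<in> M" for x using flow that by (simp add: flow_on_def)
    show "\<Phi> t x \<in> M" if "x \<in> M" "t \<in> {0..1}" for x t using flow that by (simp add: flow_on_def)
    show "L-lipschitz_on M W" by (rule lip)
  qed
qed

end

section \<open>Second-order expansions and brackets\<close>

text \<open>Second-order Taylor expansion at time 0, uniform on \<open>M\<close>, with coefficients
  \<open>u\<close> and \<open>v\<close>. In a commutator the terms of first order cancel, so the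
  bracket becomes visible only at this order.\<close>

definition jet2 ::
  "'a::euclidean_space set \<Rightarrow> (real \<Rightarrow> 'a \<Rightarrow> 'a) \<Rightarrow> ('a \<Rightarrow> 'a) \<Rightarrow> ('a \<Rightarrow> 'a) \<Rightarrow> bool" where
  "jet2 M \<phi> u v \<longleftrightarrow> (\<forall>e>0. \<exists>d>0. \<forall>s x. 0 < s \<and> s < d \<and> x \<in> M \<longrightarrow>
     \<phi> s x \<in> M \<and> norm (\<phi> s x - x - s *\<^sub>R u x - s\<^sup>2 *\<^sub>R v x) \<le> e * s\<^sup>2)"

lemma jet2E:
  assumes "jet2 M \<phi> u v" "e > 0"
  obtains d where "d > 0" "\<And>s x. 0 < s \<Longrightarrow> s < d \<Longrightarrow> x \<in> M \<Longrightarrow> \<phi> s x \<in> M"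
    "\<And>s x. 0 < s \<Longrightarrow> s < d \<Longrightarrow> x \<in> M \<Longrightarrow> norm (\<phi> s x - x - s *\<^sub>R u x - s\<^sup>2 *\<^sub>R v x) \<le> e * s\<^sup>2"
proof -
  have "\<exists>d>0. \<forall>s x. 0 < s \<and> s < d \<and> x \<in> M \<longrightarrow>
     \<phi> s x \<in> M \<and> norm (\<phi> s x - x - s *\<^sub>R u x - s\<^sup>2 *\<^sub>R v x) \<le> e * s\<^sup>2"
    using assms unfolding jet2_def by blast
  then show thesis using that by blast
qed

lemma jet2_cong:
  assumes "jet2 M \<phi> u v" "\<And>x. x \<in> M \<Longrightarrow> u x = u' x" "\<And>x. x \<in> M \<Longrightarrow> v x = v' x"
  shows "jet2 M \<phi> u' v'"
proof -
  have "norm (\<phi> s x - x - s *\<^sub>R u x - s\<^sup>2 *\<^sub>R v x) = norm (\<phi> s x - x - s *\<^sub>R u' x - s\<^sup>2 *\<^sub>R v' x)"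
    if "x \<in> M" for s x
    using assms(2,3)[OF that] by simp
  then show ?thesis
    using assms(1) unfolding jet2_def by (simp cong: conj_cong)
qed

lemma smooth_derivative_bound_on_compact:
  fixes f :: "'a::euclidean_space \<Rightarrow> 'b::real_normed_vector"
  assumes "smooth_on UNIV f" "compact M"
  obtains K where "K > 0" "\<And>x v. x \<in> M \<Longrightarrow> norm (fderiv f x v) \<le> K * norm v"
proof -
  have "continuous_on M (\<lambda>x. \<Sum>b\<in>Basis. norm (fderiv f x b))"
    by (intro continuous_intros continuous_on_subset[OF smooth_on_continuous_on[OF smooth_on_directional[OF assms(1)]]]) auto
  then obtain K where K: "K > 0"
    "\<And>x. x \<in> M \<Longrightarrow> norm (\<Sum>b\<in>Basis. norm (fderiv f x b)) \<le> K"
    using compact_continuous_bound[OF assms(2)] by blast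
  show thesis
  proof (rule that[OF K(1)])
    fix x v assume x: "x \<in> M"
    have bl: "bounded_linear (fderiv f x)"
      using smooth_on_has_derivative[OF assms(1)] has_derivative_bounded_linear by blast
    have "onorm (fderiv f x) \<le> K"
      using onorm_le_Basis_sum[OF bl] K(2)[OF x] by (simp add: sum_nonneg)
    then show "norm (fderiv f x v) \<le> K * norm v"
      using onorm[OF bl, of v] mult_right_mono[of "onorm (fderiv f x)" K "norm v"] by simp
  qed
qed

text \<open>Along an integral curve the second time derivative is \<open>DW\<close> applied to
  \<open>W\<close>. Two mean value estimates, one for \<open>W\<close> along the curve and one for
  the curve itself, avoid a general Taylor formula.\<close>

lemma jet2_flow:
  fixes W :: "'a::euclidean_space \<Rightarrow> 'a"
  assumes M: "compact M" and W: "smooth_on UNIV W" and flow: "flow_on M W \<Phi>"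
  shows "jet2 M \<Phi> W (\<lambda>x. (1/2) *\<^sub>R fderiv W x (W x))"
  unfolding jet2_def
proof (intro allI impI)
  fix e :: real assume e: "e > 0"
  define D where "D x = fderiv W x (W x)" for x
  have contD: "continuous_on M D"
    unfolding D_def
    using smooth_on_continuous_on[OF smooth_on_derivative_along[OF open_UNIV W W]]
    by (rule continuous_on_subset) simp
  obtain L where L: "L > 0" "L-lipschitz_on M W"
    using lipschitz_on_balls_compact[OF smooth_on_lipschitz_on_balls[OF W] M] by blast
  obtain B where B: "B > 0" "\<And>x. x \<in> M \<Longrightarrow> norm (W x) \<le> B"
    using compact_continuous_bound[OF M lipschitz_on_continuous_on[OF L(2)]] by blast
  obtain r where r: "r > 0" "\<And>x y. x \<in> M \<Longrightarrow> y \<in> M \<Longrightarrow> dist y x < r \<Longrightarrow> dist (D y) (D x) < e"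
    using compact_continuous_modulus[OF M contD e] by blast
  define d where "d = min 1 (r / B)"
  have d: "d > 0" using r(1) B(1) by (simp add: d_def)
  have "\<Phi> s x \<in> M \<and> norm (\<Phi> s x - x - s *\<^sub>R W x - s\<^sup>2 *\<^sub>R ((1/2) *\<^sub>R D x)) \<le> e * s\<^sup>2"
    if s: "0 < s" "s < d" and x: "x \<in> M" for s x
  proof
    have s1: "s \<le> 1" and Bs: "B * s < r"
      using s B(1) by (auto simp: d_def pos_less_divide_eq mult.commute)
    have m: "\<Phi> t x \<in> M" if "t \<in> {0..s}" for t
      using flow x that s1 by (simp add: flow_on_def)
    show "\<Phi> s x \<in> M" using m s by simp
    have \<Phi>0: "\<Phi> 0 x = x" using flow x by (simp add: flow_on_def)
    have der: "((\<lambda>t. \<Phi> t x) has_vector_derivative W (\<Phi> t x)) (at t within {0..s})" if "t \<in> {0..s}" for t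
      using flow_on_shift_derivative[OF flow L(2) B(2) x order_refl s1 that] .
    have derW: "((\<lambda>t. W (\<Phi> t x)) has_vector_derivative D (\<Phi> t x)) (at t within {0..s})"
      if "t \<in> {0..s}" for t
    proof -
      have "(W has_derivative fderiv W (\<Phi> t x)) (at (\<Phi> t x) within (\<lambda>t. \<Phi> t x) ` {0..s})"
        using smooth_on_has_derivative[OF W] has_derivative_at_withinI by blast
      from vector_derivative_diff_chain_within[OF der[OF that] this]
      show ?thesis by (simp add: D_def o_def)
    qed
    have near: "norm (D (\<Phi> t x) - D x) \<le> e" if t: "t \<in> {0..s}" for t
    proof -
      have "norm (\<Phi> t x - x) \<le> B * t"
        using flow_on_displacement[OF flow L(2) B(2) x order_refl, of t] t s1 \<Phi>0 by simp
      also have "\<dots> \<le> B * s" using t B(1) by (intro mult_left_mono) auto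
      also have "\<dots> < r" by (rule Bs)
      finally have "dist (D (\<Phi> t x)) (D x) < e"
        by (intro r(2) x m t) (simp add: dist_norm)
      then show ?thesis by (simp add: dist_norm)
    qed
    have first: "norm (W (\<Phi> t x) - W x - t *\<^sub>R D x) \<le> e * s" if t: "t \<in> {0..s}" for t
    proof -
      have "norm (W (\<Phi> t x) - W (\<Phi> 0 x) - (t - 0) *\<^sub>R D (\<Phi> 0 x)) \<le> norm (t - 0) * e"
        by (rule vector_differentiable_bound_linearization[where S = "{0..s}" and f = "\<lambda>t. W (\<Phi> t x)"])
           (use derW near t \<Phi>0 in \<open>auto simp: closed_segment_eq_real_ivl\<close>)
      also have "\<dots> \<le> e * s" using t e by (simp add: mult.commute)
      finally show ?thesis using \<Phi>0 by simp
    qed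
    \<comment> \<open>The derivative of \<open>g\<close> is exactly the remainder bounded in
      \<open>first\<close>.\<close>
    define g where "g t = \<Phi> t x - t *\<^sub>R W x - (t\<^sup>2 / 2) *\<^sub>R D x" for t
    have dg: "(g has_vector_derivative W (\<Phi> t x) - W x - t *\<^sub>R D x) (at t within {0..s})"
      if "t \<in> {0..s}" for t
    proof -
      have "((\<lambda>t. t *\<^sub>R W x) has_vector_derivative 1 *\<^sub>R W x) (at t within {0..s})"
        by (auto intro!: derivative_eq_intros)
      moreover have "((\<lambda>t. (t\<^sup>2 / 2) *\<^sub>R D x) has_vector_derivative t *\<^sub>R D x) (at t within {0..s})"
        by (auto intro!: derivative_eq_intros)
      ultimately show ?thesis
        unfolding g_def using has_vector_derivative_diff[OF has_vector_derivative_diff[OF der[OF that]]]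
        by simp
    qed
    have "norm (g s - g 0) \<le> (e * s) * (s - 0)"
      by (rule has_vector_derivative_norm_bound[OF _ dg first]) (use s in auto)
    then show "norm (\<Phi> s x - x - s *\<^sub>R W x - s\<^sup>2 *\<^sub>R ((1/2) *\<^sub>R D x)) \<le> e * s\<^sup>2"
      by (simp add: g_def \<Phi>0 power2_eq_square algebra_simps)
  qed
  then show "\<exists>d>0. \<forall>s x. 0 < s \<and> s < d \<and> x \<in> M \<longrightarrow> \<Phi> s x \<in> M \<and>
      norm (\<Phi> s x - x - s *\<^sub>R W x - s\<^sup>2 *\<^sub>R ((1/2) *\<^sub>R fderiv W x (W x))) \<le> e * s\<^sup>2"
    using d unfolding D_def by blast
qed

text \<open>Expand \<open>\<psi>\<close> at the moved point \<open>y\<close>, then return to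
  \<open>x\<close>. Since \<open>y - x\<close> is \<open>s * u x\<close> up to second order, the
  term \<open>s * u' y\<close> produces the cross term \<open>Du'(u)\<close>; this is why
  \<open>u'\<close> is the coefficient that has to be differentiated, while the others enter by
  continuity.\<close>

lemma jet2_comp:
  fixes M :: "'a::euclidean_space set"
  assumes M: "compact M" and \<phi>: "jet2 M \<phi> u v" and \<psi>: "jet2 M \<psi> u' v'"
    and u': "smooth_on UNIV u'" and contu: "continuous_on M u" and contv: "continuous_on M v"
    and contv': "continuous_on M v'"
  shows "jet2 M (\<lambda>s x. \<psi> s (\<phi> s x)) (\<lambda>x. u x + u' x)
    (\<lambda>x. v x + v' x + fderiv u' x (u x))"
  unfolding jet2_def
proof (intro allI impI)
  fix e :: real assume e: "e > 0"
  obtain Bu where Bu: "Bu > 0" "\<And>x. x \<in> M \<Longrightarrow> norm (u x) \<le> Bu"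
    using compact_continuous_bound[OF M contu] by blast
  obtain Bv where Bv: "Bv > 0" "\<And>x. x \<in> M \<Longrightarrow> norm (v x) \<le> Bv"
    using compact_continuous_bound[OF M contv] by blast
  obtain K where K: "K > 0" "\<And>x w. x \<in> M \<Longrightarrow> norm (fderiv u' x w) \<le> K * norm w"
    using smooth_derivative_bound_on_compact[OF u' M] by blast
  define e5 where "e5 = e / 5"
  have e5: "e5 > 0" using e by (simp add: e5_def)
  \<comment> \<open>For \<open>s < 1\<close> this bounds both \<open>norm (y - x) / s\<close> and
    the second-order quotient of \<open>y - x - s u x\<close>.\<close>
  define C where "C = Bu + Bv + e5"
  have C: "C > 0" using Bu(1) Bv(1) e5 by (simp add: C_def)
  define \<eta> where "\<eta> = e5 / C"
  have \<eta>: "\<eta> > 0" "\<eta> * C = e5" using e5 C by (auto simp: \<eta>_def)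
  obtain d1 where d1: "d1 > 0" "\<And>s x. 0 < s \<Longrightarrow> s < d1 \<Longrightarrow> x \<in> M \<Longrightarrow> \<phi> s x \<in> M"
    "\<And>s x. 0 < s \<Longrightarrow> s < d1 \<Longrightarrow> x \<in> M \<Longrightarrow> norm (\<phi> s x - x - s *\<^sub>R u x - s\<^sup>2 *\<^sub>R v x) \<le> e5 * s\<^sup>2"
    using jet2E[OF \<phi> e5] by blast
  obtain d2 where d2: "d2 > 0" "\<And>s x. 0 < s \<Longrightarrow> s < d2 \<Longrightarrow> x \<in> M \<Longrightarrow> \<psi> s x \<in> M"
    "\<And>s x. 0 < s \<Longrightarrow> s < d2 \<Longrightarrow> x \<in> M \<Longrightarrow> norm (\<psi> s x - x - s *\<^sub>R u' x - s\<^sup>2 *\<^sub>R v' x) \<le> e5 * s\<^sup>2"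
    using jet2E[OF \<psi> e5] by blast
  obtain d3 where d3: "d3 > 0" "\<And>x y. x \<in> M \<Longrightarrow> y \<in> M \<Longrightarrow> dist y x < d3 \<Longrightarrow> dist (v' y) (v' x) < e5"
    using compact_continuous_modulus[OF M contv' e5] by blast
  obtain d4 where d4: "d4 > 0" "\<And>p. p \<in> M \<Longrightarrow> ball p d4 \<subseteq> UNIV"
    "\<And>p x y. p \<in> M \<Longrightarrow> x \<in> ball p d4 \<Longrightarrow> y \<in> ball p d4 \<Longrightarrow>
      norm (u' x - u' y - fderiv u' p (x - y)) \<le> \<eta> * norm (x - y)"
    by (rule smooth_on_strict_derivative[OF open_UNIV u' M subset_UNIV \<eta>(1)]) (rule that)
  define d where "d = Min {1, d1, d2, d3 / C, d4 / C, e5 / (K * C)}"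
  have d: "d > 0" using d1(1) d2(1) d3(1) d4(1) e5 K(1) C by (simp add: d_def)
  have main: "\<psi> s (\<phi> s x) \<in> M \<and> norm (\<psi> s (\<phi> s x) - x - s *\<^sub>R (u x + u' x)
      - s\<^sup>2 *\<^sub>R (v x + v' x + fderiv u' x (u x))) \<le> e * s\<^sup>2"
    if s: "0 < s" "s < d" and x: "x \<in> M" for s x
  proof
    have sd: "s < 1" "s < d1" "s < d2" and sd': "s < d3 / C" "s < d4 / C" "s < e5 / (K * C)"
      using s(2) by (simp_all add: d_def)
    have sC: "C * s < d3" "C * s < d4" "K * C * s < e5"
      using sd' C K(1) by (simp_all add: pos_less_divide_eq mult.commute)
    define y where "y = \<phi> s x"
    have y: "y \<in> M" unfolding y_def by (rule d1(2)[OF s(1) sd(2) x])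
    show "\<psi> s (\<phi> s x) \<in> M" unfolding y_def[symmetric] by (rule d2(2)[OF s(1) sd(3) y])
    have ss: "s\<^sup>2 \<le> s" using s(1) sd(1) by (simp add: power2_eq_square mult_left_le)
    have r1: "norm (y - x - s *\<^sub>R u x - s\<^sup>2 *\<^sub>R v x) \<le> e5 * s\<^sup>2"
      unfolding y_def by (rule d1(3)[OF s(1) sd(2) x])
    have r2: "norm (\<psi> s y - y - s *\<^sub>R u' y - s\<^sup>2 *\<^sub>R v' y) \<le> e5 * s\<^sup>2"
      by (rule d2(3)[OF s(1) sd(3) y])
    have su: "norm (y - x - s *\<^sub>R u x) \<le> C * s\<^sup>2"
    proof -
      have "norm (y - x - s *\<^sub>R u x) \<le> norm (y - x - s *\<^sub>R u x - s\<^sup>2 *\<^sub>R v x) + norm (s\<^sup>2 *\<^sub>R v x)"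
        using norm_triangle_ineq[of "y - x - s *\<^sub>R u x - s\<^sup>2 *\<^sub>R v x" "s\<^sup>2 *\<^sub>R v x"] by simp
      also have "norm (s\<^sup>2 *\<^sub>R v x) \<le> s\<^sup>2 * Bv"
        using mult_left_mono[OF Bv(2)[OF x], of "s\<^sup>2"] by simp
      finally have "norm (y - x - s *\<^sub>R u x) \<le> (Bv + e5) * s\<^sup>2" using r1 by (simp add: algebra_simps)
      also have "\<dots> \<le> C * s\<^sup>2" using Bu(1) by (intro mult_right_mono) (auto simp: C_def)
      finally show ?thesis .
    qed
    have yx: "norm (y - x) \<le> C * s"
    proof -
      have "norm (y - x) \<le> norm (y - x - s *\<^sub>R u x - s\<^sup>2 *\<^sub>R v x) + norm (s *\<^sub>R u x) + norm (s\<^sup>2 *\<^sub>R v x)"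
        using norm_triangle_ineq[of "y - x - s *\<^sub>R u x - s\<^sup>2 *\<^sub>R v x" "s *\<^sub>R u x + s\<^sup>2 *\<^sub>R v x"]
          norm_triangle_ineq[of "s *\<^sub>R u x" "s\<^sup>2 *\<^sub>R v x"] by simp
      also have "norm (s *\<^sub>R u x) \<le> s * Bu"
        using mult_left_mono[OF Bu(2)[OF x], of s] s(1) by simp
      also have "norm (s\<^sup>2 *\<^sub>R v x) \<le> s * Bv"
      proof -
        have "norm (s\<^sup>2 *\<^sub>R v x) \<le> s\<^sup>2 * Bv" using mult_left_mono[OF Bv(2)[OF x], of "s\<^sup>2"] by simp
        also have "\<dots> \<le> s * Bv" using ss Bv(1) by (intro mult_right_mono) auto
        finally show ?thesis .
      qed
      also have "norm (y - x - s *\<^sub>R u x - s\<^sup>2 *\<^sub>R v x) \<le> s * e5"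
      proof -
        have "e5 * s\<^sup>2 \<le> s * e5" using mult_left_mono[OF ss less_imp_le[OF e5]] by (simp only: mult.commute)
        with r1 show ?thesis by linarith
      qed
      finally show ?thesis by (simp add: C_def algebra_simps)
    qed
    have v'y: "norm (s\<^sup>2 *\<^sub>R (v' y - v' x)) \<le> e5 * s\<^sup>2"
    proof -
      have "dist (v' y) (v' x) < e5"
        using yx sC(1) by (intro d3(2) x y) (simp add: dist_norm)
      then show ?thesis
        using mult_left_mono[of "norm (v' y - v' x)" e5 "s\<^sup>2"] by (simp add: dist_norm mult.commute)
    qed
    interpret D: bounded_linear "fderiv u' x"
      using smooth_on_has_derivative[OF u'] has_derivative_bounded_linear by blast
    have lin: "norm (s *\<^sub>R (u' y - u' x - fderiv u' x (y - x))) \<le> e5 * s\<^sup>2"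
    proof -
      have "norm (u' y - u' x - fderiv u' x (y - x)) \<le> \<eta> * norm (y - x)"
      proof (rule d4(3)[OF x])
        show "x \<in> ball x d4" using d4(1) by simp
        show "y \<in> ball x d4" using yx sC(2) by (simp add: dist_norm norm_minus_commute)
      qed
      also have "\<dots> \<le> \<eta> * (C * s)" using yx \<eta>(1) by (intro mult_left_mono) auto
      also have "\<dots> = e5 * s" using \<eta>(2) by (simp add: mult.assoc[symmetric])
      finally have "norm (u' y - u' x - fderiv u' x (y - x)) \<le> e5 * s" .
      from mult_left_mono[OF this, of s] s(1) show ?thesis
        by (simp add: power2_eq_square mult_ac)
    qed
    have lin2: "norm (s *\<^sub>R fderiv u' x (y - x - s *\<^sub>R u x)) \<le> e5 * s\<^sup>2"
    proof -
      have "norm (fderiv u' x (y - x - s *\<^sub>R u x)) \<le> K * (C * s\<^sup>2)"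
        using K(2)[OF x, of "y - x - s *\<^sub>R u x"] mult_left_mono[OF su, of K] K(1) by linarith
      then have "norm (s *\<^sub>R fderiv u' x (y - x - s *\<^sub>R u x)) \<le> s * (K * (C * s\<^sup>2))"
        using mult_left_mono[of "norm (fderiv u' x (y - x - s *\<^sub>R u x))" "K * (C * s\<^sup>2)" s] s(1)
        by simp
      also have "\<dots> = (K * C * s) * s\<^sup>2" by simp
      also have "\<dots> \<le> e5 * s\<^sup>2" using sC(3) by (intro mult_right_mono) auto
      finally show ?thesis .
    qed
    \<comment> \<open>Five errors, one fifth of \<open>e\<close> each: the two given remainders, the
      variation of \<open>v'\<close>, the linearization of \<open>u'\<close>, and the second-order
      part of \<open>y - x\<close> under its derivative.\<close>
    have "\<psi> s y - x - s *\<^sub>R (u x + u' x) - s\<^sup>2 *\<^sub>R (v x + v' x + fderiv u' x (u x))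
        = (\<psi> s y - y - s *\<^sub>R u' y - s\<^sup>2 *\<^sub>R v' y) + (y - x - s *\<^sub>R u x - s\<^sup>2 *\<^sub>R v x)
          + s\<^sup>2 *\<^sub>R (v' y - v' x) + s *\<^sub>R (u' y - u' x - fderiv u' x (y - x))
          + s *\<^sub>R fderiv u' x (y - x - s *\<^sub>R u x)"
      by (simp add: D.diff D.add D.scale power2_eq_square algebra_simps)
    also have "norm \<dots> \<le> e5 * s\<^sup>2 + e5 * s\<^sup>2 + e5 * s\<^sup>2 + e5 * s\<^sup>2 + e5 * s\<^sup>2"
      by (intro norm_triangle_mono r1 r2 v'y lin lin2)
    also have "\<dots> = e * s\<^sup>2" by (simp add: e5_def)
    finally show "norm (\<psi> s (\<phi> s x) - x - s *\<^sub>R (u x + u' x)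
        - s\<^sup>2 *\<^sub>R (v x + v' x + fderiv u' x (u x))) \<le> e * s\<^sup>2"
      by (simp add: y_def)
  qed
  show "\<exists>d>0. \<forall>s x. 0 < s \<and> s < d \<and> x \<in> M \<longrightarrow> \<psi> s (\<phi> s x) \<in> M \<and>
      norm (\<psi> s (\<phi> s x) - x - s *\<^sub>R (u x + u' x)
        - s\<^sup>2 *\<^sub>R (v x + v' x + fderiv u' x (u x))) \<le> e * s\<^sup>2"
  proof (rule exI[of _ d], rule conjI[OF d], intro allI impI)
    fix s x assume "0 < s \<and> s < d \<and> x \<in> M"
    then show "\<psi> s (\<phi> s x) \<in> M \<and> norm (\<psi> s (\<phi> s x) - x - s *\<^sub>R (u x + u' x)
        - s\<^sup>2 *\<^sub>R (v x + v' x + fderiv u' x (u x))) \<le> e * s\<^sup>2"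
      by (elim conjE) (rule main)
  qed
qed

lemma frechet_derivative_minus:
  assumes "smooth_on UNIV f"
  shows "fderiv (\<lambda>x. - f x) x v = - fderiv f x v"
proof -
  have "((\<lambda>x. - f x) has_derivative (\<lambda>v. - fderiv f x v)) (at x)"
    by (rule has_derivative_minus[OF smooth_on_has_derivative[OF assms UNIV_I]])
  from frechet_derivative_at[OF this, symmetric] show ?thesis by simp
qed

text \<open>The halves \<open>(1/2) Df f\<close> and \<open>(1/2) Dh h\<close> occur twice each and
  are cancelled by cross terms of the backward flows. What survives is \<open>Dh f - Df h\<close>;
  running \<open>f\<close> first gives this sign, which is that of
  \<open>lie_bracket f h\<close>.\<close>

lemma jet2_commutator:
  fixes f h :: "'a::euclidean_space \<Rightarrow> 'a"
  assumes M: "compact M" and f: "smooth_on UNIV f" and h: "smooth_on UNIV h"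
    and fl: "flow_on M f \<Phi>" "flow_on M h \<Psi>" "flow_on M (\<lambda>x. - f x) \<Phi>'" "flow_on M (\<lambda>x. - h x) \<Psi>'"
  shows "jet2 M (\<lambda>s x. \<Psi>' s (\<Phi>' s (\<Psi> s (\<Phi> s x)))) (\<lambda>x. 0)
    (\<lambda>x. fderiv h x (f x) - fderiv f x (h x))"
proof -
  note mf = smooth_on_minus[OF open_UNIV f] and mh = smooth_on_minus[OF open_UNIV h]
  define Df where "Df w x = fderiv f x (w x)" for w x
  define Dh where "Dh w x = fderiv h x (w x)" for w x
  have lin: "bounded_linear (fderiv f x)" "bounded_linear (fderiv h x)" for x
    using smooth_on_has_derivative f h has_derivative_bounded_linear by blast+
  have Dlin: "fderiv f x (- w) = - fderiv f x w"
    "fderiv f x (w + z) = fderiv f x w + fderiv f x z"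
    "fderiv h x (- w) = - fderiv h x w" for x w z
    using lin[of x] by (simp_all add: linear_simps)
  have half: "(1/2) *\<^sub>R a + (1/2) *\<^sub>R a = a" for a :: 'a
    by (simp add: scaleR_left_distrib[symmetric])
  have c: "continuous_on M (Df w)" "continuous_on M (Dh w)" if "smooth_on UNIV w" for w
    unfolding Df_def Dh_def
    using smooth_on_derivative_along[OF open_UNIV f that] smooth_on_derivative_along[OF open_UNIV h that]
    by (auto dest!: smooth_on_continuous_on intro: continuous_on_subset)
  have cfh: "continuous_on M f" "continuous_on M h"
    using smooth_on_continuous_on[OF f] smooth_on_continuous_on[OF h] by (auto intro: continuous_on_subset)
  have j1: "jet2 M \<Phi> f (\<lambda>x. (1/2) *\<^sub>R Df f x)"
    unfolding Df_def by (rule jet2_flow[OF M f fl(1)])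
  have j2: "jet2 M \<Psi> h (\<lambda>x. (1/2) *\<^sub>R Dh h x)"
    unfolding Dh_def by (rule jet2_flow[OF M h fl(2)])
  have j3: "jet2 M \<Phi>' (\<lambda>x. - f x) (\<lambda>x. (1/2) *\<^sub>R Df f x)"
    by (rule jet2_cong[OF jet2_flow[OF M mf fl(3)]])
       (auto simp: Df_def frechet_derivative_minus[OF f] Dlin)
  have j4: "jet2 M \<Psi>' (\<lambda>x. - h x) (\<lambda>x. (1/2) *\<^sub>R Dh h x)"
    by (rule jet2_cong[OF jet2_flow[OF M mh fl(4)]])
       (auto simp: Dh_def frechet_derivative_minus[OF h] Dlin)
  have j12: "jet2 M (\<lambda>s x. \<Psi> s (\<Phi> s x)) (\<lambda>x. f x + h x)
      (\<lambda>x. (1/2) *\<^sub>R Df f x + (1/2) *\<^sub>R Dh h x + Dh f x)"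
    unfolding Dh_def[of f]
    by (rule jet2_comp[OF M j1 j2 h]) (intro continuous_intros c cfh f h)+
  have "jet2 M (\<lambda>s x. \<Phi>' s (\<Psi> s (\<Phi> s x))) (\<lambda>x. (f x + h x) + - f x)
      (\<lambda>x. (1/2) *\<^sub>R Df f x + (1/2) *\<^sub>R Dh h x + Dh f x + (1/2) *\<^sub>R Df f x
        + fderiv (\<lambda>x. - f x) x (f x + h x))"
    by (rule jet2_comp[OF M j12 j3 mf]) (intro continuous_intros c cfh f h)+
  then have j123: "jet2 M (\<lambda>s x. \<Phi>' s (\<Psi> s (\<Phi> s x))) h
      (\<lambda>x. (1/2) *\<^sub>R Dh h x + Dh f x - Df h x)"
    by (rule jet2_cong)
       (simp_all add: frechet_derivative_minus[OF f] Dlin Df_def half algebra_simps)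
  have "jet2 M (\<lambda>s x. \<Psi>' s (\<Phi>' s (\<Psi> s (\<Phi> s x)))) (\<lambda>x. h x + - h x)
      (\<lambda>x. (1/2) *\<^sub>R Dh h x + Dh f x - Df h x + (1/2) *\<^sub>R Dh h x
        + fderiv (\<lambda>x. - h x) x (h x))"
    by (rule jet2_comp[OF M j123 j4 mh]) (intro continuous_intros c cfh f h)+
  then show ?thesis
    by (rule jet2_cong)
       (simp_all add: frechet_derivative_minus[OF h] Df_def Dh_def half algebra_simps)
qed

context map_semigroup begin

text \<open>Flows of the negated fields appear as separate data because the closure is known to be
  stable under composition, not under inversion. All four flows lie in it by the Euler scheme, hence
  so does the commutator at each fixed time.\<close>

lemma approximable_bracket:
  assumes f: "smooth_on UNIV f" and h: "smooth_on UNIV h"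
    and fl: "flow_on M f \<Phi>" "flow_on M h \<Psi>" "flow_on M (\<lambda>x. - f x) \<Phi>'" "flow_on M (\<lambda>x. - h x) \<Psi>'"
    and app: "approximable f" "approximable h" "approximable (\<lambda>x. - f x)" "approximable (\<lambda>x. - h x)"
  shows "approximable (\<lambda>x. fderiv h x (f x) - fderiv f x (h x))"
    (is "approximable ?W")
  unfolding approximable_def
proof (intro conjI allI impI)
  show "continuous_on M ?W"
    by (intro continuous_intros continuous_on_subset[OF smooth_on_continuous_on[OF smooth_on_derivative_along[OF open_UNIV]]] f h)
       auto
  fix e :: real assume e: "e > 0"
  have incl: "\<Theta> s \<in> cl" if w: "smooth_on UNIV w" "flow_on M w \<Theta>" "approximable w" "s \<in> {0..1}" for w \<Theta> s
  proof -
    obtain L where "L-lipschitz_on M w"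
      using lipschitz_on_balls_compact[OF smooth_on_lipschitz_on_balls[OF w(1)] compact] by blast
    then show ?thesis using flow_in_cl[OF w(3) _ w(2,4)] by blast
  qed
  define P where "P = (\<lambda>s x. \<Psi>' s (\<Phi>' s (\<Psi> s (\<Phi> s x))))"
  have Pcl: "P s \<in> cl" if "s \<in> {0..1}" for s
  proof -
    note mf = smooth_on_minus[OF open_UNIV f] and mh = smooth_on_minus[OF open_UNIV h]
    have "(\<lambda>x. \<Psi> s (\<Phi> s x)) \<in> cl"
      by (rule cl_comp[OF incl[OF h fl(2) app(2) that] incl[OF f fl(1) app(1) that]])
    from cl_comp[OF incl[OF mf fl(3) app(3) that] this]
    have "(\<lambda>x. \<Phi>' s (\<Psi> s (\<Phi> s x))) \<in> cl" .
    from cl_comp[OF incl[OF mh fl(4) app(4) that] this]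
    show ?thesis by (simp add: P_def)
  qed
  have jet: "jet2 M P (\<lambda>x. 0) ?W"
    unfolding P_def by (rule jet2_commutator[OF compact f h fl])
  obtain d where d: "d > 0" "\<And>s x. 0 < s \<Longrightarrow> s < d \<Longrightarrow> x \<in> M \<Longrightarrow> P s x \<in> M"
    "\<And>s x. 0 < s \<Longrightarrow> s < d \<Longrightarrow> x \<in> M \<Longrightarrow> norm (P s x - x - s *\<^sub>R 0 - s\<^sup>2 *\<^sub>R ?W x) \<le> e * s\<^sup>2"
    by (rule jet2E[OF jet e]) (rule that)
  \<comment> \<open>For \<open>s < r\<close> the time \<open>sqrt s\<close> is below
    \<open>d\<close> and below 1, where the flows are defined.\<close>
  define r where "r = (min 1 d)\<^sup>2"
  have r: "r > 0" using d(1) by (simp add: r_def)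
  have "\<exists>P\<in>cl. \<forall>x\<in>M. norm (P x - x - s *\<^sub>R ?W x) \<le> e * s" if s: "0 < s" "s < r" for s
  proof -
    have "sqrt s < min 1 d"
      using s d(1) real_sqrt_less_mono[of s r] by (simp add: r_def real_sqrt_abs)
    then have q: "0 < sqrt s" "sqrt s < d" "sqrt s \<in> {0..1}" using s by auto
    have "norm (P (sqrt s) x - x - s *\<^sub>R ?W x) \<le> e * s" if "x \<in> M" for x
      using d(3)[OF q(1,2) that] s by simp
    then show ?thesis by (intro bexI[OF _ Pcl[OF q(3)]]) simp
  qed
  then show "\<exists>d>0. \<forall>s. 0 < s \<and> s < d \<longrightarrow> (\<exists>P\<in>cl. \<forall>x\<in>M. norm (P x - x - s *\<^sub>R ?W x) \<le> e * s)"
    using r by (intro exI[of _ r]) simp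
qed

end

section \<open>The velocity field of an isotopy\<close>

lemma continuous_on_locally_eq:
  fixes f :: "'a::metric_space \<Rightarrow> 'b::metric_space"
  assumes "\<And>p. p \<in> S \<Longrightarrow> \<exists>U g. open U \<and> p \<in> U \<and> continuous_on U g \<and> (\<forall>q\<in>S \<inter> U. g q = f q)"
  shows "continuous_on S f"
  unfolding continuous_on_iff
proof (intro ballI allI impI)
  fix p e assume p: "p \<in> S" and e: "(e::real) > 0"
  obtain U g where U: "open U" "p \<in> U" "continuous_on U g" "\<forall>q\<in>S \<inter> U. g q = f q"
    using assms[OF p] by blast
  obtain d1 where d1: "d1 > 0" "ball p d1 \<subseteq> U"
    using U(1,2) open_contains_ball by blast
  have "\<exists>d>0. \<forall>q\<in>U. dist q p < d \<longrightarrow> dist (g q) (g p) < e"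
    using U(3)[unfolded continuous_on_iff] U(2) e by blast
  then obtain d2 where d2: "d2 > 0" "\<And>q. q \<in> U \<Longrightarrow> dist q p < d2 \<Longrightarrow> dist (g q) (g p) < e"
    by blast
  have "dist (f q) (f p) < e" if "q \<in> S" "dist q p < min d1 d2" for q
  proof -
    have "q \<in> U" using d1(2) that(2) by (auto simp: dist_commute)
    then have "dist (g q) (g p) < e" using d2(2) that(2) by simp
    then show ?thesis using U(2,4) p that(1) \<open>q \<in> U\<close> by simp
  qed
  then show "\<exists>d>0. \<forall>q\<in>S. dist q p < d \<longrightarrow> dist (f q) (f p) < e"
    using d1(1) d2(1) by (intro exI[of _ "min d1 d2"]) simp
qed

lemma local_lipschitzI_ball:
  fixes f :: "real \<Rightarrow> 'a::real_normed_vector \<Rightarrow> 'b::metric_space"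
  assumes "\<And>t x. t \<in> T \<Longrightarrow> x \<in> X \<Longrightarrow> \<exists>u>0. \<exists>L\<ge>0. \<forall>s y z. s \<in> T \<and> y \<in> X \<and> z \<in> X \<and>
     \<bar>s - t\<bar> \<le> u \<and> norm (y - x) \<le> u \<and> norm (z - x) \<le> u \<longrightarrow> dist (f s y) (f s z) \<le> L * dist y z"
  shows "local_lipschitz T X f"
  unfolding local_lipschitz_def
proof (intro ballI)
  fix x t assume "x \<in> X" "t \<in> T"
  from assms[OF this(2,1)] obtain u L where u: "u > 0" "L \<ge> 0"
    and *: "\<And>s y z. s \<in> T \<and> y \<in> X \<and> z \<in> X \<and> \<bar>s - t\<bar> \<le> u \<and> norm (y - x) \<le> u \<and> norm (z - x) \<le> u
      \<Longrightarrow> dist (f s y) (f s z) \<le> L * dist y z"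
    by blast
  have "L-lipschitz_on (cball x u \<inter> X) (f s)" if "s \<in> cball t u \<inter> T" for s
  proof (rule lipschitz_onI)
    fix y z assume "y \<in> cball x u \<inter> X" "z \<in> cball x u \<inter> X"
    then show "dist (f s y) (f s z) \<le> L * dist y z"
      using that by (intro *) (auto simp: dist_norm norm_minus_commute abs_minus_commute)
  qed (rule u(2))
  then show "\<exists>u>0. \<exists>L. \<forall>t\<in>cball t u \<inter> T. L-lipschitz_on (cball x u \<inter> X) (f t)"
    using u(1) by blast
qed

lemma norm_Pair_bound: "norm (a, b) \<le> norm a + norm b"
  by (simp add: norm_Pair sqrt_sum_squares_le_sum)

locale isotopy =
  fixes M :: "'a::euclidean_space set" and H :: "real \<times> 'a \<Rightarrow> 'a"
  assumes compact: "compact M"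
    and smooth: "smooth_map_on ({0..1} \<times> M) H"
    and diffeo: "\<And>t. t \<in> {0..1} \<Longrightarrow> diffeo_on M (\<lambda>x. H (t, x))"
begin

text \<open>Taken within \<open>{0..1}\<close>, so at the two end times it is one-sided.\<close>

definition velocity :: "real \<Rightarrow> 'a \<Rightarrow> 'a" where
  "velocity t x = vector_derivative (\<lambda>s. H (s, x)) (at t within {0..1})"

definition H_inv :: "real \<Rightarrow> 'a \<Rightarrow> 'a" where
  "H_inv t = inv_into M (\<lambda>x. H (t, x))"

text \<open>The Eulerian velocity: transporting \<open>velocity\<close> back by the inverse at time
  \<open>t\<close> makes every curve \<open>s \<mapsto> H (s, x)\<close> an integral curve.\<close>

definition field :: "real \<Rightarrow> 'a \<Rightarrow> 'a" where
  "field t y = velocity t (H_inv t y)"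

lemma local_extension:
  assumes "t \<in> {0..1}" "x \<in> M"
  obtains U F where "open U" "(t, x) \<in> U" "smooth_on U F"
    "\<And>s y. s \<in> {0..1} \<Longrightarrow> y \<in> M \<Longrightarrow> (s, y) \<in> U \<Longrightarrow> F (s, y) = H (s, y)"
proof -
  have "(t, x) \<in> {0..1} \<times> M" using assms by simp
  from smooth[unfolded smooth_map_on_def, rule_format, OF this] show thesis
    using that by blast
qed

lemma H_bij: "t \<in> {0..1} \<Longrightarrow> bij_betw (\<lambda>x. H (t, x)) M M"
  using diffeo by (simp add: diffeo_on_def)

lemma H_in: "t \<in> {0..1} \<Longrightarrow> x \<in> M \<Longrightarrow> H (t, x) \<in> M"
  by (rule bij_betwE[OF H_bij, rule_format])

lemma H_inv_in: "t \<in> {0..1} \<Longrightarrow> y \<in> M \<Longrightarrow> H_inv t y \<in> M"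
  unfolding H_inv_def by (rule bij_betwE[OF bij_betw_inv_into[OF H_bij], rule_format])

lemma H_inv_H: "t \<in> {0..1} \<Longrightarrow> x \<in> M \<Longrightarrow> H_inv t (H (t, x)) = x"
  unfolding H_inv_def by (rule bij_betw_inv_into_left[OF H_bij])

lemma H_H_inv: "t \<in> {0..1} \<Longrightarrow> y \<in> M \<Longrightarrow> H (t, H_inv t y) = y"
  unfolding H_inv_def by (rule bij_betw_inv_into_right[OF H_bij])

lemma extension_derivative:
  fixes F :: "real \<times> 'a \<Rightarrow> 'a"
  assumes "smooth_on U F" "(t, x) \<in> U"
  shows "((\<lambda>s. F (s, x)) has_vector_derivative fderiv F (t, x) (1, 0)) (at t)"
proof -
  have "((\<lambda>s. (s, x)) has_derivative (\<lambda>h. (h, 0))) (at t)"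
    by (rule has_derivative_Pair[OF has_derivative_ident has_derivative_const])
  from has_derivative_compose[OF this smooth_on_has_derivative[OF assms]]
  have d: "((\<lambda>s. F (s, x)) has_derivative (\<lambda>h. fderiv F (t, x) (h, 0))) (at t)" .
  interpret bounded_linear "fderiv F (t, x)"
    by (rule has_derivative_bounded_linear[OF smooth_on_has_derivative[OF assms]])
  have "(\<lambda>h. fderiv F (t, x) (h, 0)) = (\<lambda>h. h *\<^sub>R fderiv F (t, x) (1, 0))"
    by (rule ext, subst scale[symmetric]) simp
  with d show ?thesis by (simp only: has_vector_derivative_def)
qed

text \<open>A local extension \<open>F\<close> agrees with \<open>H\<close> on
  \<open>{0..1} \<times> M\<close> only, but the direction \<open>(1, 0)\<close> stays in this set,
  so that derivative of \<open>F\<close> is determined by \<open>H\<close>. Locally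
  \<open>velocity\<close> thus becomes the restriction of a smooth function of time and
  space.\<close>

lemma velocity_extension:
  assumes U: "open U" "(t, x) \<in> U" "smooth_on U F"
    "\<And>s y. s \<in> {0..1} \<Longrightarrow> y \<in> M \<Longrightarrow> (s, y) \<in> U \<Longrightarrow> F (s, y) = H (s, y)"
    and t: "t \<in> {0..1}" and x: "x \<in> M"
  shows "((\<lambda>s. H (s, x)) has_vector_derivative fderiv F (t, x) (1, 0)) (at t within {0..1})"
    "velocity t x = fderiv F (t, x) (1, 0)"
proof -
  obtain d where d: "d > 0" "ball (t, x) d \<subseteq> U"
    using U(1,2) open_contains_ball by blast
  have "((\<lambda>s. F (s, x)) has_vector_derivative fderiv F (t, x) (1, 0)) (at t within {0..1})"
    using extension_derivative[OF U(3,2)] by (rule has_vector_derivative_at_within)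
  then show 1: "((\<lambda>s. H (s, x)) has_vector_derivative fderiv F (t, x) (1, 0)) (at t within {0..1})"
  proof (rule has_vector_derivative_transform_within[OF _ d(1) t])
    fix s assume s: "s \<in> {0..1::real}" "dist s t < d"
    have "(s, x) \<in> ball (t, x) d" using s(2) by (simp add: dist_Pair_Pair dist_commute)
    then show "F (s, x) = H (s, x)" using U(4)[OF s(1) x] d(2) by blast
  qed
  show "velocity t x = fderiv F (t, x) (1, 0)"
    unfolding velocity_def by (rule vector_derivative_within_closed_interval[OF _ t 1]) simp
qed

lemma velocity_derivative:
  assumes "t \<in> {0..1}" "x \<in> M"
  shows "((\<lambda>s. H (s, x)) has_vector_derivative velocity t x) (at t within {0..1})"
proof -
  obtain U F where U: "open U" "(t, x) \<in> U" "smooth_on U F"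
    "\<And>s y. s \<in> {0..1} \<Longrightarrow> y \<in> M \<Longrightarrow> (s, y) \<in> U \<Longrightarrow> F (s, y) = H (s, y)"
    by (rule local_extension[OF assms]) (rule that)
  show ?thesis using velocity_extension[OF U assms] by simp
qed

lemma continuous_H: "continuous_on ({0..1} \<times> M) H"
proof (rule continuous_on_locally_eq)
  fix p :: "real \<times> 'a" assume "p \<in> {0..1} \<times> M"
  then obtain U F where "open U" "p \<in> U" "smooth_on U F" "\<forall>q\<in>({0..1} \<times> M) \<inter> U. F q = H q"
    using smooth[unfolded smooth_map_on_def] by blast
  then show "\<exists>U g. open U \<and> p \<in> U \<and> continuous_on U g \<and> (\<forall>q\<in>({0..1} \<times> M) \<inter> U. g q = H q)"
    using smooth_on_continuous_on[of U F] by (intro exI[of _ U] exI[of _ F]) simp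
qed

lemma continuous_velocity: "continuous_on ({0..1} \<times> M) (\<lambda>p. velocity (fst p) (snd p))"
proof (rule continuous_on_locally_eq)
  fix p :: "real \<times> 'a" assume p: "p \<in> {0..1} \<times> M"
  obtain t x where tx: "p = (t, x)" "t \<in> {0..1}" "x \<in> M" using p by blast
  obtain U F where U: "open U" "(t, x) \<in> U" "smooth_on U F"
    "\<And>s y. s \<in> {0..1} \<Longrightarrow> y \<in> M \<Longrightarrow> (s, y) \<in> U \<Longrightarrow> F (s, y) = H (s, y)"
    by (rule local_extension[OF tx(2,3)]) (rule that)
  show "\<exists>U g. open U \<and> p \<in> U \<and> continuous_on U g \<and>
      (\<forall>q\<in>({0..1} \<times> M) \<inter> U. g q = velocity (fst q) (snd q))"
  proof (intro exI[of _ U] exI[of _ "\<lambda>q. fderiv F q (1, 0)"] conjI ballI)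
    show "continuous_on U (\<lambda>q. fderiv F q (1, 0))"
      by (rule smooth_on_continuous_on[OF smooth_on_directional[OF U(3)]])
    fix q assume "q \<in> ({0..1} \<times> M) \<inter> U"
    then obtain s y where q: "q = (s, y)" "s \<in> {0..1}" "y \<in> M" "(s, y) \<in> U" by blast
    show "fderiv F q (1, 0) = velocity (fst q) (snd q)"
      using velocity_extension(2)[OF U(1) q(4) U(3,4) q(2,3)] by (simp add: q(1))
  qed (use U(1,2) tx(1) in auto)
qed

text \<open>The hypotheses control the inverse at each time separately. Joint continuity comes from
  compactness: \<open>(t, x) \<mapsto> (t, H (t, x))\<close> is a continuous bijection of the
  compact set \<open>{0..1} \<times> M\<close>.\<close>

lemma continuous_H_inv: "continuous_on ({0..1} \<times> M) (\<lambda>p. H_inv (fst p) (snd p))"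
proof -
  define \<Theta> where "\<Theta> p = (fst p, H p)" for p
  have c: "continuous_on ({0..1} \<times> M) \<Theta>"
    unfolding \<Theta>_def by (intro continuous_intros continuous_H)
  have k: "compact ({0..1::real} \<times> M)" by (intro compact_Times compact_Icc compact)
  have "continuous_on (\<Theta> ` ({0..1} \<times> M)) (\<lambda>p. (fst p, H_inv (fst p) (snd p)))"
    by (rule continuous_on_inv[OF c k]) (auto simp: \<Theta>_def H_inv_H)
  moreover have "\<Theta> ` ({0..1} \<times> M) = {0..1} \<times> M"
  proof (intro equalityI subsetI)
    fix p :: "real \<times> 'a" assume "p \<in> {0..1} \<times> M"
    then have "p = \<Theta> (fst p, H_inv (fst p) (snd p))" "(fst p, H_inv (fst p) (snd p)) \<in> {0..1} \<times> M"
      by (auto simp: \<Theta>_def H_H_inv H_inv_in)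
    then show "p \<in> \<Theta> ` ({0..1} \<times> M)" by (rule image_eqI)
  qed (auto simp: \<Theta>_def H_in)
  ultimately have "continuous_on ({0..1} \<times> M) (\<lambda>p. (fst p, H_inv (fst p) (snd p)))" by simp
  from continuous_on_snd[OF this] show ?thesis by simp
qed

lemma continuous_field: "continuous_on ({0..1} \<times> M) (\<lambda>p. field (fst p) (snd p))"
proof -
  have "continuous_on ({0..1} \<times> M) (\<lambda>p. velocity (fst (fst p, H_inv (fst p) (snd p))) (snd (fst p, H_inv (fst p) (snd p))))"
    by (rule continuous_on_compose2[OF continuous_velocity])
       (auto intro!: continuous_intros continuous_H_inv simp: H_inv_in)
  then show ?thesis by (simp add: field_def)
qed

lemma continuous_on_slices:
  assumes "continuous_on ({0..1} \<times> M) (\<lambda>p. f (fst p) (snd p))"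
  shows "x \<in> M \<Longrightarrow> continuous_on {0..1::real} (\<lambda>t. f t x)" "t \<in> {0..1} \<Longrightarrow> continuous_on M (f t)"
proof -
  assume x: "x \<in> M"
  have "continuous_on {0..1::real} (\<lambda>t. (t, x))" by (intro continuous_intros)
  moreover have "(\<lambda>t. (t, x)) ` {0..1} \<subseteq> {0..1} \<times> M" using x by auto
  ultimately show "continuous_on {0..1} (\<lambda>t. f t x)"
    using continuous_on_compose2[OF assms] by fastforce
next
  assume t: "t \<in> {0..1}"
  have "continuous_on M (\<lambda>x. (t, x))" by (intro continuous_intros)
  moreover have "(\<lambda>x. (t, x)) ` M \<subseteq> {0..1} \<times> M" using t by auto
  ultimately show "continuous_on M (f t)"
    using continuous_on_compose2[OF assms] by fastforce
qed

section \<open>Lipschitz bounds uniform in time\<close>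

lemma local_lipschitz_velocity: "local_lipschitz {0..1} M velocity"
proof (rule local_lipschitzI_ball)
  fix t x assume t: "t \<in> {0..1::real}" and x: "x \<in> M"
  obtain U F where U: "open U" "(t, x) \<in> U" "smooth_on U F"
    "\<And>s y. s \<in> {0..1} \<Longrightarrow> y \<in> M \<Longrightarrow> (s, y) \<in> U \<Longrightarrow> F (s, y) = H (s, y)"
    by (rule local_extension[OF t x]) (rule that)
  obtain d L where d: "d > 0" "ball (t, x) d \<subseteq> U" "L > 0"
    "L-lipschitz_on (ball (t, x) d) (\<lambda>q. fderiv F q (1, 0))"
    by (rule smooth_on_locally_lipschitz[OF U(1) smooth_on_directional[OF U(3)] U(2)]) (rule that)
  have in_ball: "(s, y) \<in> ball (t, x) d" if "\<bar>s - t\<bar> \<le> d / 3" "norm (y - x) \<le> d / 3" for s y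
  proof -
    have "dist (s, y) (t, x) < d"
      using norm_Pair_bound[of "s - t" "y - x"] that d(1) by (simp add: dist_norm)
    then show ?thesis by (simp add: dist_commute)
  qed
  have "dist (velocity s y) (velocity s z) \<le> L * dist y z"
    if "s \<in> {0..1}" "y \<in> M" "z \<in> M" "\<bar>s - t\<bar> \<le> d / 3" "norm (y - x) \<le> d / 3" "norm (z - x) \<le> d / 3"
    for s y z
  proof -
    have yz: "(s, y) \<in> ball (t, x) d" "(s, z) \<in> ball (t, x) d"
      using in_ball that by blast+
    have "velocity s y = fderiv F (s, y) (1, 0)"
      "velocity s z = fderiv F (s, z) (1, 0)"
      using velocity_extension(2)[OF U(1) subsetD[OF d(2) yz(1)] U(3,4) that(1,2)]
        velocity_extension(2)[OF U(1) subsetD[OF d(2) yz(2)] U(3,4) that(1,3)] by simp_all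
    then show ?thesis
      using lipschitz_onD[OF d(4) yz] by (simp add: dist_Pair_Pair)
  qed
  then show "\<exists>u>0. \<exists>L\<ge>0. \<forall>s y z. s \<in> {0..1} \<and> y \<in> M \<and> z \<in> M \<and>
     \<bar>s - t\<bar> \<le> u \<and> norm (y - x) \<le> u \<and> norm (z - x) \<le> u \<longrightarrow>
       dist (velocity s y) (velocity s z) \<le> L * dist y z"
    using d(1,3) by (intro exI[of _ "d / 3"] exI[of _ L] conjI) auto
qed

text \<open>
  The inverse \<open>H_inv\<close> is smooth for each fixed time only, so uniformity in time comes from perturbation:
  at the base time \<open>t\<close> the map \<open>H(t, -)\<close> expands distances by at least \<open>1/K\<close> (its inverse is locally
  Lipschitz), and nearby times change the increments of \<open>H\<close> by at most half of that.
\<close>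

lemma local_lipschitz_H_inv: "local_lipschitz {0..1} M H_inv"
proof (rule local_lipschitzI_ball)
  fix t y assume t: "t \<in> {0..1::real}" and y: "y \<in> M"
  define x where "x = H_inv t y"
  have x: "x \<in> M" "H (t, x) = y" using H_inv_in[OF t y] H_H_inv[OF t y] by (simp_all add: x_def)
  obtain U F where U: "open U" "(t, x) \<in> U" "smooth_on U F"
    "\<And>s y. s \<in> {0..1} \<Longrightarrow> y \<in> M \<Longrightarrow> (s, y) \<in> U \<Longrightarrow> F (s, y) = H (s, y)"
    by (rule local_extension[OF t x(1)]) (rule that)
  have "smooth_map_on M (H_inv t)" using diffeo[OF t] by (simp add: diffeo_on_def H_inv_def)
  from this[unfolded smooth_map_on_def, rule_format, OF y]
  obtain UG G where G': "open UG" "y \<in> UG" "smooth_on UG G" "\<forall>z\<in>M \<inter> UG. G z = H_inv t z"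
    by blast
  then have G: "open UG" "y \<in> UG" "smooth_on UG G" "\<And>z. z \<in> M \<inter> UG \<Longrightarrow> G z = H_inv t z"
    by simp_all
  obtain r K where K: "r > 0" "ball y r \<subseteq> UG" "K > 0" "K-lipschitz_on (ball y r) G"
    by (rule smooth_on_locally_lipschitz[OF G(1,3,2)]) (rule that)
  \<comment> \<open>With this \<open>e\<close> the perturbation term \<open>2 * e * K\<close> equals
    1/2 and can be absorbed on the left.\<close>
  define e where "e = 1 / (4 * K)"
  have e: "e > 0" using K(3) by (simp add: e_def)
  have cp: "compact {(t, x)}" and sub: "{(t, x)} \<subseteq> U" using U(2) by simp_all
  obtain d where d: "d > 0" "\<And>p. p \<in> {(t, x)} \<Longrightarrow> ball p d \<subseteq> U"
    "\<And>p a b. p \<in> {(t, x)} \<Longrightarrow> a \<in> ball p d \<Longrightarrow> b \<in> ball p d \<Longrightarrow>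
      norm (F a - F b - fderiv F p (a - b)) \<le> e * norm (a - b)"
    by (rule smooth_on_strict_derivative[OF U(1,3) cp sub e]) (rule that)
  \<comment> \<open>Points near \<open>x\<close> must have images under the time-\<open>t\<close>
    map in \<open>ball y r\<close>, where the Lipschitz extension \<open>G\<close> of the inverse is
    available.\<close>
  have "continuous_on M (\<lambda>x. H (t, x))"
    using continuous_on_slices(2)[of "\<lambda>t x. H (t, x)", OF _ t] continuous_H by simp
  then have "\<exists>d'>0. \<forall>z\<in>M. dist z x < d' \<longrightarrow> dist (H (t, z)) (H (t, x)) < r"
    unfolding continuous_on_iff using x(1) K(1) by blast
  then obtain d' where d': "d' > 0" "\<And>z. z \<in> M \<Longrightarrow> dist z x < d' \<Longrightarrow> dist (H (t, z)) y < r"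
    unfolding x(2) by blast
  define \<rho> where "\<rho> = min (d / 3) d'"
  have \<rho>: "\<rho> > 0" using d(1) d'(1) by (simp add: \<rho>_def)
  have "\<exists>\<delta>>0. \<forall>q\<in>{0..1} \<times> M. dist q (t, y) < \<delta> \<longrightarrow> dist (H_inv (fst q) (snd q)) (H_inv (fst (t, y)) (snd (t, y))) < \<rho>"
    using continuous_H_inv[unfolded continuous_on_iff, rule_format, of "(t, y)" \<rho>] t y \<rho> by blast
  then obtain \<delta> where \<delta>: "\<delta> > 0"
    "\<And>q. q \<in> {0..1} \<times> M \<Longrightarrow> dist q (t, y) < \<delta> \<Longrightarrow> dist (H_inv (fst q) (snd q)) x < \<rho>"
    unfolding x_def by auto
  define u where "u = min (d / 3) (\<delta> / 3)"
  have u: "u > 0" "u \<le> d / 3" "u \<le> \<delta> / 3" using d(1) \<delta>(1) by (auto simp: u_def)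
  have "dist (H_inv s y1) (H_inv s y2) \<le> 2 * K * dist y1 y2"
    if s: "s \<in> {0..1}" "\<bar>s - t\<bar> \<le> u" and y12: "y1 \<in> M" "y2 \<in> M" "norm (y1 - y) \<le> u" "norm (y2 - y) \<le> u"
    for s y1 y2
  proof -
    define x1 where "x1 = H_inv s y1"
    define x2 where "x2 = H_inv s y2"
    have near: "dist (H_inv s z) x < \<rho>" if "z \<in> M" "norm (z - y) \<le> u" for z
    proof -
      have "dist (s, z) (t, y) < \<delta>"
        using norm_Pair_bound[of "s - t" "z - y"] that(2) s(2) u by (simp add: dist_norm)
      then show ?thesis using \<delta>(2)[of "(s, z)"] s(1) that(1) by simp
    qed
    have x12: "x1 \<in> M" "x2 \<in> M" "H (s, x1) = y1" "H (s, x2) = y2" "dist x1 x < \<rho>" "dist x2 x < \<rho>"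
      using y12 s(1) near by (simp_all add: x1_def x2_def H_inv_in H_H_inv)
    have pts: "(s, x1) \<in> ball (t, x) d" "(s, x2) \<in> ball (t, x) d" "(t, x1) \<in> ball (t, x) d" "(t, x2) \<in> ball (t, x) d"
    proof -
      have *: "(s', z) \<in> ball (t, x) d" if "\<bar>s' - t\<bar> \<le> u" "dist z x < \<rho>" for s' z
      proof -
        have "dist (s', z) (t, x) < d"
          using norm_Pair_bound[of "s' - t" "z - x"] that u(2) d(1) by (simp add: \<rho>_def dist_norm)
        then show ?thesis by (simp add: dist_commute)
      qed
      show "(s, x1) \<in> ball (t, x) d" "(s, x2) \<in> ball (t, x) d" "(t, x1) \<in> ball (t, x) d" "(t, x2) \<in> ball (t, x) d"
        using * s(2) x12(5,6) u(1) by simp_all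
    qed
    have FH: "F (s, x1) = y1" "F (s, x2) = y2" "F (t, x1) = H (t, x1)" "F (t, x2) = H (t, x2)"
      using U(4)[OF s(1)] U(4)[OF t] x12 pts d(2)[OF singletonI] by blast+
    \<comment> \<open>The same linear map, the derivative at \<open>(t, x)\<close>, approximates the
      increments at both times \<open>s\<close> and \<open>t\<close>, so it drops out of their
      difference.\<close>
    define A where "A = fderiv F (t, x) (0, x1 - x2)"
    have n1: "norm (y1 - y2 - A) \<le> e * norm (x1 - x2)"
      using d(3)[OF singletonI pts(1,2)] by (simp add: FH A_def norm_Pair)
    have n2: "norm (H (t, x1) - H (t, x2) - A) \<le> e * norm (x1 - x2)"
      using d(3)[OF singletonI pts(3,4)] by (simp add: FH A_def norm_Pair)
    have grow: "norm (H (t, x1) - H (t, x2)) \<le> norm (y1 - y2) + 2 * e * norm (x1 - x2)"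
      using norm_triangle_ineq4[of "H (t, x1) - H (t, x2) - A" "y1 - y2 - A"]
        norm_triangle_ineq[of "H (t, x1) - H (t, x2) - (y1 - y2)" "y1 - y2"] n1 n2 by simp
    have "norm (x1 - x2) \<le> K * norm (H (t, x1) - H (t, x2))"
    proof -
      have m: "H (t, x1) \<in> ball y r" "H (t, x2) \<in> ball y r"
        using d'(2) x12 by (simp_all add: \<rho>_def dist_commute)
      have "G (H (t, x1)) = x1" "G (H (t, x2)) = x2"
        using G(4)[of "H (t, x1)"] G(4)[of "H (t, x2)"] subsetD[OF K(2) m(1)] subsetD[OF K(2) m(2)]
          H_in[OF t x12(1)] H_in[OF t x12(2)] H_inv_H[OF t x12(1)] H_inv_H[OF t x12(2)] by simp_all
      then show ?thesis using lipschitz_on_normD[OF K(4) m] by simp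
    qed
    also have "\<dots> \<le> K * (norm (y1 - y2) + 2 * e * norm (x1 - x2))"
      using K(3) grow by (intro mult_left_mono) auto
    also have "\<dots> = K * norm (y1 - y2) + norm (x1 - x2) / 2"
      using K(3) by (simp add: e_def algebra_simps)
    finally show ?thesis by (simp add: dist_norm x1_def x2_def)
  qed
  then show "\<exists>u>0. \<exists>L\<ge>0. \<forall>s y1 y2. s \<in> {0..1} \<and> y1 \<in> M \<and> y2 \<in> M \<and>
     \<bar>s - t\<bar> \<le> u \<and> norm (y1 - y) \<le> u \<and> norm (y2 - y) \<le> u \<longrightarrow> dist (H_inv s y1) (H_inv s y2) \<le> L * dist y1 y2"
    using u(1) K(3) by (intro exI[of _ u] exI[of _ "2 * K"] conjI) auto
qed

text \<open>The constant must be common to all times, as the Euler scheme uses it at every node;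
  compactness of \<open>{0..1}\<close> and \<open>M\<close> turns the local bounds into such a
  constant.\<close>

lemma lipschitz_field:
  obtains L where "\<And>t. t \<in> {0..1} \<Longrightarrow> L-lipschitz_on M (field t)"
proof -
  obtain L1 where L1: "\<And>t. t \<in> {0..1} \<Longrightarrow> L1-lipschitz_on M (velocity t)"
    using local_lipschitz_compact_implies_lipschitz[OF local_lipschitz_velocity compact compact_Icc
        continuous_on_slices(1)[OF continuous_velocity]] by blast
  obtain L2 where L2: "\<And>t. t \<in> {0..1} \<Longrightarrow> L2-lipschitz_on M (H_inv t)"
    using local_lipschitz_compact_implies_lipschitz[OF local_lipschitz_H_inv compact compact_Icc
        continuous_on_slices(1)[OF continuous_H_inv]] by blast
  have "(L1 * L2)-lipschitz_on M (field t)" if t: "t \<in> {0..1}" for t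
  proof -
    have "L1-lipschitz_on (H_inv t ` M) (velocity t)"
      using L1[OF t] by (rule lipschitz_on_subset) (use H_inv_in[OF t] in auto)
    from lipschitz_on_compose[OF L2[OF t] this] show ?thesis
      by (simp add: field_def[abs_def] o_def)
  qed
  then show thesis by (rule that)
qed

text \<open>The tangent vectors are velocities of curves defined on both sides of 0, hence the
  restriction to interior times. The curve through \<open>y\<close> is the path of
  \<open>x = H_inv t y\<close>, written with the extension \<open>F\<close> to be smooth.\<close>

lemma field_tangent:
  assumes t: "0 < t" "t < 1" and y: "y \<in> M"
  shows "field t y \<in> tangent_space M y"
proof -
  have t01: "t \<in> {0..1}" using t by simp
  define x where "x = H_inv t y"
  have x: "x \<in> M" "H (t, x) = y" using H_inv_in[OF t01 y] H_H_inv[OF t01 y] by (simp_all add: x_def)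
  obtain U F where U: "open U" "(t, x) \<in> U" "smooth_on U F"
    "\<And>s y. s \<in> {0..1} \<Longrightarrow> y \<in> M \<Longrightarrow> (s, y) \<in> U \<Longrightarrow> F (s, y) = H (s, y)"
    by (rule local_extension[OF t01 x(1)]) (rule that)
  obtain d where d: "d > 0" "ball (t, x) d \<subseteq> U"
    using U(1,2) open_contains_ball by blast
  define \<delta> where "\<delta> = min d (min t (1 - t))"
  have \<delta>: "\<delta> > 0" using d(1) t by (simp add: \<delta>_def)
  define \<gamma> where "\<gamma> s = F ((t, x) + (s, 0))" for s :: real
  have inU: "(t, x) + (s, 0) \<in> U" if "s \<in> {-\<delta><..<\<delta>}" for s
  proof -
    have "(t + s, x) \<in> ball (t, x) d" using that by (auto simp: dist_Pair_Pair dist_norm \<delta>_def)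
    then show ?thesis using d(2) by auto
  qed
  have "bounded_linear (\<lambda>s::real. (s, 0::'a))"
    by (intro bounded_linear_Pair bounded_linear_ident bounded_linear_zero)
  then have sm: "smooth_on {-\<delta><..<\<delta>} \<gamma>"
    unfolding \<gamma>_def by (intro smooth_on_affine_compose[OF U(1)] U(3) inU) auto
  have ts: "t + s \<in> {0..1}" if "s \<in> {-\<delta><..<\<delta>}" for s
    using that by (auto simp: \<delta>_def min_def split: if_splits)
  have \<gamma>H: "\<gamma> s = H (t + s, x)" if "s \<in> {-\<delta><..<\<delta>}" for s
    unfolding \<gamma>_def using U(4)[OF ts[OF that] x(1)] inU[OF that] by simp
  have inM: "\<gamma> ` {-\<delta><..<\<delta>} \<subseteq> M"
  proof (rule image_subsetI)
    fix s assume s: "s \<in> {-\<delta><..<\<delta>}"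
    show "\<gamma> s \<in> M" using H_in[OF ts[OF s] x(1)] \<gamma>H[OF s] by simp
  qed
  have \<gamma>0: "\<gamma> 0 = y" using \<gamma>H[of 0] \<delta> x(2) by simp
  have "((\<lambda>s. F (s, x)) \<circ> (\<lambda>s. t + s) has_vector_derivative
      1 *\<^sub>R fderiv F (t, x) (1, 0)) (at 0)"
  proof (rule vector_diff_chain_at)
    show "((\<lambda>s. t + s) has_vector_derivative 1) (at 0)"
      by (auto intro!: derivative_eq_intros)
    show "((\<lambda>s. F (s, x)) has_vector_derivative fderiv F (t, x) (1, 0)) (at (t + 0))"
      using extension_derivative[OF U(3,2)] by simp
  qed
  then have "(\<gamma> has_vector_derivative velocity t x) (at 0)"
    using velocity_extension(2)[OF U t01 x(1)] by (simp add: \<gamma>_def[abs_def] o_def)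
  then show ?thesis
    unfolding tangent_space_def field_def x_def[symmetric] using \<delta> sm inM \<gamma>0
    by (intro CollectI exI[of _ \<delta>] exI[of _ \<gamma>] conjI)
qed

text \<open>Since \<open>H_inv\<close> undoes \<open>H\<close>, the field at \<open>H (t, x)\<close>
  is \<open>velocity t x\<close>; uniform continuity of \<open>velocity\<close> provides one step
  size for all points and times.\<close>

lemma field_consistent:
  assumes e: "e > 0"
  shows "\<exists>d>0. \<forall>x\<in>M. \<forall>t s. 0 \<le> t \<and> 0 < s \<and> s < d \<and> t + s \<le> 1 \<longrightarrow>
    norm (H (t + s, x) - H (t, x) - s *\<^sub>R field t (H (t, x))) \<le> e * s"
proof -
  have k: "compact ({0..1::real} \<times> M)" by (intro compact_Times compact_Icc compact)
  obtain d where d: "d > 0" "\<And>p q. p \<in> {0..1} \<times> M \<Longrightarrow> q \<in> {0..1} \<times> M \<Longrightarrow> dist q p < d \<Longrightarrow>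
      dist (velocity (fst q) (snd q)) (velocity (fst p) (snd p)) < e"
    by (rule compact_continuous_modulus[OF k continuous_velocity e]) (rule that)
  have "norm (H (t + s, x) - H (t, x) - s *\<^sub>R field t (H (t, x))) \<le> e * s"
    if x: "x \<in> M" and ts: "0 \<le> t" "0 < s" "s < d" "t + s \<le> 1" for x t s
  proof -
    have "norm (H (t + s, x) - H (t, x) - (t + s - t) *\<^sub>R velocity t x) \<le> norm (t + s - t) * e"
    proof (rule vector_differentiable_bound_linearization[where S = "{t..t + s}" and f = "\<lambda>r. H (r, x)"])
      fix r assume r: "r \<in> {t..t + s}"
      then have r01: "r \<in> {0..1}" "t \<in> {0..1}" using ts by auto
      show "((\<lambda>r. H (r, x)) has_vector_derivative velocity r x) (at r within {t..t + s})"
        by (rule has_vector_derivative_within_subset[OF velocity_derivative[OF r01(1) x]]) (use ts in auto)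
      have "dist (r, x) (t, x) < d" using r ts by (simp add: dist_Pair_Pair dist_norm)
      then show "norm (velocity r x - velocity t x) \<le> e"
        using d(2)[of "(t, x)" "(r, x)"] r01 x by (simp add: dist_norm)
    qed (use ts in \<open>auto simp: closed_segment_eq_real_ivl\<close>)
    moreover have "t \<in> {0..1}" using ts by simp
    ultimately show ?thesis using H_inv_H[OF _ x] ts by (simp add: field_def mult.commute)
  qed
  then show ?thesis using d(1) by blast
qed

text \<open>Approximability of each frozen field gives a step size depending on the time, whereas
  the Euler scheme wants one for all times. Finitely many frozen times serve for all, as the field
  varies uniformly little between neighbours. They are taken strictly inside \<open>{0..1}\<close>,
  where tangency is available.\<close>

lemma isotopy_end_in_cl:
  assumes R: "map_semigroup M R"
    and app: "\<And>W. continuous_on M W \<Longrightarrow> (\<And>y. y \<in> M \<Longrightarrow> W y \<in> tangent_space M y) \<Longrightarrow>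
        map_semigroup.approximable M R W"
    and init: "\<And>x. x \<in> M \<Longrightarrow> H (0, x) = x"
  shows "(\<lambda>x. H (1, x)) \<in> map_semigroup.cl M R"
proof -
  interpret map_semigroup M R by (rule R)
  obtain L where L: "\<And>t. t \<in> {0..1} \<Longrightarrow> L-lipschitz_on M (field t)"
    using lipschitz_field by blast
  show ?thesis
  proof (rule euler_limit[where c = "\<lambda>t x. H (t, x)" and V = field and L = L])
    fix e :: real assume e: "e > 0"
    show "\<exists>d>0. \<forall>x\<in>M. \<forall>t s. 0 \<le> t \<and> 0 < s \<and> s < d \<and> t + s \<le> 1 \<longrightarrow>
        norm (H (t + s, x) - H (t, x) - s *\<^sub>R field t (H (t, x))) \<le> e * s"
      by (rule field_consistent[OF e])
    have k: "compact ({0..1::real} \<times> M)" by (intro compact_Times compact_Icc compact)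
    have e2: "e / 2 > 0" using e by simp
    obtain \<delta> where \<delta>: "\<delta> > 0" "\<And>p q. p \<in> {0..1} \<times> M \<Longrightarrow> q \<in> {0..1} \<times> M \<Longrightarrow> dist q p < \<delta> \<Longrightarrow>
        dist (field (fst q) (snd q)) (field (fst p) (snd p)) < e / 2"
      by (rule compact_continuous_modulus[OF k continuous_field e2]) (rule that)
    have cover: "{0..1::real} \<subseteq> (\<Union>\<tau>\<in>{0<..<1}. ball \<tau> \<delta>)"
    proof
      fix t :: real assume t: "t \<in> {0..1}"
      \<comment> \<open>A shift towards the middle by at most 1/4 reaches an interior time close to
        any \<open>t\<close>, the end points included.\<close>
      define \<mu> where "\<mu> = min (\<delta> / 2) (1 / 4)"
      have \<mu>: "0 < \<mu>" "\<mu> \<le> 1 / 4" "\<mu> < \<delta>" using \<delta>(1) by (auto simp: \<mu>_def)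
      define \<tau> where "\<tau> = (if t < 1 / 2 then t + \<mu> else t - \<mu>)"
      have "\<tau> \<in> {0<..<1}" "dist \<tau> t < \<delta>" using t \<mu> by (auto simp: \<tau>_def dist_norm)
      then show "t \<in> (\<Union>\<tau>\<in>{0<..<1}. ball \<tau> \<delta>)"
        by (intro UN_I[of \<tau>]) auto
    qed
    obtain T where T: "T \<subseteq> {0<..<1::real}" "finite T" "{0..1} \<subseteq> (\<Union>\<tau>\<in>T. ball \<tau> \<delta>)"
      by (rule compactE_image[OF compact_Icc open_ball cover]) (erule (2) that)
    have "\<exists>d>0. \<forall>s. 0 < s \<and> s < d \<longrightarrow> (has_step (field \<tau>) (e / 2) s)"
      if \<tau>: "\<tau> \<in> T" for \<tau>
    proof -
      have "0 < \<tau>" "\<tau> < 1" using \<tau> T(1) by auto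
      then have "approximable (field \<tau>)"
        by (intro app continuous_on_slices(2)[OF continuous_field] field_tangent) auto
      then have "\<forall>e>0. \<exists>d>0. \<forall>s. 0 < s \<and> s < d \<longrightarrow>
          (has_step (field \<tau>) e s)"
        unfolding approximable_def by (rule conjunct2)
      from this[rule_format, OF e2] show ?thesis .
    qed
    then have "\<forall>\<tau>\<in>T. \<exists>d>0. \<forall>s. 0 < s \<and> s < d \<longrightarrow>
        (has_step (field \<tau>) (e / 2) s)"
      by (intro ballI)
    from bchoice[OF this] obtain d where d: "\<And>\<tau>. \<tau> \<in> T \<Longrightarrow> d \<tau> > (0::real)" "\<And>\<tau> s. \<tau> \<in> T \<Longrightarrow> 0 < s \<Longrightarrow> s < d \<tau> \<Longrightarrow>
        has_step (field \<tau>) (e / 2) s"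
      by blast
    define d0 where "d0 = Min (insert 1 (d ` T))"
    have d0: "d0 > 0" "\<And>\<tau>. \<tau> \<in> T \<Longrightarrow> d0 \<le> d \<tau>"
      using T(2) d(1) by (auto simp: d0_def)
    have "has_step (field t) e s"
      if s: "0 < s" "s < d0" and t: "t \<in> {0..1}" for s t
    proof -
      obtain \<tau> where \<tau>: "\<tau> \<in> T" "dist \<tau> t < \<delta>" using T(3) t by (auto simp: subset_iff)
      have \<tau>01: "\<tau> \<in> {0..1}" using T(1) \<tau>(1) by auto
      have "s < d \<tau>" using d0(2)[OF \<tau>(1)] s(2) by simp
      then obtain P where P: "P \<in> cl" "\<And>x. x \<in> M \<Longrightarrow> norm (P x - x - s *\<^sub>R field \<tau> x) \<le> e / 2 * s"
        using d(2)[OF \<tau>(1) s(1)] by blast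
      have "norm (P x - x - s *\<^sub>R field t x) \<le> e * s" if x: "x \<in> M" for x
      proof -
        have "dist (field \<tau> x) (field t x) < e / 2"
          using \<delta>(2)[of "(t, x)" "(\<tau>, x)"] t \<tau>01 x \<tau>(2) by (simp add: dist_Pair_Pair)
        then have "norm (s *\<^sub>R (field \<tau> x - field t x)) \<le> s * (e / 2)"
          using s(1) by (simp add: dist_norm)
        moreover have "P x - x - s *\<^sub>R field t x = (P x - x - s *\<^sub>R field \<tau> x) + s *\<^sub>R (field \<tau> x - field t x)"
          by (simp add: algebra_simps)
        ultimately show ?thesis
          using P(2)[OF x] norm_triangle_ineq[of "P x - x - s *\<^sub>R field \<tau> x" "s *\<^sub>R (field \<tau> x - field t x)"]
          by (simp add: algebra_simps)
      qed
      then show ?thesis using P(1) by blast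
    qed
    then show "\<exists>d>0. \<forall>s t. 0 < s \<and> s < d \<and> t \<in> {0..1} \<longrightarrow>
        (has_step (field t) e s)"
      using d0(1) by (intro exI[of _ d0]) simp
  qed (use init H_in L in auto)
qed

end

section \<open>Realizable maps\<close>

lemma lipschitz_on_balls_activation:
  fixes w :: "'a::real_inner"
  assumes "regular_activation \<sigma>"
  shows "lipschitz_on_balls (\<lambda>x. \<sigma> (w \<bullet> x + b))"
  unfolding lipschitz_on_balls_def
proof
  fix r
  obtain K where K: "K > 0" "\<And>x y. \<bar>\<sigma> x - \<sigma> y\<bar> \<le> K * \<bar>x - y\<bar>"
    using assms unfolding regular_activation_def by blast
  have "(K * norm w)-lipschitz_on (cball 0 r) (\<lambda>x. \<sigma> (w \<bullet> x + b))"
  proof (rule lipschitz_onI)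
    fix x y :: 'a
    have "\<bar>\<sigma> (w \<bullet> x + b) - \<sigma> (w \<bullet> y + b)\<bar> \<le> K * \<bar>w \<bullet> (x - y)\<bar>"
      using K(2)[of "w \<bullet> x + b" "w \<bullet> y + b"] by (simp add: inner_diff_right)
    also have "\<dots> \<le> K * (norm w * norm (x - y))"
      using K(1) Cauchy_Schwarz_ineq2[of w "x - y"] by (intro mult_left_mono) auto
    finally show "dist (\<sigma> (w \<bullet> x + b)) (\<sigma> (w \<bullet> y + b)) \<le> K * norm w * dist x y"
      by (simp add: dist_norm mult.assoc)
  qed (use K(1) in simp)
  then show "\<exists>L. L-lipschitz_on (cball 0 r) (\<lambda>x. \<sigma> (w \<bullet> x + b))" ..
qed

text \<open>The constant values of amplitudes, weights and biases on one time piece, each indexed by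
  the number of the control field.\<close>

type_synonym 'd control = "(nat \<Rightarrow> real) \<times> (nat \<Rightarrow> real ^ 'd) \<times> (nat \<Rightarrow> real)"

definition neural_field ::
  "(real \<Rightarrow> real) \<Rightarrow> (nat \<Rightarrow> real ^ 'd \<Rightarrow> real ^ 'd) \<Rightarrow> nat \<Rightarrow> 'd::finite control \<Rightarrow> real ^ 'd \<Rightarrow> real ^ 'd" where
  "neural_field \<sigma> g m p x =
     (\<Sum>i=1..m. (fst p i * \<sigma> (fst (snd p) i \<bullet> x + snd (snd p) i)) *\<^sub>R g i x)"

locale neural_control =
  fixes M :: "(real ^ 'd::finite) set" and m :: nat
    and g :: "nat \<Rightarrow> real ^ 'd \<Rightarrow> real ^ 'd" and \<sigma> :: "real \<Rightarrow> real"
  assumes compact_M: "compact M"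
    and smooth_g: "\<And>i. i \<in> {1..m} \<Longrightarrow> smooth_on UNIV (g i)"
    and Lie: "\<And>x. x \<in> M \<Longrightarrow> Lie_at (g ` {1..m}) x = tangent_space M x"
    and regular: "regular_activation \<sigma>"
begin

abbreviation nf :: "'d control \<Rightarrow> real ^ 'd \<Rightarrow> real ^ 'd" where
  "nf \<equiv> neural_field \<sigma> g m"

text \<open>\<open>tangent_space\<close> is defined by curves, which do not show its linearity; here
  it is read off from the description as a span.\<close>

lemma tangent_subspace:
  assumes "x \<in> M"
  shows "subspace (tangent_space M x)"
  using Lie[OF assms, symmetric] by (simp add: Lie_at_def subspace_span)

lemma bracket_tangent:
  assumes "x \<in> M" "B \<in> bracket_level (g ` {1..m}) l"
  shows "B x \<in> tangent_space M x"
proof -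
  have "B x \<in> Lie_at (g ` {1..m}) x"
    unfolding Lie_at_def using assms(2) by (intro span_base CollectI exI[of _ B] conjI exI[of _ l] refl)
  then show ?thesis using Lie[OF assms(1)] by simp
qed

lemma g_tangent:
  assumes "i \<in> {1..m}" "x \<in> M"
  shows "g i x \<in> tangent_space M x"
proof (rule bracket_tangent[OF assms(2)])
  show "g i \<in> bracket_level (g ` {1..m}) 0"
    using assms(1) by (simp add: bracket_level.simps)
qed

lemma nf_summand_lipschitz:
  assumes "i \<in> {1..m}"
  shows "lipschitz_on_balls (\<lambda>x. (a * \<sigma> (w \<bullet> x + b)) *\<^sub>R g i x)"
proof -
  have "lipschitz_on_balls (\<lambda>x. a * \<sigma> (w \<bullet> x + b))"
    using lipschitz_on_balls_scaleR[OF lipschitz_on_balls_const[of a]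
        lipschitz_on_balls_activation[OF regular, of w b]] by simp
  from lipschitz_on_balls_scaleR[OF this smooth_on_lipschitz_on_balls[OF smooth_g[OF assms]]]
  show ?thesis .
qed

lemma nf_lipschitz: "lipschitz_on_balls (nf p)"
  unfolding neural_field_def[abs_def]
  by (rule lipschitz_on_balls_sum) (rule nf_summand_lipschitz)

lemma nf_tangent:
  assumes "x \<in> M"
  shows "nf p x \<in> tangent_space M x"
  unfolding neural_field_def
  by (intro subspace_sum subspace_mul tangent_subspace[OF assms] g_tangent assms)

definition nflow :: "'d control \<Rightarrow> real \<Rightarrow> real ^ 'd \<Rightarrow> real ^ 'd" where
  "nflow p = (SOME \<Phi>. flow_on M (nf p) \<Phi>)"

lemma nflow: "flow_on M (nf p) (nflow p)"
proof -
  obtain \<Phi> where "flow_on M (nf p) \<Phi>"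
    by (rule flow_on_exists[OF nf_lipschitz compact_M nf_tangent])
  then show ?thesis unfolding nflow_def by (rule someI[of "flow_on M (nf p)"])
qed

lemma nflow_0: "x \<in> M \<Longrightarrow> nflow p 0 x = x"
  using nflow by (simp add: flow_on_def)

lemma nflow_in: "x \<in> M \<Longrightarrow> t \<in> {0..1} \<Longrightarrow> nflow p t x \<in> M"
  using nflow by (simp add: flow_on_def)

text \<open>The head of the list acts first. Every control runs for unit time; durations are encoded
  in the amplitudes, on which the field depends linearly.\<close>

primrec run :: "'d control list \<Rightarrow> real ^ 'd \<Rightarrow> real ^ 'd" where
  "run [] x = x"
| "run (p # ps) x = run ps (nflow p 1 x)"

lemma run_append: "run (ps @ qs) x = run qs (run ps x)"
  by (induction ps arbitrary: x) auto

lemma run_in: "x \<in> M \<Longrightarrow> run ps x \<in> M"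
  by (induction ps arbitrary: x) (auto simp: nflow_in)

lemma nf_bounds:
  obtains L B where "L > 0" "B > 0" "L-lipschitz_on M (nf p)" "\<And>x. x \<in> M \<Longrightarrow> norm (nf p x) \<le> B"
proof -
  obtain L where L: "L > 0" "L-lipschitz_on M (nf p)"
    using lipschitz_on_balls_compact[OF nf_lipschitz compact_M] by blast
  obtain B where B: "B > 0" "\<And>x. x \<in> M \<Longrightarrow> norm (nf p x) \<le> B"
    using compact_continuous_bound[OF compact_M lipschitz_on_continuous_on[OF L(2)]] by blast
  show thesis by (rule that[OF L(1) B(1) L(2) B(2)])
qed

lemma nflow_continuous: "continuous_on M (nflow p 1)"
proof -
  obtain L B where LB: "L > 0" "B > 0" "L-lipschitz_on M (nf p)" "\<And>x. x \<in> M \<Longrightarrow> norm (nf p x) \<le> B"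
    by (rule nf_bounds[of p]) (rule that)
  show ?thesis by (rule flow_on_continuous[OF nflow LB(3,4)]) simp_all
qed

lemma run_continuous: "continuous_on M (run ps)"
proof (induction ps)
  case (Cons p ps)
  have "continuous_on M (\<lambda>x. run ps (nflow p 1 x))"
    by (rule continuous_on_compose2[OF Cons nflow_continuous]) (auto simp: nflow_in)
  moreover have "run (p # ps) = (\<lambda>x. run ps (nflow p 1 x))" by (rule ext) simp
  ultimately show ?case by (simp only:)
next
  case Nil
  have "run [] = (\<lambda>x. x)" by (rule ext) simp
  then show ?case by (simp only: continuous_on_id)
qed

definition realizable :: "(real ^ 'd \<Rightarrow> real ^ 'd) set" where
  "realizable = range run"

lemma map_semigroup_realizable: "map_semigroup M realizable"
proof
  show "X \<in> M \<rightarrow> M" if "X \<in> realizable" for X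
    using that by (auto simp: realizable_def run_in)
  show "continuous_on M X" if "X \<in> realizable" for X
    using that by (auto simp: realizable_def run_continuous)
  have "(\<lambda>x. x) = run []" by (rule ext) simp
  then show "(\<lambda>x. x) \<in> realizable" unfolding realizable_def by (metis rangeI)
  show "(\<lambda>x. X (Y x)) \<in> realizable" if XY: "X \<in> realizable" "Y \<in> realizable" for X Y
  proof -
    obtain ps qs where "X = run ps" "Y = run qs" using XY by (auto simp: realizable_def)
    then have "(\<lambda>x. X (Y x)) = run (qs @ ps)" by (simp add: run_append fun_eq_iff)
    then show ?thesis unfolding realizable_def by (metis rangeI)
  qed
qed (rule compact_M)

section \<open>From lists of controls to solutions on the unit interval\<close>

text \<open>Appending a zero control changes no map on \<open>M\<close> and makes every list
  nonempty, so that the identity also arises from a partition of \<open>{0..1}\<close>.\<close>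

lemma nflow_zero:
  assumes "x \<in> M"
  shows "nflow (\<lambda>_. 0, w, b) 1 x = x"
proof -
  define p where "p = (\<lambda>_::nat. 0::real, w, b)"
  have z: "nf p = (\<lambda>x. 0)" by (rule ext) (simp add: neural_field_def p_def)
  have "norm (nflow p 1 x - nflow p 0 x) \<le> 0 * (1 - 0)"
    by (rule flow_on_displacement[OF nflow _ _ assms]) (auto simp: z intro: lipschitz_on_constant)
  then show ?thesis using nflow_0[OF assms] by (simp add: p_def)
qed

text \<open>The minimum puts the end point \<open>t = 1\<close> into the last piece.\<close>

definition piece :: "nat \<Rightarrow> real \<Rightarrow> nat" where
  "piece n t = min (nat \<lfloor>n * t\<rfloor>) (n - 1)"

lemma piece_eq:
  fixes t :: real
  assumes "k < n" "real k \<le> real n * t" "real n * t < real k + 1"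
  shows "piece n t = k"
proof -
  have "\<lfloor>n * t\<rfloor> = int k" using assms by (intro floor_unique) auto
  then show ?thesis using assms(1) by (simp add: piece_def)
qed

lemma piece_less: "n > 0 \<Longrightarrow> piece n t < n"
  by (auto simp: piece_def)

lemma piecewise_constant_piece:
  assumes "n > 0"
  shows "piecewise_constant (\<lambda>t. f (piece n t))"
  unfolding piecewise_constant_def
proof (intro exI conjI allI impI)
  fix i assume i: "i < n"
  show "real i / n < real (Suc i) / n" using assms by (simp add: divide_strict_right_mono)
  have "f (piece n t) = f i" if "t \<in> {real i / n<..<real (Suc i) / n}" for t
  proof -
    have "real i \<le> real n * t" "real n * t < real i + 1"
      using that assms by (auto simp: field_simps)
    then show ?thesis by (simp only: piece_eq[OF i])
  qed
  then show "\<forall>t\<in>{real i / n<..<real (Suc i) / n}. f (piece n t) = f i" by blast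
qed (use assms in auto)

text \<open>Squeezing a unit-time flow into time \<open>1 / n\<close> multiplies the field by
  \<open>n\<close>, and only the amplitude has to change for that. The glued curve is Lipschitz,
  hence absolutely continuous, and solves the equation away from the break points; uniqueness holds
  in the whole ambient space.\<close>

lemma run_is_flow_map:
  fixes ps :: "'d control list"
  assumes ne: "ps \<noteq> []"
  defines "n \<equiv> length ps"
  shows "is_flow_map M (\<lambda>t. nf (\<lambda>i. real n * fst (ps ! piece n t) i, snd (ps ! piece n t))) (run ps)"
    (is "is_flow_map M ?F (run ps)")
proof -
  have n: "n > 0" using ne by (simp add: n_def)
  have F: "?F t x = real n *\<^sub>R nf (ps ! piece n t) x" for t x
    by (simp add: neural_field_def scaleR_sum_right mult.assoc)
  let ?I = "\<lambda>k::nat. {real k / real n..(real k + 1) / real n}"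
  let ?J = "\<lambda>k::nat. {real k / real n<..<(real k + 1) / real n}"
  \<comment> \<open>The sum of the finitely many nonnegative constants dominates each of them,
    whichever piece is active.\<close>
  have Flip: "\<exists>L. \<forall>t\<in>{0..1}. L-lipschitz_on (cball 0 r) (?F t)" for r
  proof -
    have "\<forall>k. \<exists>L. L-lipschitz_on (cball 0 r) (nf (ps ! k))"
      using nf_lipschitz unfolding lipschitz_on_balls_def by blast
    from choice[OF this] obtain L where L: "\<And>k. (L k)-lipschitz_on (cball 0 r) (nf (ps ! k))"
      by blast
    have "(\<bar>real n\<bar> * (\<Sum>k<n. L k))-lipschitz_on (cball 0 r) (?F t)" for t
    proof -
      have "L (piece n t) \<le> (\<Sum>k<n. L k)"
        using piece_less[OF n] lipschitz_on_nonneg[OF L] by (intro member_le_sum) auto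
      from lipschitz_on_mono[OF L subset_refl this]
      have "(\<Sum>k<n. L k)-lipschitz_on (cball 0 r) (nf (ps ! piece n t))" .
      from lipschitz_on_cmult[OF this, of "real n"] show ?thesis by (simp only: F[abs_def])
    qed
    then show ?thesis by blast
  qed
  have sol: "\<exists>x. ode_solution ?F x0 x \<and> run ps x0 = x 1" if x0: "x0 \<in> M" for x0
  proof -
    define z where "z k = run (take k ps) x0" for k
    have zM: "z k \<in> M" for k unfolding z_def by (rule run_in[OF x0])
    have zS: "z (Suc k) = nflow (ps ! k) 1 (z k)" if "k < n" for k
      using that by (simp add: z_def take_Suc_conv_app_nth n_def run_append)
    define y where "y k t = nflow (ps ! k) (real n * t - real k) (z k)" for k and t :: real
    define x where "x t = y (piece n t) t" for t
    \<comment> \<open>At the right end of a cell \<open>piece\<close> already selects the next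
      control, except for the last cell. The two formulas agree there because a flow at time 0 is
      the identity.\<close>
    have xy: "x t = y k t" if k: "k < n" and t: "t \<in> ?I k" for k t
    proof -
      have b: "real k \<le> real n * t" "real n * t \<le> real k + 1" using t n by (auto simp: field_simps)
      show ?thesis
      proof (cases "real n * t < real k + 1")
        case True
        then show ?thesis using piece_eq[OF k b(1)] by (simp add: x_def)
      next
        case False
        then have e: "real n * t = real k + 1" using b(2) by simp
        show ?thesis
        proof (cases "Suc k < n")
          case True
          have "piece n t = Suc k" using e by (intro piece_eq True) auto
          then have "x t = nflow (ps ! Suc k) 0 (z (Suc k))" using e by (simp add: x_def y_def)
          also have "\<dots> = z (Suc k)" by (rule nflow_0[OF zM])
          also have "\<dots> = y k t" using e zS[OF k] by (simp add: y_def)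
          finally show ?thesis .
        next
          case False
          then have "piece n t = k"
            using e k by (simp add: piece_def)
          then show ?thesis by (simp add: x_def)
        qed
      qed
    qed
    have yder: "(y k has_vector_derivative real n *\<^sub>R nf (ps ! k) (y k t)) (at t within ?I k)"
      if k: "k < n" and t: "t \<in> ?I k" for k t
    proof -
      let ?\<phi> = "\<lambda>s. nflow (ps ! k) s (z k)" and ?l = "\<lambda>t. real n * t - real k"
      have im: "?l ` ?I k \<subseteq> {0..1}" using n by (auto simp: field_simps)
      have "(?l has_vector_derivative real n) (at t within ?I k)"
      proof -
        have "(?l has_real_derivative real n) (at t within ?I k)"
          by (auto intro!: derivative_eq_intros)
        then show ?thesis by (simp only: has_real_derivative_iff_has_vector_derivative)
      qed
      moreover have "(?\<phi> has_vector_derivative nf (ps ! k) (?\<phi> (?l t))) (at (?l t) within ?l ` ?I k)"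
      proof (rule has_vector_derivative_within_subset[OF _ im])
        have "?l t \<in> {0..1}" using im t by blast
        then show "(?\<phi> has_vector_derivative nf (ps ! k) (?\<phi> (?l t))) (at (?l t) within {0..1})"
          using nflow[of "ps ! k"] zM[of k] unfolding flow_on_def by blast
      qed
      ultimately have "(?\<phi> \<circ> ?l has_vector_derivative real n *\<^sub>R nf (ps ! k) (?\<phi> (?l t))) (at t within ?I k)"
        by (rule vector_diff_chain_within)
      then show ?thesis by (simp add: y_def[abs_def] o_def)
    qed
    have yM: "y k t \<in> M" if "k < n" "t \<in> ?I k" for k t
    proof -
      have "real n * t - real k \<in> {0..1}" using that n by (auto simp: field_simps)
      then show ?thesis unfolding y_def by (rule nflow_in[OF zM])
    qed
    have "\<forall>k. \<exists>B. \<forall>x\<in>M. norm (nf (ps ! k) x) \<le> B"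
      using nf_bounds by metis
    from choice[OF this] obtain B where B: "\<And>k x. x \<in> M \<Longrightarrow> norm (nf (ps ! k) x) \<le> B k" by blast
    define C where "C = real n * (\<Sum>k<n. \<bar>B k\<bar>)"
    have C: "C \<ge> 0" by (simp add: C_def sum_nonneg)
    have ylip: "C-lipschitz_on (?I k) (y k)" if k: "k < n" for k
    proof (rule bounded_derivative_imp_lipschitz)
      show "(y k has_derivative (\<lambda>h. h *\<^sub>R (real n *\<^sub>R nf (ps ! k) (y k t)))) (at t within ?I k)"
        if "t \<in> ?I k" for t
        using yder[OF k that] by (simp add: has_vector_derivative_def)
      show "onorm (\<lambda>h. h *\<^sub>R (real n *\<^sub>R nf (ps ! k) (y k t))) \<le> C" if t: "t \<in> ?I k" for t
      proof (rule onorm_le)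
        fix h :: real
        have "norm (nf (ps ! k) (y k t)) \<le> \<bar>B k\<bar>" using B[OF yM[OF k t], of k] by simp
        also have "\<dots> \<le> (\<Sum>k<n. \<bar>B k\<bar>)" using k by (intro member_le_sum) auto
        finally have "norm (real n *\<^sub>R nf (ps ! k) (y k t)) \<le> C"
          by (simp add: C_def mult_left_mono)
        from mult_right_mono[OF this norm_ge_zero[of h]]
        show "norm (h *\<^sub>R (real n *\<^sub>R nf (ps ! k) (y k t))) \<le> C * norm h"
          by (subst norm_scaleR) (simp only: real_norm_def mult.commute)
      qed
    qed (use C in auto)
    \<comment> \<open>Cells are concatenated one by one; the common end point lets the constant
      \<open>C\<close> be kept.\<close>
    have xlip: "C-lipschitz_on {0..real k / real n} x" if "k \<le> n" for k
      using that
    proof (induction k)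
      case 0
      then show ?case using C by (simp add: lipschitz_on_singleton)
    next
      case (Suc k)
      have "C-lipschitz_on (?I k) x"
        by (rule lipschitz_on_transform[OF ylip[of k]]) (use Suc.prems xy in auto)
      from lipschitz_on_concat[OF Suc.IH this] Suc.prems
      have "C-lipschitz_on {0..(real k + 1) / real n} (\<lambda>t. if t \<le> real k / real n then x t else x t)" by simp
      then show ?case by (simp add: add.commute)
    qed
    have "abs_continuous_on_interval 0 1 x"
      using xlip[of n] n by (intro lipschitz_on_imp_abs_continuous[where L = C]) simp
    moreover have "x 0 = x0"
      using xy[of 0 0] n nflow_0[OF zM[of 0]] by (simp add: y_def z_def)
    moreover have "AE t in lebesgue. t \<in> {0..1} \<longrightarrow> (x has_vector_derivative ?F t (x t)) (at t within {0..1})"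
    proof -
      \<comment> \<open>Outside this finite set of break points \<open>t\<close> is interior to one
        cell, on which \<open>x\<close> is a single rescaled flow.\<close>
      define E where "E = (\<lambda>k. real k / n) ` {..n}"
      have "E \<in> null_sets lebesgue"
        unfolding E_def by (intro countable_imp_null_set_lborel[THEN null_sets_completionI] countable_finite) auto
      then have "AE t in lebesgue. t \<notin> E" by (rule AE_not_in)
      then show ?thesis
      proof eventually_elim
        case (elim t)
        show ?case
        proof
          assume t: "t \<in> {0..1}"
          define k where "k = nat \<lfloor>real n * t\<rfloor>"
          have kt: "real k \<le> real n * t" "real n * t < real k + 1" using t by (auto simp: k_def)
          have "t \<noteq> real j / n" if "j \<le> n" for j using elim that by (auto simp: E_def)
          then have nj: "real n * t \<noteq> real j" if "j \<le> n" for j using n that by (auto simp: field_simps)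
          have "real n * t \<le> real n" using t by (simp add: mult_left_le)
          then have "real n * t < real n" using nj[of n] by simp
          then have kn: "k < n" using kt(1) by linarith
          have kt': "real k < real n * t" using kt(1) nj[of k] kn by simp
          have tin: "t \<in> ?J k" using kt kt' n by (auto simp: field_simps)
          have tcl: "t \<in> ?I k" using tin by simp
          have sub: "?J k \<subseteq> ?I k"
            by auto
          have eq: "y k s = x s" if "s \<in> ?J k" for s
            using xy[OF kn subsetD[OF sub that]] by simp
          note has_vector_derivative_within_subset[OF yder[OF kn tcl] sub]
          then have "(y k has_vector_derivative real n *\<^sub>R nf (ps ! k) (y k t)) (at t)"
            by (simp only: at_within_open[OF tin open_greaterThanLessThan])
          from has_vector_derivative_transform_within_open[OF this open_greaterThanLessThan tin eq]
          have "(x has_vector_derivative real n *\<^sub>R nf (ps ! k) (y k t)) (at t)" .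
          moreover have "x t = y k t" by (rule xy[OF kn tcl])
          moreover have "piece n t = k" by (rule piece_eq[OF kn kt])
          ultimately have "(x has_vector_derivative ?F t (x t)) (at t)" unfolding F by simp
          then show "(x has_vector_derivative ?F t (x t)) (at t within {0..1})"
            by (rule has_vector_derivative_at_within)
        qed
      qed
    qed
    moreover have "run ps x0 = x 1"
    proof -
      have "x 1 = y (n - 1) 1" using n by (intro xy) (auto simp: of_nat_diff)
      also have "\<dots> = z (Suc (n - 1))" using n zS[of "n - 1"] by (simp add: y_def of_nat_diff)
      also have "\<dots> = run ps x0" using n by (simp add: z_def n_def)
      finally show ?thesis by (rule sym)
    qed
    ultimately have "ode_solution ?F x0 x \<and> run ps x0 = x 1"
      unfolding ode_solution_def by (intro conjI)
    then show ?thesis by (rule exI[of _ x])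
  qed
  show ?thesis
    unfolding is_flow_map_def
  proof (intro conjI ballI)
    show "run ps \<in> M \<rightarrow> M" by (intro Pi_I run_in)
    fix x0 assume "x0 \<in> M"
    from sol[OF this] obtain x where x: "ode_solution ?F x0 x" "run ps x0 = x 1" by blast
    have uniq: "y t = x t" if "ode_solution ?F x0 y" "t \<in> {0..1}" for y t
      by (rule ode_solution_unique[OF Flip that(1) x(1) that(2)])
    show "\<exists>x. ode_solution ?F x0 x \<and> run ps x0 = x 1 \<and>
        (\<forall>y. ode_solution ?F x0 y \<longrightarrow> (\<forall>t\<in>{0..1}. y t = x t))"
      by (intro exI[of _ x] conjI allI impI ballI x uniq)
  qed
qed

lemma realizable_controls:
  assumes "X \<in> realizable"
  shows "\<exists>(a :: nat \<Rightarrow> real \<Rightarrow> real) (w :: nat \<Rightarrow> real \<Rightarrow> real ^ 'd) (b :: nat \<Rightarrow> real \<Rightarrow> real).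
      (\<forall>i\<in>{1..m}. piecewise_constant (a i) \<and> piecewise_constant (w i) \<and> piecewise_constant (b i)) \<and>
      (\<exists>X'. is_flow_map M (\<lambda>t x. \<Sum>i=1..m. (a i t * \<sigma> (w i t \<bullet> x + b i t)) *\<^sub>R g i x) X' \<and>
         (\<forall>x\<in>M. X' x = X x))"
proof -
  obtain qs where qs: "X = run qs" using assms by (auto simp: realizable_def)
  define ps where "ps = qs @ [(\<lambda>_. 0, \<lambda>_. 0, \<lambda>_. 0)]"
  define n where "n = length ps"
  have ne: "ps \<noteq> []" and n: "n > 0" by (simp_all add: ps_def n_def)
  have eq: "run ps x = X x" if "x \<in> M" for x
    using nflow_zero[OF run_in[OF that]] by (simp add: ps_def run_append qs)
  define a where "a i t = real n * fst (ps ! piece n t) i" for i t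
  define w where "w i t = fst (snd (ps ! piece n t)) i" for i t
  define b where "b i t = snd (snd (ps ! piece n t)) i" for i t
  have "piecewise_constant (a i)" "piecewise_constant (w i)" "piecewise_constant (b i)" for i
    unfolding a_def w_def b_def by (rule piecewise_constant_piece[OF n])+
  moreover have "is_flow_map M (\<lambda>t x. \<Sum>i=1..m. (a i t * \<sigma> (w i t \<bullet> x + b i t)) *\<^sub>R g i x) (run ps)"
    using run_is_flow_map[OF ne] unfolding n_def[symmetric]
    by (simp add: neural_field_def[abs_def] a_def w_def b_def)
  ultimately show ?thesis using eq
    by (intro exI[of _ a] exI[of _ w] exI[of _ b] exI[of _ "run ps"] conjI ballI)
qed

end

section \<open>Brackets of the control fields\<close>

lemma partial_eq_frechet:
  assumes "smooth_on UNIV f"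
  shows "partial j (\<lambda>y. f y $ i) x = fderiv f x (axis j 1) $ i"
proof -
  have l: "((\<lambda>t::real. x + t *\<^sub>R axis j 1) has_derivative (\<lambda>t. t *\<^sub>R axis j 1)) (at 0)"
    by (auto intro!: derivative_eq_intros)
  have "(f has_derivative fderiv f x) (at (x + 0 *\<^sub>R axis j 1))"
    using smooth_on_has_derivative[OF assms UNIV_I, of x] by simp
  from has_derivative_compose[OF l this]
  have d: "((\<lambda>t. f (x + t *\<^sub>R axis j 1)) has_derivative (\<lambda>t. fderiv f x (t *\<^sub>R axis j 1))) (at 0)" .
  interpret bounded_linear "fderiv f x"
    by (rule has_derivative_bounded_linear[OF smooth_on_has_derivative[OF assms UNIV_I]])
  have "((\<lambda>t. f (x + t *\<^sub>R axis j 1) $ i) has_derivative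
      (\<lambda>t. fderiv f x (t *\<^sub>R axis j 1) $ i)) (at 0)"
    by (rule bounded_linear.has_derivative[OF bounded_linear_vec_nth d])
  then have "((\<lambda>t. f (x + t *\<^sub>R axis j 1) $ i) has_real_derivative
      fderiv f x (axis j 1) $ i) (at 0)"
    by (simp add: has_field_derivative_def scale mult.commute[of _ "fderiv f x (axis j 1) $ i"])
  then show ?thesis
    unfolding partial_def by (rule DERIV_imp_deriv)
qed

text \<open>Brings the coordinate formula into the form in which the commutator of flows delivers
  the bracket.\<close>

lemma lie_bracket_eq_frechet:
  fixes f h :: "real ^ 'd::finite \<Rightarrow> real ^ 'd"
  assumes f: "smooth_on UNIV f" and h: "smooth_on UNIV h"
  shows "lie_bracket f h x = fderiv h x (f x) - fderiv f x (h x)"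
proof -
  have expand: "L v = (\<Sum>j\<in>UNIV. v $ j *\<^sub>R L (axis j 1))"
    if "bounded_linear L" for L :: "real ^ 'd \<Rightarrow> real ^ 'd" and v
  proof -
    interpret bounded_linear L by (rule that)
    have "v = (\<Sum>j\<in>UNIV. v $ j *\<^sub>R axis j 1)"
      using basis_expansion[of v] by (simp add: scalar_mult_eq_scaleR)
    then have "L v = L (\<Sum>j\<in>UNIV. v $ j *\<^sub>R axis j 1)" by (rule arg_cong)
    then show ?thesis by (simp only: sum scale)
  qed
  have b: "bounded_linear (fderiv f x)" "bounded_linear (fderiv h x)"
    by (rule has_derivative_bounded_linear[OF smooth_on_has_derivative[OF f UNIV_I]],
        rule has_derivative_bounded_linear[OF smooth_on_has_derivative[OF h UNIV_I]])
  show ?thesis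
    unfolding expand[OF b(1), of "h x"] expand[OF b(2), of "f x"] lie_bracket_def vec_eq_iff
    by (simp add: partial_eq_frechet[OF f] partial_eq_frechet[OF h] sum_subtractf)
qed

lemma smooth_on_lie_bracket:
  assumes f: "smooth_on UNIV f" and h: "smooth_on UNIV h"
  shows "smooth_on UNIV (lie_bracket f h)"
proof -
  have "smooth_on UNIV (\<lambda>x. fderiv h x (f x) + - fderiv f x (h x))"
    by (rule smooth_on_add[OF open_UNIV smooth_on_derivative_along[OF open_UNIV h f]
          smooth_on_minus[OF open_UNIV smooth_on_derivative_along[OF open_UNIV f h]]])
  moreover have "lie_bracket f h = (\<lambda>x. fderiv h x (f x) + - fderiv f x (h x))"
    by (rule ext) (simp add: lie_bracket_eq_frechet[OF f h])
  ultimately show ?thesis by simp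
qed

section \<open>Approximability of multiples of brackets\<close>

context neural_control begin

sublocale sg: map_semigroup M realizable
  by (rule map_semigroup_realizable)

text \<open>A step of length \<open>s\<close> is the unit-time flow of the control with amplitudes
  multiplied by \<open>s\<close>, which is again an admissible control.\<close>

lemma nf_approximable: "sg.approximable (nf p)"
proof -
  obtain L B where LB: "L > 0" "B > 0" "L-lipschitz_on M (nf p)" "\<And>x. x \<in> M \<Longrightarrow> norm (nf p x) \<le> B"
    by (rule nf_bounds[of p]) (rule that)
  show ?thesis
  proof (rule sg.approximable_quadratic[where C = "L * B"])
    show "continuous_on M (nf p)" by (rule lipschitz_on_continuous_on[OF LB(3)])
    fix s :: real assume s: "0 < s" "s \<le> 1"
    define q where "q = (\<lambda>i. s * fst p i, snd p)"
    have q: "nf q x = s *\<^sub>R nf p x" for x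
      by (simp add: neural_field_def q_def scaleR_sum_right mult.assoc)
    \<comment> \<open>Both the Lipschitz constant and the bound scale with \<open>s\<close>; their
      product is the quadratic error.\<close>
    have lip: "(s * L)-lipschitz_on M (nf q)"
      using lipschitz_on_cmult[OF LB(3), of s] s by (simp add: q[abs_def])
    have bnd: "norm (nf q x) \<le> s * B" if "x \<in> M" for x
      using LB(4)[OF that] s by (simp add: q mult_left_mono)
    have "norm (nflow q 1 x - x - s *\<^sub>R nf p x) \<le> L * B * s\<^sup>2" if x: "x \<in> M" for x
      using flow_on_expansion[OF nflow lip bnd x, of 0 1] nflow_0[OF x, of q]
      by (simp add: q power2_eq_square mult_ac)
    moreover have "nflow q 1 \<in> sg.cl"
    proof (rule sg.subset_cl)
      have "nflow q 1 = run [q]" by (rule ext) simp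
      then show "nflow q 1 \<in> realizable" unfolding realizable_def by simp
    qed
    ultimately show "\<exists>P\<in>sg.cl. \<forall>x\<in>M. norm (P x - x - s *\<^sub>R nf p x) \<le> L * B * s\<^sup>2"
      by (intro bexI[of _ "nflow q 1"]) simp_all
  qed
qed

text \<open>A control applies one neuron to each field at a time, while \<open>h\<close> sums many.
  Closure under sums lets the neurons act one after the other.\<close>

lemma superposition_approximable:
  assumes h: "h \<in> superpositions \<sigma>" and i: "i \<in> {1..m}"
  shows "sg.approximable (\<lambda>x. h x *\<^sub>R g i x)"
proof -
  obtain n :: nat and \<alpha> b :: "nat \<Rightarrow> real" and w :: "nat \<Rightarrow> real ^ 'd" where h_eq: "h = (\<lambda>x. \<Sum>j=1..n. \<alpha> j * \<sigma> (w j \<bullet> x + b j))"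
    using h unfolding superpositions_def by (elim CollectE exE conjE) (rule that)
  \<comment> \<open>Zero amplitudes switch off all fields except the one with number
    \<open>i\<close>.\<close>
  define p :: "nat \<Rightarrow> 'd control" where
    "p j = (\<lambda>i'. if i' = i then \<alpha> j else 0, \<lambda>i'. w j, \<lambda>i'. b j)" for j
  have nfp: "nf (p j) x = (\<alpha> j * \<sigma> (w j \<bullet> x + b j)) *\<^sub>R g i x" for j x
  proof -
    have "nf (p j) x = (\<Sum>i'=1..m. if i' = i then (\<alpha> j * \<sigma> (w j \<bullet> x + b j)) *\<^sub>R g i x else 0)"
      unfolding neural_field_def p_def by (intro sum.cong) auto
    also have "\<dots> = (\<alpha> j * \<sigma> (w j \<bullet> x + b j)) *\<^sub>R g i x"
      using i by (subst sum.delta) auto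
    finally show ?thesis .
  qed
  have "sg.approximable (\<lambda>x. \<Sum>j=1..n. nf (p j) x)"
    by (rule sg.approximable_sum) (rule nf_approximable)
  moreover have "(\<lambda>x. \<Sum>j=1..n. nf (p j) x) = (\<lambda>x. h x *\<^sub>R g i x)"
    by (simp add: nfp h_eq scaleR_sum_left)
  ultimately show ?thesis by simp
qed

lemma superposition_continuous:
  fixes h :: "real ^ 'd \<Rightarrow> real"
  assumes "h \<in> superpositions \<sigma>"
  shows "continuous_on UNIV h"
proof -
  obtain n :: nat and \<alpha> b :: "nat \<Rightarrow> real" and w :: "nat \<Rightarrow> real ^ 'd" where h_eq: "h = (\<lambda>x. \<Sum>j=1..n. \<alpha> j * \<sigma> (w j \<bullet> x + b j))"
    using assms unfolding superpositions_def by (elim CollectE exE conjE) (rule that)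
  obtain K where K: "K > 0" "\<And>x y. \<bar>\<sigma> x - \<sigma> y\<bar> \<le> K * \<bar>x - y\<bar>"
    using regular unfolding regular_activation_def by blast
  have "K-lipschitz_on UNIV \<sigma>"
    using K by (intro lipschitz_onI) (auto simp: dist_real_def)
  then have "continuous_on UNIV \<sigma>" by (rule lipschitz_on_continuous_on)
  then have "continuous_on UNIV (\<lambda>x. \<sigma> (w j \<bullet> x + b j))" for j
    by (rule continuous_on_compose2) (auto intro!: continuous_intros)
  then show ?thesis unfolding h_eq by (intro continuous_intros)
qed

text \<open>Density gives the bound almost everywhere. By continuity the set where it fails is open
  in the ball, and an open null set is empty.\<close>

lemma dense_superpositions_uniform:
  fixes c :: "real ^ 'd \<Rightarrow> real"
  assumes dense: "dense_superpositions TYPE('d) \<sigma>" and c: "smooth_on UNIV c" and e: "e > 0"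
  obtains h where "h \<in> superpositions \<sigma>" "\<And>x. x \<in> M \<Longrightarrow> \<bar>c x - h x\<bar> \<le> e"
proof -
  obtain r where r: "r > 0" "M \<subseteq> ball 0 r"
    using bounded_subset_ballD[OF compact_imp_bounded[OF compact_M], of 0] by blast
  have "Ck_on 1 UNIV c" using c by (simp add: smooth_on_def)
  then obtain h where h: "h \<in> superpositions \<sigma>"
    "AE x in lebesgue. norm x < r \<longrightarrow> (\<forall>i. has_partial i h x) \<and>
       \<bar>c x - h x\<bar> + (\<Sum>i\<in>UNIV. \<bar>partial i c x - partial i h x\<bar>) < e"
    using dense[unfolded dense_superpositions_def, rule_format, of c r e] r(1) e by blast
  have ae: "AE x in lebesgue. \<not> (norm x < r \<and> \<bar>c x - h x\<bar> > e)"
    using h(2)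
  proof eventually_elim
    case (elim x)
    have "0 \<le> (\<Sum>i\<in>UNIV. \<bar>partial i c x - partial i h x\<bar>)" by (simp add: sum_nonneg)
    moreover have "norm x < r \<Longrightarrow> \<bar>c x - h x\<bar> + (\<Sum>i\<in>UNIV. \<bar>partial i c x - partial i h x\<bar>) < e"
      using elim by simp
    ultimately show ?case by linarith
  qed
  define S where "S = ball 0 r \<inter> {x. \<bar>c x - h x\<bar> > e}"
  have "open {x. \<bar>c x - h x\<bar> > e}"
    by (intro open_Collect_less continuous_intros smooth_on_continuous_on[OF c] superposition_continuous h(1))
  then have "open S" unfolding S_def by (intro open_Int open_ball)
  moreover have "negligible S"
  proof -
    have "AE x in lebesgue. x \<notin> S" using ae by (simp add: S_def)
    then obtain N where "N \<in> null_sets lebesgue" "S \<subseteq> N" by (auto simp: eventually_ae_filter)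
    then have "negligible N" by (simp add: negligible_iff_null_sets)
    then show ?thesis using \<open>S \<subseteq> N\<close> by (rule negligible_subset)
  qed
  ultimately have "S = {}" using open_not_negligible by blast
  then have "\<bar>c x - h x\<bar> \<le> e" if "x \<in> M" for x
    using r(2) that by (force simp: S_def)
  then show thesis using that h(1) by blast
qed

lemma flow_exists:
  assumes "smooth_on UNIV W" "\<And>x. x \<in> M \<Longrightarrow> W x \<in> tangent_space M x"
  obtains \<Phi> where "flow_on M W \<Phi>"
proof -
  obtain \<Phi> where "flow_on M W \<Phi>"
    by (rule flow_on_exists[OF smooth_on_lipschitz_on_balls[OF assms(1)] compact_M assms(2)])
  then show thesis by (rule that)
qed

lemma approximable_lie_bracket:
  assumes f: "smooth_on UNIV f" and h: "smooth_on UNIV h"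
    and tan: "\<And>x. x \<in> M \<Longrightarrow> f x \<in> tangent_space M x" "\<And>x. x \<in> M \<Longrightarrow> h x \<in> tangent_space M x"
    and app: "sg.approximable f" "sg.approximable h"
      "sg.approximable (\<lambda>x. - f x)" "sg.approximable (\<lambda>x. - h x)"
  shows "sg.approximable (\<lambda>x. fderiv h x (f x) - fderiv f x (h x))"
proof -
  obtain \<Phi> where 1: "flow_on M f \<Phi>" by (rule flow_exists[OF f tan(1)])
  obtain \<Psi> where 2: "flow_on M h \<Psi>" by (rule flow_exists[OF h tan(2)])
  have "- f x \<in> tangent_space M x" "- h x \<in> tangent_space M x" if "x \<in> M" for x
    by (rule subspace_neg[OF tangent_subspace[OF that] tan(1)[OF that]],
        rule subspace_neg[OF tangent_subspace[OF that] tan(2)[OF that]])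
  note neg = this
  obtain \<Phi>' where 3: "flow_on M (\<lambda>x. - f x) \<Phi>'"
    by (rule flow_exists[OF smooth_on_minus[OF open_UNIV f] neg(1)])
  obtain \<Psi>' where 4: "flow_on M (\<lambda>x. - h x) \<Psi>'"
    by (rule flow_exists[OF smooth_on_minus[OF open_UNIV h] neg(2)])
  show ?thesis by (rule sg.approximable_bracket[OF f h 1 2 3 4 app])
qed

text \<open>
  Multiplication by functions is what makes brackets manageable:
  \<open>c [f, h] = [c f, h] + (Dc h) f\<close>, where the coefficient \<open>Dc h\<close> is smooth again.
\<close>

lemma bracket_level_approximable:
  assumes dense: "dense_superpositions TYPE('d) \<sigma>"
  shows "B \<in> bracket_level (g ` {1..m}) l \<Longrightarrow>
    smooth_on UNIV B \<and> (\<forall>c. smooth_on UNIV c \<longrightarrow> sg.approximable (\<lambda>x. c x *\<^sub>R B x))"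
proof (induction l arbitrary: B rule: less_induct)
  case (less l)
  show ?case
  proof (cases "l = 0")
    case True
    then obtain i where i: "i \<in> {1..m}" "B = g i"
      using less.prems by (auto simp: bracket_level.simps)
    have "sg.approximable (\<lambda>x. c x *\<^sub>R g i x)" if c: "smooth_on UNIV c" for c
    proof (rule sg.approximable_limit)
      show "continuous_on M (\<lambda>x. c x *\<^sub>R g i x)"
        by (rule continuous_on_subset[OF _ subset_UNIV],
            intro continuous_intros smooth_on_continuous_on c smooth_g i(1))
      fix e :: real assume e: "e > 0"
      obtain G where G: "G > 0" "\<And>x. x \<in> M \<Longrightarrow> norm (g i x) \<le> G"
        using compact_continuous_bound[OF compact_M
            continuous_on_subset[OF smooth_on_continuous_on[OF smooth_g[OF i(1)]] subset_UNIV]] by blast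
      have "e / G > 0" using e G(1) by simp
      then obtain h where h: "h \<in> superpositions \<sigma>" "\<And>x. x \<in> M \<Longrightarrow> \<bar>c x - h x\<bar> \<le> e / G"
        by (rule dense_superpositions_uniform[OF dense c]) (rule that)
      have "norm (c x *\<^sub>R g i x - h x *\<^sub>R g i x) \<le> e" if x: "x \<in> M" for x
      proof -
        have "norm (c x *\<^sub>R g i x - h x *\<^sub>R g i x) = \<bar>c x - h x\<bar> * norm (g i x)"
          by (simp add: scaleR_diff_left[symmetric])
        also have "\<dots> \<le> (e / G) * G" using h(2)[OF x] G(2)[OF x] e G(1) by (intro mult_mono) auto
        finally show ?thesis using G(1) by simp
      qed
      then show "\<exists>V. sg.approximable V \<and> (\<forall>x\<in>M. norm (c x *\<^sub>R g i x - V x) \<le> e)"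
        by (intro exI[of _ "\<lambda>x. h x *\<^sub>R g i x"] conjI superposition_approximable[OF h(1) i(1)]) simp
    qed
    then show ?thesis using smooth_g[OF i(1)] i(2) by simp
  next
    case False
    from less.prems False have "B \<in> {lie_bracket f h | f h.
        f \<in> (\<Union>j\<in>{..<l}. bracket_level (g ` {1..m}) j) \<and> h \<in> (\<Union>j\<in>{..<l}. bracket_level (g ` {1..m}) j)}"
      by (subst (asm) bracket_level.simps) simp
    then obtain f h j j' where B: "B = lie_bracket f h"
      and fh: "f \<in> bracket_level (g ` {1..m}) j" "j < l" "h \<in> bracket_level (g ` {1..m}) j'" "j' < l"
      by auto
    have sf: "smooth_on UNIV f" and sh: "smooth_on UNIV h"
      using less.IH[OF fh(2,1)] less.IH[OF fh(4,3)] by simp_all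
    have af: "sg.approximable (\<lambda>x. c x *\<^sub>R f x)" if "smooth_on UNIV c" for c
      using less.IH[OF fh(2,1)] that by simp
    have ah: "sg.approximable (\<lambda>x. c x *\<^sub>R h x)" if "smooth_on UNIV c" for c
      using less.IH[OF fh(4,3)] that by simp
    have "sg.approximable (\<lambda>x. c x *\<^sub>R B x)" if c: "smooth_on UNIV c" for c
    proof -
      have scf: "smooth_on UNIV (\<lambda>x. c x *\<^sub>R f x)"
        by (rule smooth_on_scaleR[OF open_UNIV c sf])
      \<comment> \<open>The coefficients -1 and 1 give both signs of \<open>h\<close>, so that its
        backward flow is at hand too.\<close>
      have "sg.approximable (\<lambda>x. (-1) *\<^sub>R h x)" "sg.approximable (\<lambda>x. 1 *\<^sub>R h x)"
        by (rule ah[OF smooth_on_const])+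
      then have hh: "sg.approximable (\<lambda>x. - h x)" "sg.approximable h" by simp_all
      have "sg.approximable (\<lambda>x. (- c x) *\<^sub>R f x)"
        by (rule af[OF smooth_on_minus[OF open_UNIV c]])
      then have mcf: "sg.approximable (\<lambda>x. - (c x *\<^sub>R f x))" by simp
      have tcf: "c x *\<^sub>R f x \<in> tangent_space M x" if "x \<in> M" for x
        by (rule subspace_scale[OF tangent_subspace[OF that] bracket_tangent[OF that fh(1)]])
      have br: "sg.approximable (\<lambda>x. fderiv h x (c x *\<^sub>R f x)
          - fderiv (\<lambda>x. c x *\<^sub>R f x) x (h x))"
        by (rule approximable_lie_bracket[OF scf sh tcf bracket_tangent[OF _ fh(3)] af[OF c] hh(2) mcf hh(1)])
      have "sg.approximable (\<lambda>x. fderiv c x (h x) *\<^sub>R f x)"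
        by (rule af[OF smooth_on_derivative_along[OF open_UNIV c sh]])
      from sg.approximable_add[OF br this] show ?thesis
      proof (rule sg.approximable_cong)
        fix x
        interpret bounded_linear "fderiv h x"
          by (rule has_derivative_bounded_linear[OF smooth_on_has_derivative[OF sh UNIV_I]])
        have "((\<lambda>x. c x *\<^sub>R f x) has_derivative
          (\<lambda>v. c x *\<^sub>R fderiv f x v + fderiv c x v *\<^sub>R f x)) (at x)"
          by (rule has_derivative_scaleR[OF smooth_on_has_derivative[OF c UNIV_I] smooth_on_has_derivative[OF sf UNIV_I]])
        from frechet_derivative_at[OF this, symmetric]
        have "fderiv (\<lambda>x. c x *\<^sub>R f x) x (h x)
            = c x *\<^sub>R fderiv f x (h x) + fderiv c x (h x) *\<^sub>R f x"
          by (rule fun_cong)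
        then show "c x *\<^sub>R B x = fderiv h x (c x *\<^sub>R f x)
            - fderiv (\<lambda>x. c x *\<^sub>R f x) x (h x) + fderiv c x (h x) *\<^sub>R f x"
          by (simp add: B lie_bracket_eq_frechet[OF sf sh] scale algebra_simps)
      qed
    qed
    then show ?thesis using smooth_on_lie_bracket[OF sf sh] B by simp
  qed
qed

section \<open>Continuous tangent fields\<close>

text \<open>Polynomials are smooth coefficients and are uniformly dense on \<open>M\<close> by
  Stone-Weierstrass. Continuous coefficients are what the partition of unity requires.\<close>

lemma continuous_multiple_approximable:
  assumes dense: "dense_superpositions TYPE('d) \<sigma>"
    and B: "B \<in> bracket_level (g ` {1..m}) l" and c: "continuous_on M c"
  shows "sg.approximable (\<lambda>x. c x *\<^sub>R B x)"
proof (rule sg.approximable_limit)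
  have sB: "smooth_on UNIV B" using bracket_level_approximable[OF dense B] by simp
  have cB: "continuous_on M B"
    by (rule continuous_on_subset[OF smooth_on_continuous_on[OF sB] subset_UNIV])
  show "continuous_on M (\<lambda>x. c x *\<^sub>R B x)" by (intro continuous_intros c cB)
  fix e :: real assume e: "e > 0"
  obtain G where G: "G > 0" "\<And>x. x \<in> M \<Longrightarrow> norm (B x) \<le> G"
    using compact_continuous_bound[OF compact_M cB] by blast
  have eG: "0 < e / G" using e G(1) by simp
  obtain q where q: "real_polynomial_function q" "\<And>x. x \<in> M \<Longrightarrow> \<bar>c x - q x\<bar> < e / G"
    by (rule Stone_Weierstrass_real_polynomial_function[OF compact_M c eG]) (rule that)
  have "norm (c x *\<^sub>R B x - q x *\<^sub>R B x) \<le> e" if x: "x \<in> M" for x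
  proof -
    have "norm (c x *\<^sub>R B x - q x *\<^sub>R B x) = \<bar>c x - q x\<bar> * norm (B x)"
      by (simp add: scaleR_diff_left[symmetric])
    also have "\<dots> \<le> (e / G) * G" using q(2)[OF x] G(2)[OF x] e G(1) by (intro mult_mono) auto
    finally show ?thesis using G(1) by simp
  qed
  moreover have "sg.approximable (\<lambda>x. q x *\<^sub>R B x)"
    using bracket_level_approximable[OF dense B] smooth_on_polynomial[OF q(1)] by simp
  ultimately show "\<exists>V. sg.approximable V \<and> (\<forall>x\<in>M. norm (c x *\<^sub>R B x - V x) \<le> e)"
    by (intro exI[of _ "\<lambda>x. q x *\<^sub>R B x"]) simp
qed

text \<open>A representation of \<open>v\<close> in the span at \<open>x\<close> is a finite
  combination of bracket values; the same constants applied to the bracket fields extend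
  \<open>v\<close> to a field whose continuous multiples remain approximable.\<close>

lemma tangent_vector_extension:
  assumes dense: "dense_superpositions TYPE('d) \<sigma>" and x: "x \<in> M" and v: "v \<in> tangent_space M x"
  obtains W where "continuous_on M W" "W x = v"
    "\<And>c. continuous_on M c \<Longrightarrow> sg.approximable (\<lambda>y. c y *\<^sub>R W y)"
proof -
  define S where "S = {B. \<exists>l. B \<in> bracket_level (g ` {1..m}) l}"
  have "v \<in> span ((\<lambda>B. B x) ` S)"
  proof -
    have "(\<lambda>B. B x) ` S = {B x | B. \<exists>l. B \<in> bracket_level (g ` {1..m}) l}" by (auto simp: S_def)
    then show ?thesis using v Lie[OF x] by (simp add: Lie_at_def)
  qed
  then obtain t r where t: "finite t" "t \<subseteq> (\<lambda>B. B x) ` S" "v = (\<Sum>a\<in>t. r a *\<^sub>R a)"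
    unfolding span_explicit by blast
  have "\<forall>a\<in>t. \<exists>B. B \<in> S \<and> B x = a" using t(2) by blast
  \<comment> \<open>For each vector of the representation, a bracket field taking this value at
    \<open>x\<close>.\<close>
  from bchoice[OF this] obtain E where E: "\<forall>a\<in>t. E a \<in> S \<and> E a x = a" by blast
  have app: "sg.approximable (\<lambda>y. \<Sum>a\<in>t. (c y * r a) *\<^sub>R E a y)" if c: "continuous_on M c" for c
  proof (rule sg.approximable_sum)
    fix a assume "a \<in> t"
    then obtain l where "E a \<in> bracket_level (g ` {1..m}) l" using E by (auto simp: S_def)
    from continuous_multiple_approximable[OF dense this, of "\<lambda>y. c y * r a"]
    show "sg.approximable (\<lambda>y. (c y * r a) *\<^sub>R E a y)"
      using continuous_on_mult[OF c continuous_on_const] by blast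
  qed
  show thesis
  proof (rule that[of "\<lambda>y. \<Sum>a\<in>t. r a *\<^sub>R E a y"])
    show "continuous_on M (\<lambda>y. \<Sum>a\<in>t. r a *\<^sub>R E a y)"
      using sg.approximable_continuous[OF app[OF continuous_on_const[of M 1]]] by simp
    show "(\<Sum>a\<in>t. r a *\<^sub>R E a x) = v" unfolding t(3) using E by (intro sum.cong) auto
    show "sg.approximable (\<lambda>y. c y *\<^sub>R (\<Sum>a\<in>t. r a *\<^sub>R E a y))" if "continuous_on M c" for c
      using app[OF that] by (simp add: scaleR_sum_right)
  qed
qed

text \<open>Near each point an approximable local extension is within \<open>e\<close> of
  \<open>V\<close>; a convex combination of such fields with continuous weights keeps the error
  \<open>e\<close>. The local fields need to match \<open>V\<close> at one point only, so no frame
  of constant rank has to be selected.\<close>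

lemma tangent_field_approximable:
  assumes dense: "dense_superpositions TYPE('d) \<sigma>" and V: "continuous_on M V"
    and tan: "\<And>y. y \<in> M \<Longrightarrow> V y \<in> tangent_space M y"
  shows "sg.approximable V"
proof (rule sg.approximable_limit[OF V])
  fix e :: real assume e: "e > 0"
  have "\<forall>x\<in>M. \<exists>W d. d > 0 \<and> (\<forall>y\<in>M. dist y x < d \<longrightarrow> norm (V y - W y) \<le> e) \<and>
      (\<forall>c. continuous_on M c \<longrightarrow> sg.approximable (\<lambda>y. c y *\<^sub>R W y))"
  proof
    fix x assume x: "x \<in> M"
    obtain W where W: "continuous_on M W" "W x = V x"
      "\<And>c. continuous_on M c \<Longrightarrow> sg.approximable (\<lambda>y. c y *\<^sub>R W y)"
      by (rule tangent_vector_extension[OF dense x tan[OF x]]) (rule that)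
    have "continuous_on M (\<lambda>y. V y - W y)" by (intro continuous_intros V W(1))
    from this[unfolded continuous_on_iff, rule_format, OF x e]
    obtain d where d: "d > 0" "\<forall>y\<in>M. dist y x < d \<longrightarrow> dist (V y - W y) (V x - W x) < e" by blast
    then have "\<forall>y\<in>M. dist y x < d \<longrightarrow> norm (V y - W y) \<le> e"
      using W(2) by (auto simp: dist_norm intro: less_imp_le)
    then show "\<exists>W d. d > 0 \<and> (\<forall>y\<in>M. dist y x < d \<longrightarrow> norm (V y - W y) \<le> e) \<and>
      (\<forall>c. continuous_on M c \<longrightarrow> sg.approximable (\<lambda>y. c y *\<^sub>R W y))"
      using d(1) W(3) by (intro exI[of _ W] exI[of _ d] conjI allI impI)
  qed
  from bchoice[OF this] obtain W where "\<forall>x\<in>M. \<exists>d. d > 0 \<and>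
      (\<forall>y\<in>M. dist y x < d \<longrightarrow> norm (V y - W x y) \<le> e) \<and>
      (\<forall>c. continuous_on M c \<longrightarrow> sg.approximable (\<lambda>y. c y *\<^sub>R W x y))"
    by blast
  from bchoice[OF this] obtain d where Wd: "\<forall>x\<in>M. d x > 0 \<and>
      (\<forall>y\<in>M. dist y x < d x \<longrightarrow> norm (V y - W x y) \<le> e) \<and>
      (\<forall>c. continuous_on M c \<longrightarrow> sg.approximable (\<lambda>y. c y *\<^sub>R W x y))"
    by blast
  have cover: "M \<subseteq> (\<Union>x\<in>M. ball x (d x))" using Wd by (auto intro!: UN_I)
  obtain C where C: "C \<subseteq> M" "finite C" "M \<subseteq> (\<Union>x\<in>C. ball x (d x))"
    by (rule compactE_image[OF compact_M open_ball cover]) (rule that)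
  \<comment> \<open>Tent functions supported in the balls of the finite cover; their sum is positive
    on \<open>M\<close>, and dividing by it gives the weights.\<close>
  define \<rho> where "\<rho> x y = max 0 (d x - dist x y)" for x y
  define S where "S y = (\<Sum>x\<in>C. \<rho> x y)" for y
  have \<rho>0: "\<rho> x y \<ge> 0" for x y by (simp add: \<rho>_def)
  have S0: "S y > 0" if y: "y \<in> M" for y
  proof -
    obtain x where x: "x \<in> C" "dist x y < d x" using C(3) y by auto
    then have "0 < \<rho> x y" by (simp add: \<rho>_def)
    then show ?thesis unfolding S_def using x(1) C(2) \<rho>0 by (intro sum_pos2[of C x])
  qed
  have cont: "continuous_on M (\<lambda>y. \<rho> x y / S y)" for x
  proof (rule continuous_on_divide)
    have r: "continuous_on M (\<rho> x)" for x unfolding \<rho>_def by (intro continuous_intros)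
    then show "continuous_on M (\<lambda>y. \<rho> x y)" .
    show "continuous_on M S" unfolding S_def by (intro continuous_on_sum r)
    show "\<forall>y\<in>M. S y \<noteq> 0" using S0 by force
  qed
  have "sg.approximable (\<lambda>y. \<Sum>x\<in>C. (\<rho> x y / S y) *\<^sub>R W x y)"
  proof (rule sg.approximable_sum)
    fix x assume "x \<in> C"
    then have "x \<in> M" using C(1) by blast
    then show "sg.approximable (\<lambda>y. (\<rho> x y / S y) *\<^sub>R W x y)" using Wd cont[of x] by blast
  qed
  moreover have "norm (V y - (\<Sum>x\<in>C. (\<rho> x y / S y) *\<^sub>R W x y)) \<le> e" if y: "y \<in> M" for y
  proof -
    have one: "(\<Sum>x\<in>C. \<rho> x y / S y) = 1"
      using S0[OF y] by (simp add: sum_divide_distrib[symmetric] S_def)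
    then have "V y = (\<Sum>x\<in>C. (\<rho> x y / S y) *\<^sub>R V y)"
      by (simp only: scaleR_sum_left[symmetric] scaleR_one)
    then have "V y - (\<Sum>x\<in>C. (\<rho> x y / S y) *\<^sub>R W x y) = (\<Sum>x\<in>C. (\<rho> x y / S y) *\<^sub>R (V y - W x y))"
      by (simp add: sum_subtractf scaleR_diff_right)
    also have "norm \<dots> \<le> (\<Sum>x\<in>C. (\<rho> x y / S y) * e)"
    proof (rule sum_norm_le)
      fix x assume x: "x \<in> C"
      show "norm ((\<rho> x y / S y) *\<^sub>R (V y - W x y)) \<le> (\<rho> x y / S y) * e"
      proof (cases "dist x y < d x")
        case True
        have "x \<in> M" using x C(1) by blast
        with Wd y True have "norm (V y - W x y) \<le> e" by (simp add: dist_commute)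
        moreover have q: "0 \<le> \<rho> x y / S y" using \<rho>0[of x y] S0[OF y] by simp
        ultimately have "(\<rho> x y / S y) * norm (V y - W x y) \<le> (\<rho> x y / S y) * e"
          by (rule mult_left_mono)
        then show ?thesis using q by (simp only: norm_scaleR real_norm_def abs_of_nonneg)
      next
        case False
        then show ?thesis by (simp add: \<rho>_def)
      qed
    qed
    also have "\<dots> = e" using one by (simp only: sum_distrib_right[symmetric] mult_1)
    finally show ?thesis .
  qed
  ultimately show "\<exists>U. sg.approximable U \<and> (\<forall>y\<in>M. norm (V y - U y) \<le> e)"
    by (intro exI[of _ "\<lambda>y. \<Sum>x\<in>C. (\<rho> x y / S y) *\<^sub>R W x y"]) simp
qed

lemma Diff0_in_cl:
  assumes dense: "dense_superpositions TYPE('d) \<sigma>" and Y: "Y \<in> Diff0 M"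
  shows "Y \<in> sg.cl"
proof -
  obtain H :: "real \<times> (real ^ 'd) \<Rightarrow> real ^ 'd" where H: "smooth_map_on ({0..1} \<times> M) H" "\<forall>t\<in>{0..1}. diffeo_on M (\<lambda>x. H (t, x))"
    "\<forall>x\<in>M. H (0, x) = x" "\<forall>x\<in>M. H (1, x) = Y x"
    using Y unfolding Diff0_def by (elim CollectE exE conjE) (rule that)
  interpret isotopy M H
    by unfold_locales (use compact_M H in auto)
  have "(\<lambda>x. H (1, x)) \<in> sg.cl"
    by (rule isotopy_end_in_cl[OF map_semigroup_realizable tangent_field_approximable[OF dense]]) (use H(3) in auto)
  then show ?thesis by (rule sg.cl_cong) (use H(4) in simp)
qed

end

theorem theorem5:
  fixes M :: "(real ^ 'd) set"
    and k m :: nat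
    and g :: "nat \<Rightarrow> real ^ 'd \<Rightarrow> real ^ 'd"
    and \<sigma> :: "real \<Rightarrow> real"
    and Y :: "real ^ 'd \<Rightarrow> real ^ 'd"
    and \<epsilon> :: real
  assumes "smooth_submanifold k M" and "compact M"
    and "\<And>i. i \<in> {1..m} \<Longrightarrow> smooth_on UNIV (g i)"
    and "\<And>i x. i \<in> {1..m} \<Longrightarrow> x \<in> M \<Longrightarrow> g i x \<in> tangent_space M x"
    and "\<And>x. x \<in> M \<Longrightarrow> Lie_at (g ` {1..m}) x = tangent_space M x"
    and "regular_activation \<sigma>" and "dense_superpositions TYPE('d) \<sigma>"
    and "Y \<in> Diff0 M" and "\<epsilon> > 0"
  shows "\<exists>(a :: nat \<Rightarrow> real \<Rightarrow> real) (w :: nat \<Rightarrow> real \<Rightarrow> real ^ 'd) (b :: nat \<Rightarrow> real \<Rightarrow> real).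
      (\<forall>i\<in>{1..m}. piecewise_constant (a i) \<and> piecewise_constant (w i) \<and> piecewise_constant (b i)) \<and>
      (\<exists>X. is_flow_map M
             (\<lambda>t x. \<Sum>i=1..m. (a i t * \<sigma> (w i t \<bullet> x + b i t)) *\<^sub>R g i x) X \<and>
           (SUP x\<in>M. ereal (norm (X x - Y x))) \<le> ereal (\<epsilon> / 2))"
proof -
  interpret neural_control M m g \<sigma>
    by unfold_locales (use assms in auto)
  have "\<epsilon> / 2 > 0" using assms(9) by simp
  from sg.cl_approx[OF Diff0_in_cl[OF assms(7,8)] this]
  obtain X where X: "X \<in> realizable" "\<forall>x\<in>M. norm (Y x - X x) \<le> \<epsilon> / 2" by blast
  from realizable_controls[OF X(1)] obtain a :: "nat \<Rightarrow> real \<Rightarrow> real"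
    and w :: "nat \<Rightarrow> real \<Rightarrow> real ^ 'd" and b :: "nat \<Rightarrow> real \<Rightarrow> real" and X'
    where pc: "\<forall>i\<in>{1..m}. piecewise_constant (a i) \<and> piecewise_constant (w i) \<and> piecewise_constant (b i)"
      and fl: "is_flow_map M (\<lambda>t x. \<Sum>i=1..m. (a i t * \<sigma> (w i t \<bullet> x + b i t)) *\<^sub>R g i x) X'"
      and eq: "\<forall>x\<in>M. X' x = X x"
    by (elim exE conjE) (rule that)
  \<comment> \<open>In the extended reals the supremum over an empty \<open>M\<close> is minus
    infinity, so that case is covered as well.\<close>
  have "(SUP x\<in>M. ereal (norm (X' x - Y x))) \<le> ereal (\<epsilon> / 2)"
    by (rule SUP_least) (use X(2) eq in \<open>simp add: norm_minus_commute\<close>)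
  with pc fl show ?thesis
    by (intro exI[of _ a] exI[of _ w] exI[of _ b] exI[of _ X'] conjI)
qed

end
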